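(* There is a universal constant $c_0\in(0,1)$ with the following property. Let the fixed data $N,p,\gamma,\Lambda,\delta,R,a_1,\dots,a_N,\bar Y_1,\dots,\bar Y_N$ be as in the context and suppose $R\le c_0\delta$. Then there exist $\varepsilon_0\in(0,1]$, a time $T>0$ and a constant $C>0$, all depending only on the fixed data (in particular $T$ and $C$ do not depend on $\varepsilon$ or on the solution), such that the solution $(Y_1,\dots,Y_N)$ of the point vortex system exists on $[0,T]$ and, for every $\varepsilon\in(0,\varepsilon_0]$ and every $\varepsilon$-admissible solution $(\omega,\omega_1,\dots,\omega_N)$, $$W_1\left(\omega(t),\sum_{i=1}^N a_i\delta_{Y_i(t)}\right)\le C e^{Ct}\varepsilon\qquad\text{for all } t\in[0,T].$$
   Context: Fixed data (independent of $\varepsilon$): $N\in\mathbb{N}$, $p\in(2,\infty)$, $\gamma>0$, $\Lambda>0$, $0<R<\delta$, nonzero real numbers $a_1,\dots,a_N$ (intensities), and distinct points $\bar Y_1,\dots,\bar Y_N\in\mathbb{R}^2$. Biot--Savart kernel: $K(z)=\frac{1}{2\pi}\frac{z^\perp}{|z|^2}$ with $z^\perp=(-z_2,z_1)$. Wasserstein distances: if $f$ is integrable of one sign, $a=\int f\,dx\neq0$ and $Y\in\mathbb{R}^2$, then $W_2\left(\frac{f}{a},\delta_Y\right)=\sqrt{\frac1a\int_{\mathbb{R}^2}|x-Y|^2f(x)\,dx}$ (here $\delta_Y$ is the Dirac measure, not to be confused with the number $\delta$). For (possibly signed) compactly supported finite measures $f,g$ on $\mathbb{R}^2$ with the same total mass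 (integrable functions being identified with their densities), $W_1(f,g)=\sup\left\{\int_{\mathbb{R}^2}\zeta\,d(f-g):\ \|\nabla\zeta\|_{L^\infty}\le1\right\}$, the supremum being over Lipschitz functions $\zeta$. $\varepsilon$-admissible solution. For $\varepsilon\in(0,1]$, an $\varepsilon$-admissible solution $(\omega,\omega_1,\dots,\omega_N)$ consists of the following. (i) Initial data $\bar\omega=\sum_{i=1}^N\bar\omega_i$ with each $\bar\omega_i\in L^p(\mathbb{R}^2)$ compactly supported, either $\bar\omega_i\ge0$ or $\bar\omega_i\le0$, $\int\bar\omega_i\,dx=a_i$, and $\min_{i\ne j}\operatorname{dist}(\operatorname{spt}\bar\omega_i,\operatorname{spt}\bar\omega_j)\ge\delta$. (ii) $W_2\left(\bar\omega_i/a_i,\delta_{\bar Y_i}\right)\le\varepsilon$ for all $i$. (iii) $\|\bar\omega\|_{L^p}\le\Lambda\varepsilon^{-\gamma}$. (iv) $\operatorname{spt}\bar\omega_i\subset B_R(\bar X_i)$ for all $i$, where $\bar X_i=\frac1{a_i}\int x\,\bar\omega_i(x)\,dx$ and $B_R$ denotes the open ball. (v) $\omega\in C^0([0,\infty);L^p(\mathbb{R}^2))$ is a distributional solution of the Euler vorticity equation $\partial_t\omega+u\cdot\nabla\omega=0$, $\omega(0,\cdot)=\bar\omega$, where $u(t,\cdot)=K*\omega(t,\cdot)$ (so $\nabla\cdot u=0$), and $\omega_i\in C^0([0,\infty);L^p(\mathbb{R}^2))$ is the solution of the linear transport equation $\partial_t\omega_i+u\cdot\nabla\omega_i=0$, $\omega_i(0,\cdot)=\bar\omega_i$.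 These solutions are understood to be renormalized (DiPerna--Lions) and Lagrangian, i.e. transported by the flow of $u$; in particular they are compactly supported at each time, $\omega=\sum_i\omega_i$, the sign of $\omega_i$ is preserved, $\int\omega_i(t,x)\,dx=a_i$, and $\|\omega_i(t)\|_{L^p}=\|\bar\omega_i\|_{L^p}$. Point vortex system: $(Y_1,\dots,Y_N)$ is the solution of $\frac{d}{dt}Y_i(t)=\sum_{j\ne i}a_jK(Y_i(t)-Y_j(t))$, $Y_i(0)=\bar Y_i$, $i=1,\dots,N$. *)

theory Defs
  imports "HOL-Analysis.Analysis"
begin

type_synonym plane = "real ^ 2"

definition perp :: "plane \<Rightarrow> plane" where
  "perp z = vector [- (z $ 2), z $ 1]"

text \<open>\<open>biot_savart 0 = 0\<close> by the convention \<open>1 / 0 = 0\<close>.\<close>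

definition biot_savart :: "plane \<Rightarrow> plane" where
  "biot_savart z = (1 / (2 * pi)) *\<^sub>R ((1 / (norm z)\<^sup>2) *\<^sub>R perp z)"

definition velocity :: "(plane \<Rightarrow> real) \<Rightarrow> plane \<Rightarrow> plane" where
  "velocity f x = (\<integral>y. f y *\<^sub>R biot_savart (x - y) \<partial>lborel)"


section \<open>Lebesgue spaces and supports\<close>

text \<open>Elements of \<open>L\<^sup>p\<close> are given by Borel representatives. All notions below depend only on
  the almost-everywhere class.\<close>

definition in_Lp :: "real \<Rightarrow> (plane \<Rightarrow> real) \<Rightarrow> bool" where
  "in_Lp p f \<longleftrightarrow> f \<in> borel_measurable lborel \<and> integrable lborel (\<lambda>x. \<bar>f x\<bar> powr p)"

definition Lp_norm :: "real \<Rightarrow> (plane \<Rightarrow> real) \<Rightarrow> real" where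
  "Lp_norm p f = (\<integral>x. \<bar>f x\<bar> powr p \<partial>lborel) powr (1 / p)"

definition continuous_Lp :: "real \<Rightarrow> (real \<Rightarrow> plane \<Rightarrow> real) \<Rightarrow> bool" where
  "continuous_Lp p f \<longleftrightarrow>
     (\<forall>t\<ge>0. in_Lp p (f t)) \<and>
     (\<forall>t\<ge>0. ((\<lambda>s. Lp_norm p (\<lambda>x. f s x - f t x)) \<longlongrightarrow> 0) (at t within {0..}))"

definition spt :: "(plane \<Rightarrow> real) \<Rightarrow> plane set" where
  "spt f = - \<Union>{U. open U \<and> (AE x in lborel. x \<in> U \<longrightarrow> f x = 0)}"

definition one_signed :: "(plane \<Rightarrow> real) \<Rightarrow> bool" where
  "one_signed f \<longleftrightarrow> (AE x in lborel. f x \<ge> 0) \<or> (AE x in lborel. f x \<le> 0)"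

definition center :: "(plane \<Rightarrow> real) \<Rightarrow> plane" where
  "center f = (1 / (\<integral>x. f x \<partial>lborel)) *\<^sub>R (\<integral>x. f x *\<^sub>R x \<partial>lborel)"


section \<open>Wasserstein distances\<close>

text \<open>For \<open>f\<close> of one sign with total mass \<open>a \<noteq> 0\<close>, the quadratic Wasserstein distance between
  \<open>f / a\<close> and the Dirac measure at \<open>Y\<close>.\<close>

definition W2_dirac :: "(plane \<Rightarrow> real) \<Rightarrow> plane \<Rightarrow> real" where
  "W2_dirac f Y =
     sqrt ((1 / (\<integral>x. f x \<partial>lborel)) * (\<integral>x. (norm (x - Y))\<^sup>2 * f x \<partial>lborel))"

text \<open>A signed measure is given as a difference of two positive measures, which need not be
  mutually singular; \<open>signed_integral\<close> depends only on the difference.\<close>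

type_synonym signed_measure = "plane measure \<times> plane measure"

definition signed_integral :: "signed_measure \<Rightarrow> (plane \<Rightarrow> real) \<Rightarrow> real" where
  "signed_integral \<mu> \<zeta> = (\<integral>x. \<zeta> x \<partial>fst \<mu>) - (\<integral>x. \<zeta> x \<partial>snd \<mu>)"

text \<open>\<open>ennreal\<close> maps negative numbers to \<open>0\<close>, so the two components are the positive and the
  negative part of \<open>f\<close>.\<close>

definition signed_density :: "(plane \<Rightarrow> real) \<Rightarrow> signed_measure" where
  "signed_density f =
     (density lborel (\<lambda>x. ennreal (f x)), density lborel (\<lambda>x. ennreal (- f x)))"

text \<open>The measure \<open>\<Sum>i\<in>I. a i \<cdot> \<delta>\<^bsub>Y i\<^esub>\<close>, as push-forward of the weights \<open>a\<close> on \<open>I\<close> under \<open>Y\<close>.\<close>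

definition signed_dirac_sum :: "nat set \<Rightarrow> (nat \<Rightarrow> real) \<Rightarrow> (nat \<Rightarrow> plane) \<Rightarrow> signed_measure" where
  "signed_dirac_sum I a Y =
     (distr (density (count_space I) (\<lambda>i. ennreal (a i))) borel Y,
      distr (density (count_space I) (\<lambda>i. ennreal (- a i))) borel Y)"

text \<open>The gradient bound is the \<open>L\<^sup>\<infinity>\<close> bound on the almost everywhere defined gradient of a
  Lipschitz function.\<close>

definition W1_test :: "(plane \<Rightarrow> real) \<Rightarrow> bool" where
  "W1_test \<zeta> \<longleftrightarrow>
     (\<exists>L. L-lipschitz_on UNIV \<zeta>) \<and> (AE x in lborel. \<exists>g. GDERIV \<zeta> x :> g \<and> norm g \<le> 1)"

definition W1 :: "signed_measure \<Rightarrow> signed_measure \<Rightarrow> ereal" where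
  "W1 \<mu> \<nu> = (SUP \<zeta>\<in>Collect W1_test. ereal (signed_integral \<mu> \<zeta> - signed_integral \<nu> \<zeta>))"


section \<open>Transport equation\<close>

primrec Ck :: "nat \<Rightarrow> ('a::real_normed_vector \<Rightarrow> real) \<Rightarrow> bool" where
  "Ck 0 f \<longleftrightarrow> continuous_on UNIV f"
| "Ck (Suc k) f \<longleftrightarrow> (\<exists>f'. (\<forall>x. (f has_derivative f' x) (at x)) \<and> (\<forall>v. Ck k (\<lambda>x. f' x v)))"

definition test_function :: "(real \<times> plane \<Rightarrow> real) \<Rightarrow> bool" where
  "test_function \<phi> \<longleftrightarrow> (\<forall>k. Ck k \<phi>) \<and> compact (closure {z. \<phi> z \<noteq> 0})"

text \<open>Distributional form of \<open>\<partial>\<^sub>t f + u \<cdot> \<nabla> f = 0\<close>, \<open>f(0) = f0\<close> for divergence-free \<open>u\<close>: the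
  derivative of \<open>\<phi>\<close> in the space-time direction \<open>(1, u)\<close> is \<open>\<partial>\<^sub>t \<phi> + u \<cdot> \<nabla> \<phi>\<close>. Test functions
  need not vanish at time \<open>0\<close>.\<close>

definition weak_transport ::
  "(real \<Rightarrow> plane \<Rightarrow> plane) \<Rightarrow> (real \<Rightarrow> plane \<Rightarrow> real) \<Rightarrow> (plane \<Rightarrow> real) \<Rightarrow> bool" where
  "weak_transport u f f0 \<longleftrightarrow>
     (\<forall>\<phi>. test_function \<phi> \<longrightarrow>
        (LINT t:{0..}|lborel.
           (\<integral>x. f t x * frechet_derivative \<phi> (at (t, x)) (1, u t x) \<partial>lborel))
        + (\<integral>x. f0 x * \<phi> (0, x) \<partial>lborel) = 0)"

definition renormalized ::
  "(real \<Rightarrow> plane \<Rightarrow> plane) \<Rightarrow> (real \<Rightarrow> plane \<Rightarrow> real) \<Rightarrow> (plane \<Rightarrow> real) \<Rightarrow> bool" where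
  "renormalized u f f0 \<longleftrightarrow>
     (\<forall>\<beta> :: real \<Rightarrow> real. Ck 1 \<beta> \<and> bounded (range \<beta>) \<longrightarrow>
        weak_transport u (\<lambda>t x. \<beta> (f t x)) (\<lambda>x. \<beta> (f0 x)))"

text \<open>Regular Lagrangian flow of a divergence-free field: almost every trajectory is an absolutely
  continuous solution of the ODE, and Lebesgue measure is preserved.\<close>

definition lagrangian_flow ::
  "(real \<Rightarrow> plane \<Rightarrow> plane) \<Rightarrow> (real \<Rightarrow> plane \<Rightarrow> plane) \<Rightarrow> bool" where
  "lagrangian_flow u X \<longleftrightarrow>
     (\<forall>t\<ge>0. X t \<in> borel_measurable lborel \<and> distr lborel lborel (X t) = lborel) \<and>
     (AE x in lborel. \<forall>t\<ge>0.
        (\<lambda>s. u s (X s x)) absolutely_integrable_on {0..t} \<and>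
        X t x = x + integral {0..t} (\<lambda>s. u s (X s x)))"

definition transported_by ::
  "(real \<Rightarrow> plane \<Rightarrow> plane) \<Rightarrow> (real \<Rightarrow> plane \<Rightarrow> real) \<Rightarrow> (plane \<Rightarrow> real) \<Rightarrow> bool" where
  "transported_by X f f0 \<longleftrightarrow> (\<forall>t\<ge>0. AE x in lborel. f t (X t x) = f0 x)"

definition transport_solution ::
  "real \<Rightarrow> (real \<Rightarrow> plane \<Rightarrow> plane) \<Rightarrow> (real \<Rightarrow> plane \<Rightarrow> plane) \<Rightarrow>
   (real \<Rightarrow> plane \<Rightarrow> real) \<Rightarrow> (plane \<Rightarrow> real) \<Rightarrow> bool" where
  "transport_solution p u X f f0 \<longleftrightarrow>
     continuous_Lp p f \<and> (AE x in lborel. f 0 x = f0 x) \<and>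
     weak_transport u f f0 \<and> renormalized u f f0 \<and> transported_by X f f0"


section \<open>Admissible solutions and point vortices\<close>

definition admissible_data ::
  "nat \<Rightarrow> real \<Rightarrow> real \<Rightarrow> real \<Rightarrow> real \<Rightarrow> real \<Rightarrow> (nat \<Rightarrow> real) \<Rightarrow> (nat \<Rightarrow> plane) \<Rightarrow> real \<Rightarrow>
   (nat \<Rightarrow> plane \<Rightarrow> real) \<Rightarrow> bool" where
  "admissible_data N p \<gamma> \<Lambda> R \<delta> a Y0 \<epsilon> w0 \<longleftrightarrow>
     (\<forall>i\<in>{1..N}. in_Lp p (w0 i) \<and> compact (spt (w0 i)) \<and> one_signed (w0 i) \<and>
        (\<integral>x. w0 i x \<partial>lborel) = a i) \<and>
     (\<forall>i\<in>{1..N}. \<forall>j\<in>{1..N}. i \<noteq> j \<longrightarrow> setdist (spt (w0 i)) (spt (w0 j)) \<ge> \<delta>) \<and>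
     (\<forall>i\<in>{1..N}. W2_dirac (w0 i) (Y0 i) \<le> \<epsilon>) \<and>
     Lp_norm p (\<lambda>x. \<Sum>i\<in>{1..N}. w0 i x) \<le> \<Lambda> * \<epsilon> powr (- \<gamma>) \<and>
     (\<forall>i\<in>{1..N}. spt (w0 i) \<subseteq> ball (center (w0 i)) R)"

text \<open>For admissible data and \<open>p > 2\<close>, the clauses outside the existential quantifier follow from those
  inside it.\<close>

definition euler_evolution ::
  "nat \<Rightarrow> real \<Rightarrow> (nat \<Rightarrow> plane \<Rightarrow> real) \<Rightarrow> (real \<Rightarrow> plane \<Rightarrow> real) \<Rightarrow>
   (nat \<Rightarrow> real \<Rightarrow> plane \<Rightarrow> real) \<Rightarrow> bool" where
  "euler_evolution N p w0 w ws \<longleftrightarrow>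
     (\<exists>X. lagrangian_flow (\<lambda>t. velocity (w t)) X \<and>
        transport_solution p (\<lambda>t. velocity (w t)) X w (\<lambda>x. \<Sum>i\<in>{1..N}. w0 i x) \<and>
        (\<forall>i\<in>{1..N}. transport_solution p (\<lambda>t. velocity (w t)) X (ws i) (w0 i))) \<and>
     (\<forall>t\<ge>0. compact (spt (w t)) \<and> (AE x in lborel. w t x = (\<Sum>i\<in>{1..N}. ws i t x))) \<and>
     (\<forall>t\<ge>0. \<forall>i\<in>{1..N}.
        compact (spt (ws i t)) \<and>
        ((AE x in lborel. w0 i x \<ge> 0) \<longrightarrow> (AE x in lborel. ws i t x \<ge> 0)) \<and>
        ((AE x in lborel. w0 i x \<le> 0) \<longrightarrow> (AE x in lborel. ws i t x \<le> 0)) \<and>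
        (\<integral>x. ws i t x \<partial>lborel) = (\<integral>x. w0 i x \<partial>lborel) \<and>
        Lp_norm p (ws i t) = Lp_norm p (w0 i))"

definition admissible_solution ::
  "nat \<Rightarrow> real \<Rightarrow> real \<Rightarrow> real \<Rightarrow> real \<Rightarrow> real \<Rightarrow> (nat \<Rightarrow> real) \<Rightarrow> (nat \<Rightarrow> plane) \<Rightarrow> real \<Rightarrow>
   (nat \<Rightarrow> plane \<Rightarrow> real) \<Rightarrow> (real \<Rightarrow> plane \<Rightarrow> real) \<Rightarrow> (nat \<Rightarrow> real \<Rightarrow> plane \<Rightarrow> real) \<Rightarrow> bool" where
  "admissible_solution N p \<gamma> \<Lambda> R \<delta> a Y0 \<epsilon> w0 w ws \<longleftrightarrow>
     admissible_data N p \<gamma> \<Lambda> R \<delta> a Y0 \<epsilon> w0 \<and> euler_evolution N p w0 w ws"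

text \<open>The vortices have to stay distinct, because \<open>biot_savart\<close> is totalised at \<open>0\<close>.\<close>

definition point_vortex_solution ::
  "nat \<Rightarrow> (nat \<Rightarrow> real) \<Rightarrow> (nat \<Rightarrow> plane) \<Rightarrow> real \<Rightarrow> (nat \<Rightarrow> real \<Rightarrow> plane) \<Rightarrow> bool" where
  "point_vortex_solution N a Y0 T Y \<longleftrightarrow>
     (\<forall>i\<in>{1..N}. Y i 0 = Y0 i) \<and>
     (\<forall>t\<in>{0..T}. inj_on (\<lambda>i. Y i t) {1..N}) \<and>
     (\<forall>i\<in>{1..N}. \<forall>t\<in>{0..T}.
        (Y i has_vector_derivative (\<Sum>j\<in>{1..N} - {i}. a j *\<^sub>R biot_savart (Y i t - Y j t)))
          (at t within {0..T}))"

end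

theory Submission
  imports Defs "HOL-Analysis.Analysis"
begin

text \<open>
  The proof is Lagrangian. A blob is a finite measure on labels, namely the initial positions of
  its particles weighted by the initial vorticity, and a label \<open>x\<close> moves along a trajectory whose
  velocity is a sum, over the blobs, of integrals of the Biot--Savart kernel over labels. Write
  \<open>\<xi>\<close> for the displacement of a particle of blob \<open>i\<close> from the point vortex \<open>Y i\<close>, and \<open>d\<close> for the
  smallest initial distance of two point vortices.

  Suppose first that all particles stay within \<open>d / 8\<close> of their vortices. Then the velocity
  induced by the other blobs is Lipschitz with a constant independent of \<open>\<epsilon>\<close>. The velocity
  induced by the blob itself may be as large as a negative power of \<open>\<epsilon>\<close>, but the kernel is odd and
  orthogonal to its argument, so this contribution cancels in the derivative of the second moment
  \<open>\<Sum>i. \<integral>\<bar>\<xi>\<bar>\<^sup>2\<close>. Gronwall's inequality propagates the initial bound \<open>O(\<epsilon>\<^sup>2)\<close>, the first moment is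
  therefore \<open>O(\<epsilon>)\<close> (\<open>first_moment_le\<close>), and the first moment bounds the Wasserstein distance
  (\<open>W1_bound\<close>).

  It remains to keep every particle close to its vortex for a time independent of \<open>\<epsilon>\<close>. For a
  particle that has left a fixed neighbourhood of the vortex, the velocity induced by the bulk of
  its own blob is almost tangential: its radial part is bounded by the first moment. Only
  the mass far from the vortex can push the particle outwards, and the \<open>L\<^sup>p\<close> bound controls this
  push by \<open>\<epsilon>\<close> to a fixed negative power, times a small power of the far mass. So the far mass has
  to be shown smaller than any power of \<open>\<epsilon>\<close>. This is done with the moments
  \<open>\<integral>(\<bar>\<xi>\<bar>\<^sup>2 e\<^sup>-\<^sup>2\<^sup>\<lambda>\<^sup>t - r\<^sup>2)\<^sub>+\<^sup>n\<close>, in a frame that expands faster than the strain of the other blobs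
  can stretch. They vanish at time \<open>0\<close>, and after symmetrisation the self-interaction bounds the
  derivative of the moment of order \<open>n\<close> by the moment of order \<open>n - 2\<close> times the first moment
  (\<open>tail_moment_derivative\<close>). Each two orders thus gain a factor \<open>\<epsilon>\<close> (\<open>tail_moment_le\<close>).
  Consequently the outward speed is \<open>O(\<epsilon>)\<close>, no particle gets farther than \<open>8 d / 100 < d / 8\<close>
  from its vortex, and continuous induction removes the hypothesis (\<open>confined_always\<close>).

  The \<open>L\<^sup>p\<close> bound enters only through the integrability of a power \<open>1 + \<theta>\<close> of the kernel against
  the vorticity (\<open>kernel_bound_exists\<close>). The same integrability makes the velocity continuous along
  trajectories, so that almost every trajectory is continuously differentiable
  (\<open>trajectory_C1\<close>) and classical calculus suffices throughout.
\<close>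

section \<open>The Biot--Savart kernel\<close>

lemma inner_plane: "x \<bullet> y = x $ 1 * y $ 1 + x $ 2 * y $ 2" for x y :: plane
  by (simp add: inner_vec_def sum_2)

lemma perp_nth [simp]: "perp z $ 1 = - (z $ 2)" "perp z $ 2 = z $ 1"
  by (simp_all add: perp_def)

lemma inner_perp_self [simp]: "z \<bullet> perp z = 0"
  by (simp add: inner_plane)

lemma perp_minus: "perp (- x) = - perp x"
  by (simp add: vec_eq_iff forall_2)

lemma linear_perp: "linear perp"
  by (rule linearI) (simp_all add: vec_eq_iff forall_2)

lemma norm_perp [simp]: "norm (perp z) = norm z"
  by (simp add: norm_eq_sqrt_inner inner_plane)

lemma perp_measurable [measurable]: "perp \<in> borel_measurable borel"
  by (intro borel_measurable_continuous_onI linear_continuous_on linear_perp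
      linear_conv_bounded_linear[THEN iffD1])

lemma biot_savart_measurable [measurable]: "biot_savart \<in> borel_measurable borel"
  unfolding biot_savart_def by measurable

lemma norm_biot_savart: "norm (biot_savart z) = 1 / (2 * pi * norm z)"
  by (cases "z = 0") (simp_all add: biot_savart_def power2_eq_square)

lemma biot_savart_minus: "biot_savart (- z) = - biot_savart z"
  by (simp add: biot_savart_def perp_minus)

lemma inner_biot_savart_self [simp]: "z \<bullet> biot_savart z = 0"
  by (simp add: biot_savart_def)

text \<open>Up to the factor \<open>1 / (2 \<pi>)\<close> and a reflection the kernel is the inversion in the unit circle,
  whence an exact formula for its increments.\<close>

lemma norm_biot_savart_diff:
  assumes "x \<noteq> 0" "y \<noteq> 0"
  shows "norm (biot_savart x - biot_savart y) = norm (x - y) / (2 * pi * norm x * norm y)"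
proof -
  define v where "v = (1 / (norm x)\<^sup>2) *\<^sub>R x - (1 / (norm y)\<^sup>2) *\<^sub>R y"
  have eq: "biot_savart x - biot_savart y = (1 / (2 * pi)) *\<^sub>R perp v"
    unfolding biot_savart_def v_def using linear_perp
    by (simp add: linear_diff linear_scale scaleR_diff_right)
  have n: "norm x > 0" "norm y > 0" using assms by auto
  have "(norm v)\<^sup>2 = (norm (x - y) / (norm x * norm y))\<^sup>2"
  proof -
    define \<alpha> \<beta> where "\<alpha> = 1 / (norm x)\<^sup>2" and "\<beta> = 1 / (norm y)\<^sup>2"
    have v: "v = \<alpha> *\<^sub>R x - \<beta> *\<^sub>R y" by (simp add: v_def \<alpha>_def \<beta>_def)
    have "(norm v)\<^sup>2 = \<alpha>\<^sup>2 * (norm x)\<^sup>2 - 2 * (\<alpha> * \<beta> * (x \<bullet> y)) + \<beta>\<^sup>2 * (norm y)\<^sup>2"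
      unfolding power2_norm_eq_inner v
      by (simp add: inner_diff_left inner_diff_right inner_commute power2_eq_square algebra_simps)
    also have "\<dots> = ((norm y)\<^sup>2 - 2 * (x \<bullet> y) + (norm x)\<^sup>2) / ((norm x)\<^sup>2 * (norm y)\<^sup>2)"
      unfolding \<alpha>_def \<beta>_def using n by (simp add: field_simps power2_eq_square)
    also have "(norm y)\<^sup>2 - 2 * (x \<bullet> y) + (norm x)\<^sup>2 = (norm (x - y))\<^sup>2"
      unfolding power2_norm_eq_inner
      by (simp add: inner_diff_left inner_diff_right inner_commute)
    finally show ?thesis by (simp add: power_divide power_mult_distrib)
  qed
  then have "norm v = norm (x - y) / (norm x * norm y)"
    by (rule power2_eq_imp_eq) auto
  then show ?thesis unfolding eq by (simp add: field_simps)
qed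

lemma biot_savart_lipschitz:
  assumes "d > 0" "norm x \<ge> d / 2" "norm y \<ge> d / 2"
  shows "norm (biot_savart x - biot_savart y) \<le> norm (x - y) / d\<^sup>2"
proof -
  have ne: "x \<noteq> 0" "y \<noteq> 0" using assms by auto
  have "d\<^sup>2 \<le> 4 * (norm x * norm y)"
    using mult_mono[OF assms(2,3)] assms(1) by (simp add: power2_eq_square)
  also have "4 * (norm x * norm y) \<le> (2 * pi) * (norm x * norm y)"
    using pi_gt3 by (intro mult_right_mono) auto
  finally have "d\<^sup>2 \<le> 2 * pi * norm x * norm y" by (simp add: mult.assoc)
  then show ?thesis
    unfolding norm_biot_savart_diff[OF ne] using assms(1)
    by (intro divide_left_mono) (auto simp: ne intro!: mult_pos_pos)
qed

lemma norm_biot_savart_le: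
  assumes "d > 0" "norm z \<ge> d / 2"
  shows "norm (biot_savart z) \<le> 1 / d"
proof -
  have "d \<le> 2 * norm z" using assms by simp
  also have "\<dots> \<le> 2 * pi * norm z" using pi_gt3 by (simp add: mult_right_mono)
  finally show ?thesis unfolding norm_biot_savart using assms
    by (intro divide_left_mono) (auto intro!: mult_pos_pos)
qed

lemma norm_biot_savart_le_inverse: "norm (biot_savart z) \<le> 1 / norm z"
proof (cases "z = 0")
  case False
  have "1 * norm z \<le> 2 * pi * norm z" using pi_gt3 by (intro mult_right_mono) auto
  then show ?thesis using False unfolding norm_biot_savart by (intro divide_left_mono) auto
qed (simp add: norm_biot_savart)

lemma biot_savart_continuous_on: "continuous_on (- {0}) biot_savart"
  unfolding biot_savart_def
  by (intro continuous_intros linear_continuous_on linear_perp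
      linear_conv_bounded_linear[THEN iffD1]) auto

text \<open>The cancellation behind the whole argument: after symmetrisation the kernel only sees the
  difference of the radial weights \<open>c1\<close>, \<open>c2\<close>, and its singularity becomes harmless.\<close>

lemma inner_biot_savart_symmetrized:
  shows "(c1 *\<^sub>R x - c2 *\<^sub>R y) \<bullet> biot_savart (x - y)
           = (c1 - c2) * (x \<bullet> biot_savart (x - y))"
    and "x \<bullet> biot_savart (x - y) = y \<bullet> biot_savart (x - y)"
proof -
  show *: "x \<bullet> biot_savart (x - y) = y \<bullet> biot_savart (x - y)"
    using inner_biot_savart_self[of "x - y"] unfolding inner_diff_left by linarith
  show "(c1 *\<^sub>R x - c2 *\<^sub>R y) \<bullet> biot_savart (x - y)
           = (c1 - c2) * (x \<bullet> biot_savart (x - y))"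
    unfolding inner_diff_left inner_scaleR_left * by (simp only: left_diff_distrib)
qed

text \<open>The kernel is orthogonal to \<open>x - y\<close>, so \<open>x\<close> may be exchanged for \<open>y\<close> in the inner product.
  This gives the smaller of the two norms.\<close>

lemma abs_inner_biot_savart_le:
  "\<bar>x \<bullet> biot_savart (x - y)\<bar> \<le> min (norm x) (norm y) / (2 * pi * norm (x - y))"
proof -
  have "\<bar>x \<bullet> biot_savart (x - y)\<bar> \<le> norm x * norm (biot_savart (x - y))"
    by (rule Cauchy_Schwarz_ineq2)
  moreover have "\<bar>x \<bullet> biot_savart (x - y)\<bar> \<le> norm y * norm (biot_savart (x - y))"
    by (subst inner_biot_savart_symmetrized(2)) (rule Cauchy_Schwarz_ineq2)
  ultimately show ?thesis unfolding norm_biot_savart by (simp add: min_def)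
qed

text \<open>Weak form of Hoelder's inequality, used with a kernel of which only a power slightly above
  the first is integrable.\<close>

lemma le_powr_interpolate:
  fixes k :: real
  assumes "k \<ge> 0" "h > 0" "\<theta> > 0"
  shows "k \<le> k powr (1 + \<theta>) * h powr \<theta> + 1 / h"
proof (cases "k \<le> 1 / h")
  case True
  have "0 \<le> k powr (1 + \<theta>) * h powr \<theta>" by simp
  then show ?thesis using True by linarith
next
  case False
  have k: "k > 0" using False assms by (smt (verit) divide_nonneg_pos)
  have "1 \<le> k * h" using False assms by (simp add: field_simps)
  then have "1 \<le> (k * h) powr \<theta>" using assms by (intro ge_one_powr_ge_zero) auto
  then have "k * 1 \<le> k * (k * h) powr \<theta>" using k by (intro mult_left_mono) auto
  also have "\<dots> = k powr (1 + \<theta>) * h powr \<theta>"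
    using k assms by (simp add: powr_mult powr_add)
  also have "\<dots> \<le> k powr (1 + \<theta>) * h powr \<theta> + 1 / h" using assms by simp
  finally show ?thesis by simp
qed

definition truncated_kernel :: "real \<Rightarrow> plane \<Rightarrow> plane" where
  "truncated_kernel \<eta> z = (1 / (2 * pi * (max (norm z) \<eta>)\<^sup>2)) *\<^sub>R perp z"

lemma truncated_kernel_eq: "norm z \<ge> \<eta> \<Longrightarrow> truncated_kernel \<eta> z = biot_savart z"
  by (simp add: truncated_kernel_def biot_savart_def max_def)

lemma continuous_truncated_kernel: "\<eta> > 0 \<Longrightarrow> continuous_on UNIV (truncated_kernel \<eta>)"
  unfolding truncated_kernel_def
  by (intro continuous_intros linear_continuous_on linear_perp
      linear_conv_bounded_linear[THEN iffD1]) (auto simp: max_def)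

lemma truncated_kernel_bounded:
  assumes "\<eta> > 0" shows "norm (truncated_kernel \<eta> z) \<le> 1 / \<eta>"
proof -
  define m where "m = max (norm z) \<eta>"
  have m: "m \<ge> norm z" "m \<ge> \<eta>" "m > 0" using assms by (auto simp: m_def)
  have "norm (truncated_kernel \<eta> z) = norm z / (2 * pi * m\<^sup>2)"
    by (simp add: truncated_kernel_def m_def)
  also have "\<dots> \<le> m / (2 * pi * m\<^sup>2)" using m by (intro divide_right_mono) auto
  also have "\<dots> = 1 / (2 * pi * m)" using m by (simp add: power2_eq_square)
  also have "\<dots> \<le> 1 / \<eta>"
  proof (rule divide_left_mono)
    have "1 * \<eta> \<le> (2 * pi) * m" using m pi_gt3 assms by (intro mult_mono) auto
    then show "\<eta> \<le> 2 * pi * m" by simp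
  qed (use m assms in auto)
  finally show ?thesis .
qed

text \<open>The error lives where the kernel exceeds \<open>1 / (2 \<pi> \<eta>)\<close>, and there a power of the kernel pays for
  a power of \<open>\<eta>\<close>. After integration the error is therefore small uniformly in the position.\<close>

lemma truncated_kernel_error:
  assumes "\<eta> > 0" "\<theta> > 0"
  shows "norm (biot_savart z - truncated_kernel \<eta> z)
           \<le> norm (biot_savart z) powr (1 + \<theta>) * (2 * pi * \<eta>) powr \<theta>"
proof (cases "norm z \<ge> \<eta> \<or> z = 0")
  case True
  then have "biot_savart z - truncated_kernel \<eta> z = 0"
    by (auto simp: truncated_kernel_eq biot_savart_def truncated_kernel_def)
       (simp_all add: perp_def vec_eq_iff forall_2)
  then show ?thesis by simp
next
  case False
  then have z: "0 < norm z" "norm z < \<eta>" by auto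
  define c where "c = (norm z / \<eta>)\<^sup>2"
  have c: "0 \<le> c" "c \<le> 1" using z assms by (auto simp: c_def intro!: power_le_one)
  have "truncated_kernel \<eta> z = c *\<^sub>R biot_savart z"
    using z by (simp add: truncated_kernel_def biot_savart_def c_def max_def field_simps)
  then have "biot_savart z - truncated_kernel \<eta> z = (1 - c) *\<^sub>R biot_savart z"
    by (simp add: scaleR_diff_left)
  then have "norm (biot_savart z - truncated_kernel \<eta> z) \<le> norm (biot_savart z) * 1"
    using c by (simp add: mult_left_le_one_le)
  also have "\<dots> \<le> norm (biot_savart z) * (norm (biot_savart z) * (2 * pi * \<eta>)) powr \<theta>"
  proof (intro mult_left_mono ge_one_powr_ge_zero)
    show "1 \<le> norm (biot_savart z) * (2 * pi * \<eta>)"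
      unfolding norm_biot_savart using z by (simp add: field_simps)
  qed (use assms in auto)
  also have "\<dots> = norm (biot_savart z) powr (1 + \<theta>) * (2 * pi * \<eta>) powr \<theta>"
  proof -
    have "k * (k * c) powr \<theta> = k powr (1 + \<theta>) * c powr \<theta>" if "k > 0" "c > 0" for k c :: real
      using that by (simp add: powr_mult powr_add)
    moreover have "norm (biot_savart z) > 0" using z by (simp add: norm_biot_savart)
    moreover have "2 * pi * \<eta> > 0" using assms by simp
    ultimately show ?thesis by blast
  qed
  finally show ?thesis .
qed

section \<open>Real-variable tools\<close>

text \<open>Continuous induction: every step has the same length \<open>\<tau>\<close>, so finitely many steps reach \<open>T\<close>.\<close>

lemma induct_by_fixed_steps:
  fixes T \<tau> :: real
  assumes "0 \<le> T" "0 < \<tau>" "P 0"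
    and step: "\<And>t. 0 \<le> t \<Longrightarrow> t \<le> T \<Longrightarrow> (\<And>s. 0 \<le> s \<Longrightarrow> s \<le> t \<Longrightarrow> P s) \<Longrightarrow>
             (\<And>s. t \<le> s \<Longrightarrow> s \<le> t + \<tau> \<Longrightarrow> s \<le> T \<Longrightarrow> P s)"
    and t: "0 \<le> t" "t \<le> T"
  shows "P t"
proof -
  have "\<forall>s. 0 \<le> s \<and> s \<le> real n * \<tau> \<and> s \<le> T \<longrightarrow> P s" for n
  proof (induction n)
    case 0
    have "P s" if "0 \<le> s" "s \<le> real 0 * \<tau>" for s
    proof -
      have "s = 0" using that by simp
      then show ?thesis using assms(3) by (simp only:)
    qed
    then show ?case by blast
  next
    case (Suc n)
    define t' where "t' = min (real n * \<tau>) T"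
    have t': "0 \<le> t'" "t' \<le> T" using assms(1,2) by (auto simp: t'_def)
    have prev: "P s" if "0 \<le> s" "s \<le> t'" for s using Suc that by (auto simp: t'_def)
    show ?case
    proof (intro allI impI)
      fix s assume s: "0 \<le> s \<and> s \<le> real (Suc n) * \<tau> \<and> s \<le> T"
      show "P s"
      proof (cases "s \<le> t'")
        case True then show ?thesis using prev s by auto
      next
        case False
        then have "s \<le> t' + \<tau>" using s by (auto simp: t'_def min_def algebra_simps split: if_splits)
        then show ?thesis using step[OF t' prev, of s] False s by auto
      qed
    qed
  qed
  moreover obtain n where "t / \<tau> \<le> real n" using real_arch_simple by blast
  moreover from this have "t \<le> real n * \<tau>" using assms(2) by (simp add: pos_divide_le_eq)
  ultimately show ?thesis using t by blast
qed

lemma nonincreasing_within: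
  fixes f f' :: "real \<Rightarrow> real"
  assumes "a \<le> b"
    and d: "\<And>t. a \<le> t \<Longrightarrow> t \<le> b \<Longrightarrow> (f has_real_derivative f' t) (at t within {a..b})"
    and le: "\<And>t. a \<le> t \<Longrightarrow> t \<le> b \<Longrightarrow> f' t \<le> 0"
  shows "f b \<le> f a"
proof (cases "a = b")
  case False
  then have ab: "a < b" using assms by auto
  show ?thesis
  proof (rule DERIV_nonpos_imp_decreasing_open[OF assms(1)])
    fix x assume x: "a < x" "x < b"
    then have "(f has_real_derivative f' x) (at x)"
      using d[of x] at_within_Icc_at[of a x b] by auto
    then show "\<exists>y. DERIV f x :> y \<and> y \<le> 0" using le[of x] x by auto
  next
    show "continuous_on {a..b} f"
      by (rule DERIV_continuous_on[where D = f']) (use d in auto)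
  qed
qed auto

lemma gronwall_exp:
  fixes f f' :: "real \<Rightarrow> real"
  assumes d: "\<And>t. 0 \<le> t \<Longrightarrow> t \<le> b \<Longrightarrow> (f has_real_derivative f' t) (at t within {0..b})"
    and le: "\<And>t. 0 \<le> t \<Longrightarrow> t \<le> b \<Longrightarrow> f' t \<le> c * f t"
    and t: "0 \<le> t" "t \<le> b"
  shows "f t \<le> f 0 * exp (c * t)"
proof -
  have "f t * exp (- c * t) \<le> f 0 * exp (- c * 0)"
  proof (rule nonincreasing_within[OF t(1), where f = "\<lambda>t. f t * exp (- c * t)"
          and f' = "\<lambda>s. (f' s - c * f s) * exp (- c * s)"])
    fix s assume s: "0 \<le> s" "s \<le> t"
    have "(f has_real_derivative f' s) (at s within {0..t})"
      using d[of s] s t by (auto intro: DERIV_subset)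
    then show "((\<lambda>t. f t * exp (- c * t)) has_real_derivative (f' s - c * f s) * exp (- c * s))
            (at s within {0..t})"
      by (auto intro!: derivative_eq_intros simp: algebra_simps)
    show "(f' s - c * f s) * exp (- c * s) \<le> 0"
      using le[of s] s t by (intro mult_nonpos_nonneg) auto
  qed
  then have "f t * exp (- c * t) * exp (c * t) \<le> f 0 * exp (c * t)"
    by (intro mult_right_mono) auto
  then show ?thesis by (simp add: mult.assoc exp_add[symmetric])
qed

lemma linear_growth:
  fixes f f' :: "real \<Rightarrow> real"
  assumes d: "\<And>t. 0 \<le> t \<Longrightarrow> t \<le> b \<Longrightarrow> (f has_real_derivative f' t) (at t within {0..b})"
    and le: "\<And>t. 0 \<le> t \<Longrightarrow> t \<le> b \<Longrightarrow> f' t \<le> c"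
    and t: "0 \<le> s" "s \<le> t" "t \<le> b"
  shows "f t \<le> f s + c * (t - s)"
proof -
  have "f t - c * t \<le> f s - c * s"
  proof (rule nonincreasing_within[where f = "\<lambda>t. f t - c * t" and f' = "\<lambda>t. f' t - c"])
    fix r assume s: "s \<le> r" "r \<le> t"
    have "(f has_real_derivative f' r) (at r within {s..t})"
      using d[of r] s t by (auto intro: DERIV_subset)
    then show "((\<lambda>t. f t - c * t) has_real_derivative f' r - c) (at r within {s..t})"
      by (auto intro!: derivative_eq_intros)
    show "f' r - c \<le> 0" using le[of r] s t by auto
  qed (use t in auto)
  then show ?thesis by (simp add: algebra_simps)
qed

text \<open>A differential inequality that is only known above the level \<open>q\<close>: look at the last time
  at which the level is attained.\<close>

lemma linear_growth_above:
  fixes f f' :: "real \<Rightarrow> real"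
  assumes d: "\<And>t. 0 \<le> t \<Longrightarrow> t \<le> b \<Longrightarrow> (f has_real_derivative f' t) (at t within {0..b})"
    and le: "\<And>t. 0 \<le> t \<Longrightarrow> t \<le> b \<Longrightarrow> q \<le> f t \<Longrightarrow> f' t \<le> c"
    and f0: "f 0 \<le> q" and c: "0 \<le> c"
    and t: "0 \<le> t" "t \<le> b"
  shows "f t \<le> q + c * t"
proof (cases "f t \<le> q")
  case True
  then show ?thesis using c t by (smt (verit) mult_nonneg_nonneg)
next
  case False
  have "continuous_on {0..b} f"
    by (rule DERIV_continuous_on[where D = f']) (use d in auto)
  then have cont: "continuous_on {0..t} f"
    by (rule continuous_on_subset) (use t in auto)
  define S where "S = {s \<in> {0..t}. f s \<in> {..q}}"
  have "closed S" unfolding S_def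
    using continuous_closed_preimage[OF cont, of "{..q}"] by (simp add: vimage_def Int_def)
  moreover have S0: "0 \<in> S" using f0 t by (auto simp: S_def)
  moreover have bdd: "bdd_above S" by (auto simp: S_def bdd_above_def)
  ultimately have m: "Sup S \<in> S" using closed_contains_Sup[of S] by auto
  define s where "s = Sup S"
  have s: "0 \<le> s" "s \<le> t" "f s \<le> q" using m by (auto simp: S_def s_def)
  have above: "q < f r" if "s < r" "r \<le> t" for r
  proof (rule ccontr)
    assume "\<not> q < f r"
    then have "r \<in> S" using that s by (auto simp: S_def)
    then have "r \<le> s" using bdd by (auto simp: s_def intro: cSup_upper)
    then show False using that by auto
  qed
  have "s \<noteq> t" using False s by auto
  then have st: "s < t" using s by auto
  have fs: "q \<le> f s"
  proof (rule tendsto_lowerbound)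
    show "(f \<longlongrightarrow> f s) (at_right s)"
    proof -
      have "continuous_on {s..t} f" using cont by (rule continuous_on_subset) (use s in auto)
      then have "(f \<longlongrightarrow> f s) (at s within {s..t})" using s by (auto simp: continuous_on_def)
      then show ?thesis using at_within_Icc_at_right[OF st] by simp
    qed
    show "\<forall>\<^sub>F r in at_right s. q \<le> f r"
      using above st by (auto simp: eventually_at_right[OF st] intro!: exI[of _ t] less_imp_le)
  qed auto
  have "f t - c * t \<le> f s - c * s"
  proof (rule nonincreasing_within[where f = "\<lambda>t. f t - c * t" and f' = "\<lambda>t. f' t - c"])
    fix r assume r: "s \<le> r" "r \<le> t"
    have "(f has_real_derivative f' r) (at r within {s..t})"
      using d[of r] s r t by (auto intro: DERIV_subset)
    then show "((\<lambda>t. f t - c * t) has_real_derivative f' r - c) (at r within {s..t})"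
      by (auto intro!: derivative_eq_intros)
    have "q \<le> f r" using above[of r] fs r by (cases "r = s") auto
    then show "f' r - c \<le> 0" using le[of r] s r t by auto
  qed (use s in auto)
  moreover have "c * s \<ge> 0" using c s by auto
  ultimately show ?thesis using s by linarith
qed

text \<open>Powers of the positive part give tests that vanish on a disc and are still once differentiable,
  the second derivative being controlled by the power \<open>n - 2\<close>.\<close>

lemma has_real_derivative_pos_part_power:
  assumes "n \<ge> 2"
  shows "((\<lambda>x. (max 0 x) ^ n) has_real_derivative real n * (max 0 x) ^ (n - 1)) (at x)"
proof -
  consider "x < 0" | "x > 0" | "x = 0" by linarith
  then show ?thesis
  proof cases
    case 1
    have "((\<lambda>x. 0::real) has_real_derivative 0) (at x)" by simp
    then have "((\<lambda>x. (max 0 x) ^ n) has_real_derivative 0) (at x)"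
      by (rule has_field_derivative_transform_within_open[of _ _ _ "{..<0}"])
        (use 1 assms in auto)
    moreover have "real n * (max 0 x) ^ (n - 1) = 0" using 1 assms by (simp add: max_def)
    ultimately show ?thesis by (simp only:)
  next
    case 2
    have "((\<lambda>x. x ^ n) has_real_derivative real n * x ^ (n - 1)) (at x)"
      by (auto intro!: derivative_eq_intros)
    then have "((\<lambda>x. (max 0 x) ^ n) has_real_derivative real n * x ^ (n - 1)) (at x)"
      by (rule has_field_derivative_transform_within_open[of _ _ _ "{0<..}"]) (use 2 in auto)
    then show ?thesis using 2 by simp
  next
    case 3
    have "((\<lambda>h::real. (max 0 h) ^ n / h) \<longlongrightarrow> 0) (at 0)"
    proof (rule Lim_null_comparison)
      show "\<forall>\<^sub>F h in at 0. norm ((max 0 h) ^ n / h) \<le> \<bar>h\<bar> ^ (n - 1)"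
      proof (intro always_eventually allI)
        fix h :: real
        obtain m where n: "n = Suc m" using assms by (cases n) auto
        show "norm ((max 0 h) ^ n / h) \<le> \<bar>h\<bar> ^ (n - 1)"
          unfolding n by (cases "h > 0") (auto simp: max_def abs_mult power_abs)
      qed
      have "((\<lambda>h::real. \<bar>h\<bar> ^ (n - 1)) \<longlongrightarrow> \<bar>0\<bar> ^ (n - 1)) (at 0)"
        by (intro tendsto_intros)
      moreover have "\<bar>0::real\<bar> ^ (n - 1) = 0" using assms by simp
      ultimately show "((\<lambda>h::real. \<bar>h\<bar> ^ (n - 1)) \<longlongrightarrow> 0) (at 0)" by (simp only:)
    qed
    moreover have "n \<noteq> 0" "n - Suc 0 \<noteq> 0" using assms by auto
    ultimately show ?thesis unfolding DERIV_def 3 by (simp add: power_0_left)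
  qed
qed

lemma pos_part_power_diff_le:
  fixes a b :: real
  assumes "a \<ge> 0" "b \<ge> 0" "n \<ge> 2"
  shows "\<bar>a ^ (n - 1) - b ^ (n - 1)\<bar> \<le> real (n - 1) * (max a b) ^ (n - 2) * \<bar>a - b\<bar>"
proof -
  have *: "a ^ (n - 1) - b ^ (n - 1) \<le> real (n - 1) * a ^ (n - 2) * (a - b)"
    if ab: "0 \<le> b" "b \<le> a" for a b :: real
  proof -
    have "a ^ (n - 1) - b ^ (n - 1) = (a - b) * (\<Sum>i<n - 1. a ^ (n - 1 - Suc i) * b ^ i)"
      using power_diff_sumr2[of b "n - 1" a] by (simp add: algebra_simps)
    also have "\<dots> \<le> (a - b) * (\<Sum>i<n - 1. a ^ (n - 2))"
    proof (intro mult_left_mono sum_mono)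
      fix i assume "i \<in> {..<n - 1}"
      then have "n - 2 = (n - 1 - Suc i) + i" by auto
      then have "a ^ (n - 2) = a ^ (n - 1 - Suc i) * a ^ i" by (metis power_add)
      then show "a ^ (n - 1 - Suc i) * b ^ i \<le> a ^ (n - 2)"
        using ab by (simp add: mult_left_mono power_mono)
    qed (use ab in auto)
    finally show ?thesis by (simp add: algebra_simps)
  qed
  show ?thesis
  proof (cases "b \<le> a")
    case True
    then show ?thesis using *[of b a] assms power_mono[of b a "n - 1"] by (simp add: max_def)
  next
    case False
    then have "a ^ (n - 1) \<le> b ^ (n - 1)" using assms by (intro power_mono) auto
    then show ?thesis using False *[of a b] assms by (simp add: max_def)
  qed
qed

text \<open>The difference quotients at \<open>t\<close> are dominated by \<open>B\<close>, so dominated convergence applies. The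
  null set on which differentiability fails may depend on \<open>t\<close>.\<close>

lemma has_real_derivative_integral_lipschitz:
  fixes f :: "real \<Rightarrow> 'a \<Rightarrow> real"
  assumes fin: "finite_measure M"
    and f: "\<And>t. t \<in> X \<Longrightarrow> integrable M (f t)" and f': "f' \<in> borel_measurable M"
    and d: "AE x in M. ((\<lambda>t. f t x) has_real_derivative f' x) (at t within X)"
    and lip: "\<And>s. s \<in> X \<Longrightarrow> AE x in M. \<bar>f s x - f t x\<bar> \<le> B * \<bar>s - t\<bar>"
    and t: "t \<in> X"
  shows "((\<lambda>t. \<integral>x. f t x \<partial>M) has_real_derivative (\<integral>x. f' x \<partial>M)) (at t within X)"
proof -
  interpret finite_measure M by (rule fin)
  have "((\<lambda>s. ((\<integral>x. f s x \<partial>M) - (\<integral>x. f t x \<partial>M)) / (s - t)) \<longlongrightarrow> (\<integral>x. f' x \<partial>M)) (at t within X)"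
    unfolding tendsto_at_iff_sequentially
  proof (intro allI impI)
    fix S :: "nat \<Rightarrow> real"
    assume S: "\<forall>i. S i \<in> X - {t}" and lim: "S \<longlonglongrightarrow> t"
    have "(\<lambda>i. \<integral>x. (f (S i) x - f t x) / (S i - t) \<partial>M) \<longlonglongrightarrow> (\<integral>x. f' x \<partial>M)"
    proof (rule integral_dominated_convergence[where w = "\<lambda>x. B"])
      show "(\<lambda>x. (f (S i) x - f t x) / (S i - t)) \<in> borel_measurable M" for i
        using S f t by (intro borel_measurable_divide borel_measurable_diff) auto
      show "integrable M (\<lambda>x. B)" by simp
      show "AE x in M. (\<lambda>i. (f (S i) x - f t x) / (S i - t)) \<longlonglongrightarrow> f' x"
        using d
      proof eventually_elim
        case (elim x)
        then have "((\<lambda>s. (f s x - f t x) / (s - t)) \<longlongrightarrow> f' x) (at t within X)"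
          by (auto simp: has_field_derivative_iff)
        then show ?case using S lim unfolding tendsto_at_iff_sequentially comp_def by auto
      qed
      fix i
      have "S i \<in> X" "S i - t \<noteq> 0" using S by auto
      then show "AE x in M. norm ((f (S i) x - f t x) / (S i - t)) \<le> B"
        using lip[of "S i"] by (auto simp: divide_simps elim!: eventually_mono)
    qed (use f' in auto)
    then show "((\<lambda>s. ((\<integral>x. f s x \<partial>M) - (\<integral>x. f t x \<partial>M)) / (s - t)) \<circ> S) \<longlonglongrightarrow> (\<integral>x. f' x \<partial>M)"
      using S f t by (auto simp: comp_def)
  qed
  then show ?thesis by (simp add: has_field_derivative_iff)
qed

lemma has_real_derivative_integral:
  fixes f f' :: "real \<Rightarrow> 'a \<Rightarrow> real"
  assumes fin: "finite_measure M"
    and f: "\<And>t. t \<in> {0..b} \<Longrightarrow> integrable M (f t)"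
    and f': "\<And>t. t \<in> {0..b} \<Longrightarrow> f' t \<in> borel_measurable M"
    and d: "AE x in M. \<forall>t\<in>{0..b}. ((\<lambda>t. f t x) has_real_derivative f' t x) (at t within {0..b})"
    and bd: "AE x in M. \<forall>t\<in>{0..b}. \<bar>f' t x\<bar> \<le> B"
    and t: "t \<in> {0..b}"
  shows "((\<lambda>t. \<integral>x. f t x \<partial>M) has_real_derivative (\<integral>x. f' t x \<partial>M)) (at t within {0..b})"
    and "integrable M (f' t)"
proof -
  interpret finite_measure M by (rule fin)
  show "integrable M (f' t)"
  proof (rule integrable_const_bound[where B = B])
    show "AE x in M. norm (f' t x) \<le> B" using bd by eventually_elim (use t in auto)
  qed (use f' t in auto)
  show "((\<lambda>t. \<integral>x. f t x \<partial>M) has_real_derivative (\<integral>x. f' t x \<partial>M)) (at t within {0..b})"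
  proof (rule has_real_derivative_integral_lipschitz[OF fin f f'[OF t] _ _ t])
    show "AE x in M. ((\<lambda>t. f t x) has_real_derivative f' t x) (at t within {0..b})"
      using d by eventually_elim (use t in auto)
    show "AE x in M. \<bar>f s x - f t x\<bar> \<le> B * \<bar>s - t\<bar>" if s: "s \<in> {0..b}" for s
      using d bd
    proof eventually_elim
      case (elim x)
      have "norm (f s x - f t x) \<le> B * norm (s - t)"
        by (rule field_differentiable_bound[of "{0..b}" "\<lambda>s. f s x" "\<lambda>s. f' s x"])
          (use elim s t in auto)
      then show ?case by simp
    qed
  qed
qed

section \<open>Interacting blobs in Lagrangian coordinates\<close>

text \<open>Exchanging the two labels in the double integral and averaging replaces \<open>c x\<close> by half of
  \<open>c x - c y\<close>. The difference compensates the singularity of the kernel, and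
  \<open>g\<close> measures how well it does so. For constant \<open>c\<close> one may take \<open>g = 0\<close>: the self-interaction
  drops out.\<close>

lemma symmetrized_velocity_bound:
  fixes \<xi> :: "'l \<Rightarrow> plane" and c g :: "'l \<Rightarrow> real"
  assumes fin: "finite_measure M"
    and m [measurable]: "\<xi> \<in> borel_measurable M" "c \<in> borel_measurable M"
    and G: "AE x in M. G x"
    and b: "\<And>x. G x \<Longrightarrow> norm (\<xi> x) \<le> b" "\<And>x. G x \<Longrightarrow> \<bar>c x\<bar> \<le> cb"
    and g: "integrable M g"
    and K: "\<And>z. integrable M (\<lambda>y. biot_savart (z - \<xi> y))"
           "\<And>z. (\<integral>y. norm (biot_savart (z - \<xi> y)) \<partial>M) \<le> U"
    and bd: "\<And>x y. G x \<Longrightarrow> G y \<Longrightarrow>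
      \<bar>c x - c y\<bar> * \<bar>\<xi> x \<bullet> biot_savart (\<xi> x - \<xi> y)\<bar> \<le> g x * norm (\<xi> y) + g y * norm (\<xi> x)"
  shows "\<bar>\<integral>x. c x * (\<xi> x \<bullet> (\<integral>y. biot_savart (\<xi> x - \<xi> y) \<partial>M)) \<partial>M\<bar>
           \<le> (\<integral>x. g x \<partial>M) * (\<integral>x. norm (\<xi> x) \<partial>M)"
proof -
  interpret finite_measure M by (rule fin)
  interpret pair_sigma_finite M M ..
  define F where "F x y = c x * (\<xi> x \<bullet> biot_savart (\<xi> x - \<xi> y))" for x y
  have Fm [measurable]: "(\<lambda>(x, y). F x y) \<in> borel_measurable (M \<Otimes>\<^sub>M M)"
    unfolding F_def by measurable
  have \<xi>int: "integrable M (\<lambda>x. norm (\<xi> x))"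
  proof (rule integrable_const_bound[where B = b])
    show "AE x in M. norm (norm (\<xi> x)) \<le> b" using G by eventually_elim (use b in auto)
  qed auto
  have Fint: "integrable M (\<lambda>y. F x y)" for x
    unfolding F_def using K(1)[of "\<xi> x"] by (intro integrable_mult_right integrable_inner_right) auto
  have Fint': "integrable (M \<Otimes>\<^sub>M M) (\<lambda>(x, y). F x y)"
  proof (rule Fubini_integrable)
    show "integrable M (\<lambda>x. \<integral>y. norm (case (x, y) of (x, y) \<Rightarrow> F x y) \<partial>M)"
    proof (rule integrable_const_bound[where B = "cb * b * U"])
      show "AE x in M. norm (\<integral>y. norm (case (x, y) of (x, y) \<Rightarrow> F x y) \<partial>M) \<le> cb * b * U"
        using G
      proof eventually_elim
        case (elim x)
        have nn: "0 \<le> cb" "0 \<le> b" using b[OF elim] by (auto intro: order_trans[OF abs_ge_zero] order_trans[OF norm_ge_zero])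
        have "(\<integral>y. norm (F x y) \<partial>M) \<le> (\<integral>y. (cb * b) * norm (biot_savart (\<xi> x - \<xi> y)) \<partial>M)"
        proof (rule integral_mono)
          show "integrable M (\<lambda>y. norm (F x y))" using Fint by (rule integrable_norm)
          show "integrable M (\<lambda>y. (cb * b) * norm (biot_savart (\<xi> x - \<xi> y)))"
            using K(1) by (intro integrable_mult_right integrable_norm)
          fix y
          have "norm (F x y) \<le> cb * (b * norm (biot_savart (\<xi> x - \<xi> y)))"
            unfolding F_def real_norm_def abs_mult
            using b[OF elim] nn Cauchy_Schwarz_ineq2[of "\<xi> x" "biot_savart (\<xi> x - \<xi> y)"]
            by (intro mult_mono order_trans[OF Cauchy_Schwarz_ineq2] mult_right_mono) auto
          then show "norm (F x y) \<le> (cb * b) * norm (biot_savart (\<xi> x - \<xi> y))" by (simp add: mult.assoc)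
        qed
        also have "\<dots> \<le> cb * b * U" using K(2)[of "\<xi> x"] nn by (simp add: mult_left_mono)
        finally show ?case by simp
      qed
    qed simp
    show "AE x in M. integrable M (\<lambda>y. case (x, y) of (x, y) \<Rightarrow> F x y)" using Fint by simp
  qed simp
  define J where "J = (\<integral>x. (\<integral>y. F x y \<partial>M) \<partial>M)"
  have Fint2: "integrable (M \<Otimes>\<^sub>M M) (\<lambda>(x, y). F y x)"
    using integrable_product_swap[OF Fint'] by (simp add: case_prod_unfold)
  have Jswap: "(\<integral>x. (\<integral>y. F y x \<partial>M) \<partial>M) = J"
    unfolding J_def by (rule Fubini_integral[OF Fint'])
  have 1: "integrable M (\<lambda>x. \<integral>y. F x y \<partial>M)" "integrable M (\<lambda>x. \<integral>y. F y x \<partial>M)"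
    using integrable_fst'[OF Fint'] integrable_fst'[OF Fint2] by auto
  have 2: "AE x in M. integrable M (\<lambda>y. F y x)" using AE_integrable_fst'[OF Fint2] by simp
  have "2 * J = (\<integral>x. (\<integral>y. F x y \<partial>M) + (\<integral>y. F y x \<partial>M) \<partial>M)"
    using 1 Jswap by (simp add: J_def)
  also have "\<bar>\<dots>\<bar> \<le> (\<integral>x. \<bar>(\<integral>y. F x y \<partial>M) + (\<integral>y. F y x \<partial>M)\<bar> \<partial>M)"
    by (rule integral_abs_bound)
  also have "\<dots> \<le> (\<integral>x. (g x * (\<integral>y. norm (\<xi> y) \<partial>M) + (\<integral>y. g y \<partial>M) * norm (\<xi> x)) \<partial>M)"
  proof (rule integral_mono_AE)
    show "integrable M (\<lambda>x. \<bar>(\<integral>y. F x y \<partial>M) + (\<integral>y. F y x \<partial>M)\<bar>)" using 1 by auto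
    show "integrable M (\<lambda>x. g x * (\<integral>y. norm (\<xi> y) \<partial>M) + (\<integral>y. g y \<partial>M) * norm (\<xi> x))"
      using g \<xi>int by auto
    show "AE x in M. \<bar>(\<integral>y. F x y \<partial>M) + (\<integral>y. F y x \<partial>M)\<bar>
           \<le> g x * (\<integral>y. norm (\<xi> y) \<partial>M) + (\<integral>y. g y \<partial>M) * norm (\<xi> x)"
      using G 2
    proof eventually_elim
      case (elim x)
      have "(\<integral>y. F x y \<partial>M) + (\<integral>y. F y x \<partial>M) = (\<integral>y. F x y + F y x \<partial>M)"
        using elim Fint by simp
      also have "\<bar>\<dots>\<bar> \<le> (\<integral>y. \<bar>F x y + F y x\<bar> \<partial>M)" by (rule integral_abs_bound)
      also have "\<dots> \<le> (\<integral>y. g x * norm (\<xi> y) + g y * norm (\<xi> x) \<partial>M)"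
      proof (rule integral_mono_AE)
        show "integrable M (\<lambda>y. \<bar>F x y + F y x\<bar>)" using elim Fint by auto
        show "integrable M (\<lambda>y. g x * norm (\<xi> y) + g y * norm (\<xi> x))" using g \<xi>int by auto
        show "AE y in M. \<bar>F x y + F y x\<bar> \<le> g x * norm (\<xi> y) + g y * norm (\<xi> x)"
          using G
        proof eventually_elim
          case (elim y)
          have "F y x = - c y * (\<xi> y \<bullet> biot_savart (\<xi> x - \<xi> y))"
            unfolding F_def using biot_savart_minus[of "\<xi> x - \<xi> y"] by (simp add: inner_minus_right)
          then have "F y x = - c y * (\<xi> x \<bullet> biot_savart (\<xi> x - \<xi> y))"
            by (simp only: inner_biot_savart_symmetrized(2)[of "\<xi> x" "\<xi> y"])
          then have "F x y + F y x = (c x - c y) * (\<xi> x \<bullet> biot_savart (\<xi> x - \<xi> y))"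
            unfolding F_def by (simp add: algebra_simps)
          then show ?case using bd[OF \<open>G x\<close> elim] by (simp add: abs_mult)
        qed
      qed
      also have "\<dots> = g x * (\<integral>y. norm (\<xi> y) \<partial>M) + (\<integral>y. g y \<partial>M) * norm (\<xi> x)"
        using g \<xi>int by simp
      finally show ?case .
    qed
  qed
  also have "\<dots> = 2 * ((\<integral>x. g x \<partial>M) * (\<integral>x. norm (\<xi> x) \<partial>M))" using g \<xi>int by simp
  finally have "\<bar>J\<bar> \<le> (\<integral>x. g x \<partial>M) * (\<integral>x. norm (\<xi> x) \<partial>M)" by simp
  moreover have "J = (\<integral>x. c x * (\<xi> x \<bullet> (\<integral>y. biot_savart (\<xi> x - \<xi> y) \<partial>M)) \<partial>M)"
    unfolding J_def F_def
  proof (rule Bochner_Integration.integral_cong[OF refl])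
    fix x
    have "(\<integral>y. c x * (\<xi> x \<bullet> biot_savart (\<xi> x - \<xi> y)) \<partial>M)
        = c x * (\<integral>y. \<xi> x \<bullet> biot_savart (\<xi> x - \<xi> y) \<partial>M)"
      by simp
    also have "(\<integral>y. \<xi> x \<bullet> biot_savart (\<xi> x - \<xi> y) \<partial>M) = \<xi> x \<bullet> (\<integral>y. biot_savart (\<xi> x - \<xi> y) \<partial>M)"
      by (rule integral_inner_right) (use K(1) in auto)
    finally show "(\<integral>y. c x * (\<xi> x \<bullet> biot_savart (\<xi> x - \<xi> y)) \<partial>M)
        = c x * (\<xi> x \<bullet> (\<integral>y. biot_savart (\<xi> x - \<xi> y) \<partial>M))" .
  qed
  ultimately show ?thesis by simp
qed

text \<open>The factors that the induction over the order of the tail moments accumulates.\<close>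

primrec tail_const :: "real \<Rightarrow> real \<Rightarrow> nat \<Rightarrow> real" where
  "tail_const A d 0 = A"
| "tail_const A d (Suc k) = (real (2 * k + 2))\<^sup>2 * d * (2 * A) * tail_const A d k"

text \<open>Blob \<open>i\<close> is the measure \<open>M i\<close> on labels, its vorticity has the sign \<open>s i\<close>, and label \<open>x\<close> is at
  \<open>Z t x\<close> at time \<open>t\<close>. The singularity of the kernel is controlled by \<open>kernel\<close>, where \<open>B\<close> may
  grow like a negative power of \<open>\<epsilon>\<close>, while \<open>A\<close>, \<open>d\<close> and \<open>T\<close> are independent of \<open>\<epsilon>\<close>. The
  last of the conditions \<open>small\<close> keeps all exponential factors below \<open>10 / 9\<close>.\<close>

locale vortex_blobs =
  fixes I :: "nat set" and M :: "nat \<Rightarrow> 'l measure" and s :: "nat \<Rightarrow> real"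
    and Z :: "real \<Rightarrow> 'l \<Rightarrow> plane" and Y :: "nat \<Rightarrow> real \<Rightarrow> plane"
    and T A d \<theta> B \<epsilon> :: real
  assumes finI: "finite I"
    and fin: "\<And>i. i \<in> I \<Longrightarrow> finite_measure (M i)"
    and Z_measurable: "\<And>t i. t \<in> {0..T} \<Longrightarrow> i \<in> I \<Longrightarrow> Z t \<in> borel_measurable (M i)"
    and sgn: "\<And>i. i \<in> I \<Longrightarrow> \<bar>s i\<bar> = 1"
    and pos: "0 < T" "0 < A" "0 < d" "0 < \<theta>" "0 < \<epsilon>" "0 \<le> B"
    and mass: "(\<Sum>i\<in>I. measure (M i) (space (M i))) \<le> A"
    and kernel: "\<And>t j z. t \<in> {0..T} \<Longrightarrow> j \<in> I \<Longrightarrow>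
          integrable (M j) (\<lambda>y. norm (biot_savart (z - Z t y)) powr (1 + \<theta>)) \<and>
          (\<integral>y. norm (biot_savart (z - Z t y)) powr (1 + \<theta>) \<partial>M j) \<le> B"
    and flow: "\<And>i. i \<in> I \<Longrightarrow> AE x in M i. \<forall>t\<in>{0..T}.
          ((\<lambda>t. Z t x) has_vector_derivative
             (\<Sum>j\<in>I. s j *\<^sub>R (\<integral>y. biot_savart (Z t x - Z t y) \<partial>M j))) (at t within {0..T})"
    and vortices: "\<And>i t. i \<in> I \<Longrightarrow> t \<in> {0..T} \<Longrightarrow> (Y i has_vector_derivative
             (\<Sum>j\<in>I - {i}. (s j * measure (M j) (space (M j))) *\<^sub>R biot_savart (Y i t - Y j t)))
             (at t within {0..T})"
    and separated: "\<And>i j t. i \<in> I \<Longrightarrow> j \<in> I \<Longrightarrow> i \<noteq> j \<Longrightarrow> t \<in> {0..T} \<Longrightarrow>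
             3 * d / 4 \<le> norm (Y i t - Y j t)"
    and initial_moment: "(\<Sum>i\<in>I. \<integral>x. (norm (Z 0 x - Y i 0))\<^sup>2 \<partial>M i) \<le> A * \<epsilon>\<^sup>2"
    and initial_support: "\<And>i. i \<in> I \<Longrightarrow> AE x in M i. norm (Z 0 x - Y i 0) \<le> d / 100"
    and small: "\<epsilon> \<le> d / 100" "T \<le> 1" "30 * A * T \<le> d\<^sup>2"
begin

abbreviation "m i \<equiv> measure (M i) (space (M i))"

text \<open>The velocity induced by blob \<open>j\<close>, up to its sign; then the total velocity, the velocity of vortex
  \<open>i\<close>, and the displacement of a particle of blob \<open>i\<close> from its vortex.\<close>

definition v :: "nat \<Rightarrow> real \<Rightarrow> plane \<Rightarrow> plane" where
  "v j t z = (\<integral>y. biot_savart (z - Z t y) \<partial>M j)"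

definition u :: "real \<Rightarrow> plane \<Rightarrow> plane" where
  "u t z = (\<Sum>j\<in>I. s j *\<^sub>R v j t z)"

definition V :: "nat \<Rightarrow> real \<Rightarrow> plane" where
  "V i t = (\<Sum>j\<in>I - {i}. (s j * m j) *\<^sub>R biot_savart (Y i t - Y j t))"

definition \<xi> :: "nat \<Rightarrow> real \<Rightarrow> 'l \<Rightarrow> plane" where
  "\<xi> i t x = Z t x - Y i t"

definition first_moment :: "real \<Rightarrow> real" where
  "first_moment t = (\<Sum>i\<in>I. \<integral>x. norm (\<xi> i t x) \<partial>M i)"

definition second_moment :: "real \<Rightarrow> real" where
  "second_moment t = (\<Sum>i\<in>I. \<integral>x. (norm (\<xi> i t x))\<^sup>2 \<partial>M i)"

text \<open>The hypothesis of the continuous induction. Radius \<open>d / 8\<close> and vortices at distance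
  \<open>3 d / 4\<close> leave \<open>d / 2\<close> between different blobs. The
  exceptional null set of labels is the same for all times, so single trajectories can be
  followed.\<close>

definition confined :: "real \<Rightarrow> bool" where
  "confined \<tau> \<longleftrightarrow> \<tau> \<in> {0..T} \<and> (\<forall>i\<in>I. AE x in M i. \<forall>t\<in>{0..\<tau>}. norm (\<xi> i t x) \<le> d / 8)"

lemma confinedD: "confined \<tau> \<Longrightarrow> t \<in> {0..\<tau>} \<Longrightarrow> t \<in> {0..T}"
  by (auto simp: confined_def)

lemma \<xi>_measurable [measurable]: "t \<in> {0..T} \<Longrightarrow> i \<in> I \<Longrightarrow> \<xi> i t \<in> borel_measurable (M i)"
  unfolding \<xi>_def using Z_measurable by measurable

lemma m_le: "i \<in> I \<Longrightarrow> m i \<le> A"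
  using mass member_le_sum[of i I "\<lambda>i. measure (M i) (space (M i))"] finI by simp

text \<open>Interpolation between the power \<open>1 + \<theta>\<close> and the power \<open>0\<close>.\<close>

lemma kernel_integrable:
  assumes "t \<in> {0..T}" "j \<in> I"
  shows "integrable (M j) (\<lambda>y. biot_savart (z - Z t y))"
    and "(\<integral>y. norm (biot_savart (z - Z t y)) \<partial>M j) \<le> B + m j"
proof -
  interpret finite_measure "M j" by (rule fin) (use assms in auto)
  note [measurable] = Z_measurable[OF assms]
  have le: "norm (biot_savart (z - Z t y)) \<le> norm (biot_savart (z - Z t y)) powr (1 + \<theta>) + 1" for y
    using le_powr_interpolate[of "norm (biot_savart (z - Z t y))" 1 \<theta>] pos by simp
  have int: "integrable (M j) (\<lambda>y. norm (biot_savart (z - Z t y)) powr (1 + \<theta>) + 1)"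
    using kernel[OF assms] by auto
  show i1: "integrable (M j) (\<lambda>y. biot_savart (z - Z t y))"
    by (rule Bochner_Integration.integrable_bound[OF int]) (use le in \<open>auto intro!: AE_I2\<close>)
  have "(\<integral>y. norm (biot_savart (z - Z t y)) \<partial>M j)
      \<le> (\<integral>y. norm (biot_savart (z - Z t y)) powr (1 + \<theta>) + 1 \<partial>M j)"
    by (rule integral_mono[OF integrable_norm[OF i1] int le])
  also have "\<dots> \<le> B + m j" using kernel[OF assms, of z] by simp
  finally show "(\<integral>y. norm (biot_savart (z - Z t y)) \<partial>M j) \<le> B + m j" .
qed

lemma v_measurable [measurable]: "t \<in> {0..T} \<Longrightarrow> j \<in> I \<Longrightarrow> v j t \<in> borel_measurable borel"
proof -
  assume a: "t \<in> {0..T}" "j \<in> I"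
  interpret finite_measure "M j" by (rule fin) (use a in auto)
  note [measurable] = Z_measurable[OF a]
  show ?thesis unfolding v_def by measurable
qed

lemma norm_v_le: "t \<in> {0..T} \<Longrightarrow> j \<in> I \<Longrightarrow> norm (v j t z) \<le> B + m j"
  unfolding v_def by (rule order_trans[OF integral_norm_bound kernel_integrable(2)])

definition speed_bound where "speed_bound = real (card I) * B + A"

lemma norm_u_le: assumes "t \<in> {0..T}" shows "norm (u t z) \<le> speed_bound"
proof -
  have "norm (u t z) \<le> (\<Sum>j\<in>I. norm (s j *\<^sub>R v j t z))" unfolding u_def by (rule norm_sum)
  also have "\<dots> \<le> (\<Sum>j\<in>I. B + m j)"
    using norm_v_le[OF assms] sgn by (intro sum_mono) auto
  also have "\<dots> \<le> speed_bound" using mass by (simp add: sum.distrib speed_bound_def)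
  finally show ?thesis .
qed

lemma u_measurable [measurable]: "t \<in> {0..T} \<Longrightarrow> u t \<in> borel_measurable borel"
  unfolding u_def by measurable

lemma norm_V_le: assumes "t \<in> {0..T}" "i \<in> I" shows "norm (V i t) \<le> A / d"
proof -
  have "norm (V i t) \<le> (\<Sum>j\<in>I - {i}. norm ((s j * m j) *\<^sub>R biot_savart (Y i t - Y j t)))"
    unfolding V_def by (rule norm_sum)
  also have "\<dots> \<le> (\<Sum>j\<in>I - {i}. m j * (1 / d))"
  proof (rule sum_mono)
    fix j assume j: "j \<in> I - {i}"
    have "norm (biot_savart (Y i t - Y j t)) \<le> 1 / d"
      by (rule norm_biot_savart_le) (use separated[of i j t] j assms pos in auto)
    then show "norm ((s j * m j) *\<^sub>R biot_savart (Y i t - Y j t)) \<le> m j * (1 / d)"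
      using sgn[of j] j mult_left_mono[of _ "1 / d" "m j"] by (simp add: abs_mult)
  qed
  also have "\<dots> \<le> (\<Sum>j\<in>I. m j * (1 / d))"
    by (rule sum_mono2) (use finI pos in auto)
  also have "\<dots> = (\<Sum>j\<in>I. m j) * (1 / d)" by (simp only: sum_distrib_right)
  also have "\<dots> \<le> A * (1 / d)" using mass pos by (intro mult_right_mono) auto
  finally show ?thesis by simp
qed

lemma \<xi>_bound:
  assumes "confined \<tau>" "t \<in> {0..\<tau>}" "i \<in> I"
  shows "AE x in M i. norm (\<xi> i t x) \<le> d / 8"
proof -
  have "AE x in M i. \<forall>t\<in>{0..\<tau>}. norm (\<xi> i t x) \<le> d / 8"
    using assms by (auto simp: confined_def)
  then show ?thesis by eventually_elim (use assms in auto)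
qed

lemma \<xi>_integrable:
  assumes "confined \<tau>" "t \<in> {0..\<tau>}" "i \<in> I"
  shows "integrable (M i) (\<lambda>x. norm (\<xi> i t x))" "integrable (M i) (\<lambda>x. (norm (\<xi> i t x))\<^sup>2)"
proof -
  interpret finite_measure "M i" by (rule fin) (use assms in auto)
  note [measurable] = \<xi>_measurable[OF confinedD[OF assms(1,2)] assms(3)]
  show "integrable (M i) (\<lambda>x. norm (\<xi> i t x))"
    by (rule integrable_const_bound[where B = "d / 8"]) (use \<xi>_bound[OF assms] in auto)
  show "integrable (M i) (\<lambda>x. (norm (\<xi> i t x))\<^sup>2)"
  proof (rule integrable_const_bound[where B = "(d / 8)\<^sup>2"])
    show "AE x in M i. norm ((norm (\<xi> i t x))\<^sup>2) \<le> (d / 8)\<^sup>2"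
      using \<xi>_bound[OF assms] by eventually_elim (auto intro!: power_mono)
  qed auto
qed

lemma first_moment_ge: 
  assumes "confined \<tau>" "t \<in> {0..\<tau>}" "i \<in> I"
  shows "(\<integral>x. norm (\<xi> i t x) \<partial>M i) \<le> first_moment t"
  unfolding first_moment_def using assms(3) finI by (intro member_le_sum) auto

text \<open>The kernel is Lipschitz on the distances between different blobs. Replacing the other blobs by
  point vortices, and the particle by its own vortex, thus costs an error linear in the
  displacements.\<close>

lemma external_velocity:
  assumes \<tau>: "confined \<tau>" "t \<in> {0..\<tau>}" and i: "i \<in> I" and z: "norm (z - Y i t) \<le> d / 8"
  shows "norm (u t z - s i *\<^sub>R v i t z - V i t) \<le> (A * norm (z - Y i t) + first_moment t) / d\<^sup>2"
proof -
  note t = confinedD[OF \<tau>]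
  define e where "e j = (\<integral>y. norm (\<xi> j t y) \<partial>M j)" for j
  have one: "norm (v j t z - m j *\<^sub>R biot_savart (Y i t - Y j t)) \<le> (m j * norm (z - Y i t) + e j) / d\<^sup>2"
    if j: "j \<in> I" "j \<noteq> i" for j
  proof -
    interpret finite_measure "M j" by (rule fin[OF j(1)])
    note [measurable] = Z_measurable[OF t j(1)]
    note Ki = kernel_integrable(1)[OF t j(1), of z]
    have "v j t z - m j *\<^sub>R biot_savart (Y i t - Y j t)
        = (\<integral>y. biot_savart (z - Z t y) - biot_savart (Y i t - Y j t) \<partial>M j)"
      unfolding v_def using Ki by simp
    also have "norm \<dots> \<le> (\<integral>y. norm (biot_savart (z - Z t y) - biot_savart (Y i t - Y j t)) \<partial>M j)"
      by (rule integral_norm_bound)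
    also have "\<dots> \<le> (\<integral>y. (norm (z - Y i t) + norm (\<xi> j t y)) / d\<^sup>2 \<partial>M j)"
    proof (rule integral_mono_AE)
      show "integrable (M j) (\<lambda>y. norm (biot_savart (z - Z t y) - biot_savart (Y i t - Y j t)))"
        using Ki by auto
      show "integrable (M j) (\<lambda>y. (norm (z - Y i t) + norm (\<xi> j t y)) / d\<^sup>2)"
        using \<xi>_integrable[OF \<tau> j(1)] by auto
      show "AE y in M j. norm (biot_savart (z - Z t y) - biot_savart (Y i t - Y j t))
              \<le> (norm (z - Y i t) + norm (\<xi> j t y)) / d\<^sup>2"
        using \<xi>_bound[OF \<tau> j(1)]
      proof eventually_elim
        case (elim y)
        have sep: "3 * d / 4 \<le> norm (Y i t - Y j t)" using separated[OF i j(1) _ t] j by auto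
        have eq: "(z - Z t y) - (Y i t - Y j t) = (z - Y i t) - \<xi> j t y" by (simp add: \<xi>_def)
        have le: "norm ((z - Z t y) - (Y i t - Y j t)) \<le> norm (z - Y i t) + norm (\<xi> j t y)"
          unfolding eq by (rule norm_triangle_ineq4)
        have "norm (Y i t - Y j t) - norm (z - Z t y) \<le> norm ((z - Z t y) - (Y i t - Y j t))"
          by (metis norm_minus_commute norm_triangle_ineq2)
        then have far: "d / 2 \<le> norm (z - Z t y)" using sep le elim z by linarith
        have "norm (biot_savart (z - Z t y) - biot_savart (Y i t - Y j t))
            \<le> norm ((z - Z t y) - (Y i t - Y j t)) / d\<^sup>2"
          by (rule biot_savart_lipschitz) (use far sep pos in auto)
        also have "\<dots> \<le> (norm (z - Y i t) + norm (\<xi> j t y)) / d\<^sup>2"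
          using le by (intro divide_right_mono) auto
        finally show ?case .
      qed
    qed
    also have "\<dots> = (m j * norm (z - Y i t) + e j) / d\<^sup>2"
      unfolding e_def using \<xi>_integrable(1)[OF \<tau> j(1)] by simp
    finally show ?thesis .
  qed
  have "u t z - s i *\<^sub>R v i t z - V i t
      = (\<Sum>j\<in>I - {i}. s j *\<^sub>R (v j t z - m j *\<^sub>R biot_savart (Y i t - Y j t)))"
    unfolding u_def V_def using finI i
    by (simp add: sum.remove[of I i] sum_subtractf scaleR_diff_right)
  also have "norm \<dots> \<le> (\<Sum>j\<in>I - {i}. norm (s j *\<^sub>R (v j t z - m j *\<^sub>R biot_savart (Y i t - Y j t))))"
    by (rule norm_sum)
  also have "\<dots> \<le> (\<Sum>j\<in>I - {i}. (m j * norm (z - Y i t) + e j) / d\<^sup>2)"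
    using one sgn by (intro sum_mono) auto
  also have "\<dots> \<le> (\<Sum>j\<in>I. (m j * norm (z - Y i t) + e j) / d\<^sup>2)"
    using finI by (intro sum_mono2) (auto simp: e_def)
  also have "\<dots> = ((\<Sum>j\<in>I. m j) * norm (z - Y i t) + first_moment t) / d\<^sup>2"
    unfolding first_moment_def e_def by (simp add: sum_divide_distrib[symmetric] sum.distrib sum_distrib_right)
  also have "\<dots> \<le> (A * norm (z - Y i t) + first_moment t) / d\<^sup>2"
    using mass by (intro divide_right_mono add_right_mono mult_right_mono) auto
  finally show ?thesis .
qed

lemma \<xi>_derivative:
  assumes "i \<in> I" "\<tau> \<in> {0..T}"
  shows "AE x in M i. \<forall>t\<in>{0..\<tau>}.
     ((\<lambda>t. \<xi> i t x) has_vector_derivative (u t (Z t x) - V i t)) (at t within {0..\<tau>})"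
  using flow[OF assms(1)]
proof eventually_elim
  case (elim x)
  show ?case
  proof
    fix t assume t: "t \<in> {0..\<tau>}"
    then have t': "t \<in> {0..T}" using assms by auto
    have "((\<lambda>t. \<xi> i t x) has_vector_derivative (u t (Z t x) - V i t)) (at t within {0..T})"
      unfolding \<xi>_def u_def v_def V_def using elim t' vortices[OF assms(1) t']
      by (intro derivative_intros) auto
    then show "((\<lambda>t. \<xi> i t x) has_vector_derivative (u t (Z t x) - V i t)) (at t within {0..\<tau>})"
      by (rule has_vector_derivative_within_subset) (use assms in auto)
  qed
qed

lemma norm2_\<xi>_derivative:
  assumes "((\<lambda>t. \<xi> i t x) has_vector_derivative w) (at t within X)"
  shows "((\<lambda>t. (norm (\<xi> i t x))\<^sup>2) has_real_derivative 2 * (\<xi> i t x \<bullet> w)) (at t within X)"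
proof -
  have "((\<lambda>t. \<xi> i t x \<bullet> \<xi> i t x) has_derivative (\<lambda>h. \<xi> i t x \<bullet> (h *\<^sub>R w) + (h *\<^sub>R w) \<bullet> \<xi> i t x)) (at t within X)"
    using assms unfolding has_vector_derivative_def by (intro has_derivative_inner)
  then show ?thesis unfolding power2_norm_eq_inner has_field_derivative_def
    by (rule has_derivative_eq_rhs) (auto simp: inner_commute algebra_simps)
qed

text \<open>The symmetrised bound for one blob, written with displacements: the position of the vortex drops
  out of differences.\<close>

lemma self_interaction_bound:
  assumes \<tau>: "confined \<tau>" "t \<in> {0..\<tau>}" and i: "i \<in> I"
    and c: "c \<in> borel_measurable (M i)" "\<And>x. norm (\<xi> i t x) \<le> d / 8 \<Longrightarrow> \<bar>c x\<bar> \<le> cb"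
    and g: "integrable (M i) g"
    and bd: "\<And>x y. norm (\<xi> i t x) \<le> d / 8 \<Longrightarrow> norm (\<xi> i t y) \<le> d / 8 \<Longrightarrow>
      \<bar>c x - c y\<bar> * \<bar>\<xi> i t x \<bullet> biot_savart (\<xi> i t x - \<xi> i t y)\<bar>
        \<le> g x * norm (\<xi> i t y) + g y * norm (\<xi> i t x)"
  shows "\<bar>\<integral>x. c x * (\<xi> i t x \<bullet> v i t (Z t x)) \<partial>M i\<bar>
           \<le> (\<integral>x. g x \<partial>M i) * (\<integral>x. norm (\<xi> i t x) \<partial>M i)"
proof -
  note t = confinedD[OF \<tau>]
  have eq: "z - \<xi> i t y = (z + Y i t) - Z t y" "\<xi> i t x - \<xi> i t y = Z t x - Z t y" for x y z
    by (simp_all add: \<xi>_def)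
  show ?thesis unfolding v_def eq(2)[symmetric]
  proof (rule symmetrized_velocity_bound[where G = "\<lambda>x. norm (\<xi> i t x) \<le> d / 8" and b = "d / 8" and U = "B + m i"])
    show "integrable (M i) (\<lambda>y. biot_savart (z - \<xi> i t y))"
         "(\<integral>y. norm (biot_savart (z - \<xi> i t y)) \<partial>M i) \<le> B + m i" for z
      unfolding eq(1) using kernel_integrable[OF t i] by auto
  qed (use fin i c g bd \<xi>_bound[OF \<tau> i] \<xi>_measurable[OF t i] in auto)
qed

lemma radial_integrable:
  assumes \<tau>: "confined \<tau>" "t \<in> {0..\<tau>}" and i: "i \<in> I"
    and c: "c \<in> borel_measurable (M i)" "\<And>x. norm (\<xi> i t x) \<le> d / 8 \<Longrightarrow> \<bar>c x\<bar> \<le> cb"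
  shows "integrable (M i) (\<lambda>x. c x * (\<xi> i t x \<bullet> v i t (Z t x)))"
proof -
  note t = confinedD[OF \<tau>]
  interpret finite_measure "M i" by (rule fin[OF i])
  note [measurable] = Z_measurable[OF t i] \<xi>_measurable[OF t i] c(1) v_measurable[OF t i]
  show ?thesis
  proof (rule integrable_const_bound[where B = "cb * (d / 8 * (B + m i))"])
    show "AE x in M i. norm (c x * (\<xi> i t x \<bullet> v i t (Z t x))) \<le> cb * (d / 8 * (B + m i))"
      using \<xi>_bound[OF \<tau> i]
    proof eventually_elim
      case (elim x)
      have "\<bar>\<xi> i t x \<bullet> v i t (Z t x)\<bar> \<le> norm (\<xi> i t x) * norm (v i t (Z t x))"
        by (rule Cauchy_Schwarz_ineq2)
      also have "\<dots> \<le> d / 8 * (B + m i)"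
        using elim norm_v_le[OF t i] pos by (intro mult_mono) auto
      finally show ?case using c(2)[OF elim] unfolding real_norm_def abs_mult
        by (intro mult_mono) auto
    qed
  qed measurable
qed

text \<open>Cauchy--Schwarz, as nonnegativity of \<open>\<Sum>i. \<integral>(\<bar>\<xi>\<bar> - first_moment / A)\<^sup>2\<close>.\<close>

lemma first_moment_squared_le:
  assumes \<tau>: "confined \<tau>" "t \<in> {0..\<tau>}"
  shows "(first_moment t)\<^sup>2 \<le> A * second_moment t"
proof -
  define c where "c = first_moment t / A"
  have one: "(\<integral>x. (norm (\<xi> i t x) - c)\<^sup>2 \<partial>M i)
      = (\<integral>x. (norm (\<xi> i t x))\<^sup>2 \<partial>M i) - 2 * c * (\<integral>x. norm (\<xi> i t x) \<partial>M i) + c\<^sup>2 * m i"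
    if i: "i \<in> I" for i
  proof -
    interpret finite_measure "M i" by (rule fin[OF i])
    have "(\<integral>x. (norm (\<xi> i t x) - c)\<^sup>2 \<partial>M i)
        = (\<integral>x. (norm (\<xi> i t x))\<^sup>2 - 2 * c * norm (\<xi> i t x) + c\<^sup>2 \<partial>M i)"
      by (rule Bochner_Integration.integral_cong) (auto simp: power2_diff)
    then show ?thesis using \<xi>_integrable[OF \<tau> i] by simp
  qed
  have "0 \<le> (\<Sum>i\<in>I. \<integral>x. (norm (\<xi> i t x) - c)\<^sup>2 \<partial>M i)" by (intro sum_nonneg) auto
  also have "\<dots> = second_moment t - 2 * c * first_moment t + c\<^sup>2 * (\<Sum>i\<in>I. m i)"
    using one by (simp add: sum.distrib sum_subtractf second_moment_def first_moment_def sum_distrib_left)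
  also have "\<dots> \<le> second_moment t - 2 * c * first_moment t + c\<^sup>2 * A"
    using mass by (intro add_left_mono mult_left_mono) auto
  also have "\<dots> = second_moment t - (first_moment t)\<^sup>2 / A" unfolding c_def using pos
    by (simp add: field_simps power2_eq_square)
  finally show ?thesis using pos by (simp add: field_simps)
qed

text \<open>The self-interaction vanishes by symmetrisation with constant weight. What remains is the
  external velocity relative to the vortex, at most \<open>(A \<bar>\<xi>\<bar> + first_moment) / d\<^sup>2\<close>, and by
  Cauchy--Schwarz both terms contribute a multiple of the second moment.\<close>

lemma second_moment_derivative:
  assumes \<tau>: "confined \<tau>" and t: "t \<in> {0..\<tau>}"
  shows "(second_moment has_real_derivative (\<Sum>i\<in>I. \<integral>x. 2 * (\<xi> i t x \<bullet> (u t (Z t x) - V i t)) \<partial>M i))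
           (at t within {0..\<tau>})"
    and "(\<Sum>i\<in>I. \<integral>x. 2 * (\<xi> i t x \<bullet> (u t (Z t x) - V i t)) \<partial>M i) \<le> 4 * A / d\<^sup>2 * second_moment t"
proof -
  let ?f' = "\<lambda>i t x. 2 * (\<xi> i t x \<bullet> (u t (Z t x) - V i t))"
  have T\<tau>: "\<tau> \<in> {0..T}" using \<tau> by (auto simp: confined_def)
  have *: "((\<lambda>t. \<integral>x. (norm (\<xi> i t x))\<^sup>2 \<partial>M i) has_real_derivative (\<integral>x. ?f' i t x \<partial>M i)) (at t within {0..\<tau>})
      \<and> integrable (M i) (?f' i t)" if i: "i \<in> I" for i
  proof -
    have d: "AE x in M i. \<forall>t\<in>{0..\<tau>}. ((\<lambda>t. (norm (\<xi> i t x))\<^sup>2) has_real_derivative ?f' i t x) (at t within {0..\<tau>})"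
      using \<xi>_derivative[OF i T\<tau>] by eventually_elim (auto intro: norm2_\<xi>_derivative)
    have "AE x in M i. \<forall>t\<in>{0..\<tau>}. norm (\<xi> i t x) \<le> d / 8"
      using \<tau> i by (auto simp: confined_def)
    then have b: "AE x in M i. \<forall>t\<in>{0..\<tau>}. \<bar>?f' i t x\<bar> \<le> 2 * (d / 8 * (speed_bound + A / d))"
    proof eventually_elim
      case (elim x)
      show ?case
      proof
        fix t assume t: "t \<in> {0..\<tau>}"
        note t' = confinedD[OF \<tau> t]
        have "\<bar>\<xi> i t x \<bullet> (u t (Z t x) - V i t)\<bar> \<le> norm (\<xi> i t x) * norm (u t (Z t x) - V i t)"
          by (rule Cauchy_Schwarz_ineq2)
        also have "\<dots> \<le> d / 8 * (speed_bound + A / d)"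
          using elim t pos norm_u_le[OF t', of "Z t x"] norm_V_le[OF t' i]
            norm_triangle_ineq4[of "u t (Z t x)" "V i t"] by (intro mult_mono) auto
        finally show "\<bar>?f' i t x\<bar> \<le> 2 * (d / 8 * (speed_bound + A / d))" by simp
      qed
    qed
    have m: "?f' i t \<in> borel_measurable (M i)" if "t \<in> {0..\<tau>}" for t
    proof -
      note t' = confinedD[OF \<tau> that]
      note [measurable] = Z_measurable[OF t' i] \<xi>_measurable[OF t' i] u_measurable[OF t']
      show ?thesis by measurable
    qed
    show ?thesis
      using has_real_derivative_integral[OF fin[OF i] \<xi>_integrable(2)[OF \<tau> _ i] m d b t] by auto
  qed
  then show "(second_moment has_real_derivative (\<Sum>i\<in>I. \<integral>x. ?f' i t x \<partial>M i)) (at t within {0..\<tau>})"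
    unfolding second_moment_def by (intro DERIV_sum) auto
  have "(\<Sum>i\<in>I. \<integral>x. ?f' i t x \<partial>M i)
      \<le> (\<Sum>i\<in>I. 2 / d\<^sup>2 * (A * (\<integral>x. (norm (\<xi> i t x))\<^sup>2 \<partial>M i) + first_moment t * (\<integral>x. norm (\<xi> i t x) \<partial>M i)))"
  proof (rule sum_mono)
    fix i assume i: "i \<in> I"
    note [simp] = \<xi>_integrable[OF \<tau> t i]
    have ri: "integrable (M i) (\<lambda>x. 1 * (\<xi> i t x \<bullet> v i t (Z t x)))"
      by (rule radial_integrable[OF \<tau> t i, where cb = 1]) auto
    have "\<bar>\<integral>x. 1 * (\<xi> i t x \<bullet> v i t (Z t x)) \<partial>M i\<bar> \<le> (\<integral>x. 0 \<partial>M i) * (\<integral>x. norm (\<xi> i t x) \<partial>M i)"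
      by (rule self_interaction_bound[OF \<tau> t i, where cb = 1]) auto
    then have zero: "(\<integral>x. \<xi> i t x \<bullet> v i t (Z t x) \<partial>M i) = 0" by simp
    have "(\<integral>x. ?f' i t x \<partial>M i) \<le> (\<integral>x. 2 * s i * (\<xi> i t x \<bullet> v i t (Z t x))
        + 2 / d\<^sup>2 * (A * (norm (\<xi> i t x))\<^sup>2 + first_moment t * norm (\<xi> i t x)) \<partial>M i)"
    proof (rule integral_mono_AE)
      show "integrable (M i) (?f' i t)" using * i by auto
      show "integrable (M i) (\<lambda>x. 2 * s i * (\<xi> i t x \<bullet> v i t (Z t x))
        + 2 / d\<^sup>2 * (A * (norm (\<xi> i t x))\<^sup>2 + first_moment t * norm (\<xi> i t x)))"
        using ri by auto
      show "AE x in M i. ?f' i t x \<le> 2 * s i * (\<xi> i t x \<bullet> v i t (Z t x))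
        + 2 / d\<^sup>2 * (A * (norm (\<xi> i t x))\<^sup>2 + first_moment t * norm (\<xi> i t x))"
        using \<xi>_bound[OF \<tau> t i]
      proof eventually_elim
        case (elim x)
        define w where "w = u t (Z t x) - s i *\<^sub>R v i t (Z t x) - V i t"
        have "norm w \<le> (A * norm (\<xi> i t x) + first_moment t) / d\<^sup>2"
          unfolding w_def using external_velocity[OF \<tau> t i, of "Z t x"] elim by (simp add: \<xi>_def)
        then have "\<xi> i t x \<bullet> w \<le> norm (\<xi> i t x) * ((A * norm (\<xi> i t x) + first_moment t) / d\<^sup>2)"
          by (intro order_trans[OF norm_cauchy_schwarz] mult_left_mono) auto
        moreover have "\<xi> i t x \<bullet> (u t (Z t x) - V i t) = s i * (\<xi> i t x \<bullet> v i t (Z t x)) + \<xi> i t x \<bullet> w"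
          unfolding w_def by (simp add: inner_diff_right)
        moreover have "2 / d\<^sup>2 * (A * (norm (\<xi> i t x))\<^sup>2 + first_moment t * norm (\<xi> i t x))
            = 2 * (norm (\<xi> i t x) * ((A * norm (\<xi> i t x) + first_moment t) / d\<^sup>2))"
          using pos by (simp add: field_simps power2_eq_square)
        ultimately show ?case by linarith
      qed
    qed
    also have "\<dots> = 2 / d\<^sup>2 * (A * (\<integral>x. (norm (\<xi> i t x))\<^sup>2 \<partial>M i) + first_moment t * (\<integral>x. norm (\<xi> i t x) \<partial>M i))"
      using ri zero by simp
    finally show "(\<integral>x. ?f' i t x \<partial>M i) \<le> \<dots>" .
  qed
  also have "\<dots> = 2 / d\<^sup>2 * (A * second_moment t + (first_moment t)\<^sup>2)"
    unfolding sum_distrib_left[symmetric] sum.distrib second_moment_def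
    by (simp add: first_moment_def[of t, symmetric] power2_eq_square)
  also have "\<dots> \<le> 2 / d\<^sup>2 * (A * second_moment t + A * second_moment t)"
    using first_moment_squared_le[OF \<tau> t] by (intro mult_left_mono add_left_mono) auto
  finally show "(\<Sum>i\<in>I. \<integral>x. ?f' i t x \<partial>M i) \<le> 4 * A / d\<^sup>2 * second_moment t" by simp
qed

text \<open>Taking the square root of the bound for the second moment halves the exponent.\<close>

lemma first_moment_le:
  assumes \<tau>: "confined \<tau>" and t: "t \<in> {0..\<tau>}"
  shows "first_moment t \<le> A * \<epsilon> * exp (2 * A / d\<^sup>2 * t)"
proof -
  have "second_moment t \<le> second_moment 0 * exp (4 * A / d\<^sup>2 * t)"
    by (rule gronwall_exp[OF second_moment_derivative(1)[OF \<tau>]]) (use second_moment_derivative(2)[OF \<tau>] t in auto)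
  also have "\<dots> \<le> A * \<epsilon>\<^sup>2 * exp (4 * A / d\<^sup>2 * t)"
    using initial_moment by (intro mult_right_mono) (auto simp: second_moment_def \<xi>_def)
  also have "exp (4 * A / d\<^sup>2 * t) = (exp (2 * A / d\<^sup>2 * t))\<^sup>2"
    by (simp add: exp_double[symmetric])
  finally have "A * second_moment t \<le> A * (A * \<epsilon>\<^sup>2 * (exp (2 * A / d\<^sup>2 * t))\<^sup>2)"
    using pos by (intro mult_left_mono) auto
  then have "(first_moment t)\<^sup>2 \<le> (A * \<epsilon> * exp (2 * A / d\<^sup>2 * t))\<^sup>2"
    using first_moment_squared_le[OF \<tau> t] by (simp add: power_mult_distrib power2_eq_square algebra_simps)
  then show ?thesis by (rule power2_le_imp_le) (use pos in auto)
qed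

section \<open>Decay of the tails\<close>

text \<open>The first moment is at most \<open>2 A \<epsilon>\<close>. Hence, outside radius \<open>\<epsilon>\<close>, the
  external velocity relative to the vortex is at most \<open>3 A \<bar>\<xi>\<bar> / d\<^sup>2\<close>.\<close>

definition expansion_rate where "expansion_rate = 3 * A / d\<^sup>2"

lemma expansion_rate_nonneg: "0 \<le> expansion_rate" using pos by (auto simp: expansion_rate_def)

lemma exp_small: assumes "x \<le> 1 / 10" shows "exp x \<le> (10 / 9 :: real)"
proof -
  have "9 / 10 \<le> exp (- (1 / 10) :: real)" using exp_ge_add_one_self[of "- (1 / 10)"] by simp
  then have "9 / 10 * exp (1 / 10) \<le> exp (- (1 / 10)) * exp (1 / 10 :: real)" by (intro mult_right_mono) auto
  also have "\<dots> = 1" by (simp add: exp_add[symmetric])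
  finally have "exp (1 / 10) \<le> (10 / 9 :: real)" by simp
  then show ?thesis using assms exp_le_cancel_iff[of x "1 / 10"] by linarith
qed

lemma expansion_rate_t_le: assumes "t \<in> {0..T}" shows "expansion_rate * t \<le> 1 / 10"
proof -
  have "A * t \<le> A * T" using assms pos by (intro mult_left_mono) auto
  then have "30 * (A * t) \<le> d\<^sup>2" using small(3) by simp
  then show ?thesis unfolding expansion_rate_def using pos by (simp add: field_simps)
qed

lemma first_moment_le_linear: assumes "confined \<tau>" "t \<in> {0..\<tau>}" shows "first_moment t \<le> 2 * A * \<epsilon>"
proof -
  note t = confinedD[OF assms]
  have "2 * A / d\<^sup>2 * t \<le> expansion_rate * t" unfolding expansion_rate_def using t pos
    by (intro mult_right_mono divide_right_mono) auto
  then have "exp (2 * A / d\<^sup>2 * t) \<le> 10 / 9" using expansion_rate_t_le[OF t] by (intro exp_small) simp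
  then have "A * \<epsilon> * exp (2 * A / d\<^sup>2 * t) \<le> A * \<epsilon> * 2" using pos by (intro mult_left_mono) auto
  then show ?thesis using first_moment_le[OF assms] by simp
qed

text \<open>Squared distance in a frame that expands at a rate beating the strain of the other blobs.\<close>

definition scaled_sq :: "nat \<Rightarrow> real \<Rightarrow> 'l \<Rightarrow> real" where
  "scaled_sq i t x = (norm (\<xi> i t x))\<^sup>2 * exp (- 2 * expansion_rate * t)"

text \<open>The radius \<open>d / 100\<close> contains the whole blob at time \<open>0\<close>, so the excess vanishes initially.\<close>

definition excess :: "nat \<Rightarrow> real \<Rightarrow> 'l \<Rightarrow> real" where
  "excess i t x = max 0 (scaled_sq i t x - (d / 100)\<^sup>2)"

definition tail_moment :: "nat \<Rightarrow> nat \<Rightarrow> real \<Rightarrow> real" where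
  "tail_moment n i t = (\<integral>x. excess i t x ^ n \<partial>M i)"

lemma excess_nonneg: "0 \<le> excess i t x" by (simp add: excess_def)

lemma exp_le_1: "t \<in> {0..T} \<Longrightarrow> exp (- 2 * expansion_rate * t) \<le> 1"
  using expansion_rate_nonneg by simp

lemma excess_le: assumes "t \<in> {0..T}" "norm (\<xi> i t x) \<le> d / 8" shows "excess i t x \<le> d\<^sup>2"
proof -
  have "(norm (\<xi> i t x))\<^sup>2 \<le> d\<^sup>2" using assms pos by (intro power_mono) auto
  then have "scaled_sq i t x \<le> d\<^sup>2 * 1" unfolding scaled_sq_def using exp_le_1[OF assms(1)] by (intro mult_mono) auto
  then have "scaled_sq i t x - (d / 100)\<^sup>2 \<le> d\<^sup>2" using zero_le_power2[of "d / 100"] by linarith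
  then show ?thesis unfolding excess_def by simp
qed

lemma excess_measurable [measurable]: "t \<in> {0..T} \<Longrightarrow> i \<in> I \<Longrightarrow> excess i t \<in> borel_measurable (M i)"
  unfolding excess_def scaled_sq_def by measurable

lemma tail_moment_integrable:
  assumes \<tau>: "confined \<tau>" "t \<in> {0..\<tau>}" and i: "i \<in> I"
  shows "integrable (M i) (\<lambda>x. excess i t x ^ n)"
proof -
  note t = confinedD[OF \<tau>]
  interpret finite_measure "M i" by (rule fin[OF i])
  note [measurable] = excess_measurable[OF t i]
  show ?thesis
  proof (rule integrable_const_bound[where B = "(d\<^sup>2) ^ n"])
    show "AE x in M i. norm (excess i t x ^ n) \<le> (d\<^sup>2) ^ n"
      using \<xi>_bound[OF \<tau> i] by eventually_elim (use excess_nonneg excess_le[OF t] in \<open>auto simp: power_abs intro!: power_mono\<close>)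
  qed measurable
qed

lemma tail_moment_nonneg: "0 \<le> tail_moment n i t"
  unfolding tail_moment_def using excess_nonneg by (intro integral_nonneg_AE) auto

text \<open>Here the expansion of the frame absorbs the external velocity: the contribution of the blob
  itself is all that remains of the growth of \<open>scaled_sq\<close>.\<close>

lemma drift_compensated:
  assumes \<tau>: "confined \<tau>" "t \<in> {0..\<tau>}" and i: "i \<in> I"
    and x: "norm (\<xi> i t x) \<le> d / 8" "d / 100 \<le> norm (\<xi> i t x)"
  shows "\<xi> i t x \<bullet> (u t (Z t x) - V i t) - expansion_rate * (norm (\<xi> i t x))\<^sup>2
           \<le> s i * (\<xi> i t x \<bullet> v i t (Z t x))"
proof -
  define w where "w = u t (Z t x) - s i *\<^sub>R v i t (Z t x) - V i t"
  have "norm w \<le> (A * norm (\<xi> i t x) + first_moment t) / d\<^sup>2"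
    unfolding w_def using external_velocity[OF \<tau> i, of "Z t x"] x by (simp add: \<xi>_def)
  also have "first_moment t \<le> 2 * A * norm (\<xi> i t x)"
    using first_moment_le_linear[OF \<tau>] small(1) x(2) pos by (smt (verit) mult_left_mono)
  finally have "norm w \<le> expansion_rate * norm (\<xi> i t x)"
    unfolding expansion_rate_def by (simp add: divide_right_mono)
  then have "\<xi> i t x \<bullet> w \<le> norm (\<xi> i t x) * (expansion_rate * norm (\<xi> i t x))"
    by (intro order_trans[OF norm_cauchy_schwarz] mult_left_mono) auto
  moreover have "\<xi> i t x \<bullet> (u t (Z t x) - V i t) = s i * (\<xi> i t x \<bullet> v i t (Z t x)) + \<xi> i t x \<bullet> w"
    unfolding w_def by (simp add: inner_diff_right)
  ultimately show ?thesis by (simp add: algebra_simps power2_eq_square)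
qed

abbreviation "scaled_sq_rate i t x \<equiv>
  2 * exp (- 2 * expansion_rate * t) *
    (\<xi> i t x \<bullet> (u t (Z t x) - V i t) - expansion_rate * (norm (\<xi> i t x))\<^sup>2)"

lemma scaled_sq_derivative:
  assumes "((\<lambda>t. \<xi> i t x) has_vector_derivative (u t (Z t x) - V i t)) (at t within X)"
  shows "((\<lambda>t. scaled_sq i t x) has_real_derivative
     scaled_sq_rate i t x) (at t within X)"
proof -
  have "((\<lambda>t. exp (- 2 * expansion_rate * t)) has_real_derivative (- 2 * expansion_rate) * exp (- 2 * expansion_rate * t)) (at t within X)"
    by (auto intro!: derivative_eq_intros)
  from DERIV_mult[OF norm2_\<xi>_derivative[OF assms] this] show ?thesis
    unfolding scaled_sq_def by (rule DERIV_cong) (simp add: algebra_simps)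
qed

lemma scaled_sq_ge_imp:
  assumes "t \<in> {0..T}" "c \<ge> 0" "c\<^sup>2 \<le> scaled_sq i t x"
  shows "c \<le> norm (\<xi> i t x)"
proof (rule power2_le_imp_le)
  have "scaled_sq i t x \<le> (norm (\<xi> i t x))\<^sup>2 * 1"
    unfolding scaled_sq_def using exp_le_1[OF assms(1)] by (intro mult_left_mono) auto
  then show "c\<^sup>2 \<le> (norm (\<xi> i t x))\<^sup>2" using assms by linarith
qed simp

text \<open>The weight is a function of \<open>\<bar>\<xi>\<bar>\<^sup>2\<close>, so its increment carries a factor \<open>\<bar>\<xi> x - \<xi> y\<bar>\<close>, which
  cancels the singularity. Its other factor is the power \<open>n - 2\<close> of the excess at the outer of
  the two points, whereas \<open>abs_inner_biot_savart_le\<close> supplies the norm of the inner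
  point. Integrating the product of the two gives a first moment.\<close>

lemma weight_kernel_bound:
  assumes t: "t \<in> {0..T}" and n: "n \<ge> 2"
    and x: "norm (\<xi> i t x) \<le> d / 8" and y: "norm (\<xi> i t y) \<le> d / 8"
  shows "\<bar>real n * excess i t x ^ (n - 1) * exp (- 2 * expansion_rate * t) - real n * excess i t y ^ (n - 1) * exp (- 2 * expansion_rate * t)\<bar>
      * \<bar>\<xi> i t x \<bullet> biot_savart (\<xi> i t x - \<xi> i t y)\<bar>
      \<le> (real n)\<^sup>2 * d / 2 * excess i t x ^ (n - 2) * norm (\<xi> i t y)
        + (real n)\<^sup>2 * d / 2 * excess i t y ^ (n - 2) * norm (\<xi> i t x)" (is "?lhs \<le> ?rhs")
proof (cases "\<xi> i t x = \<xi> i t y")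
  case True
  have "norm (biot_savart 0) = 0" by (simp add: norm_biot_savart)
  then have "\<xi> i t x \<bullet> biot_savart (\<xi> i t x - \<xi> i t y) = 0" using True by simp
  then have "?lhs = 0" by (simp only: abs_zero mult_zero_right)
  moreover have "0 \<le> ?rhs" using excess_nonneg pos by (intro add_nonneg_nonneg mult_nonneg_nonneg) auto
  ultimately show ?thesis by linarith
next
  case False
  define a b \<Delta> e mn where "a = norm (\<xi> i t x)" and "b = norm (\<xi> i t y)"
    and "\<Delta> = norm (\<xi> i t x - \<xi> i t y)" and "e = exp (- 2 * expansion_rate * t)" and "mn = min a b"
  have \<Delta>: "\<Delta> > 0" using False by (simp add: \<Delta>_def)
  have e: "0 < e" "e \<le> 1" using exp_le_1[OF t] by (auto simp: e_def)
  have ab: "0 \<le> a" "0 \<le> b" "a \<le> d / 8" "b \<le> d / 8" "0 \<le> mn" using x y by (auto simp: a_def b_def mn_def)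
  define mx where "mx = max (excess i t x) (excess i t y)"
  have "\<bar>a\<^sup>2 - b\<^sup>2\<bar> = \<bar>a - b\<bar> * (a + b)"
    using ab by (simp add: power2_eq_square square_diff_square_factored abs_mult)
  also have "\<dots> \<le> \<Delta> * (d / 4)"
    using ab norm_triangle_ineq3[of "\<xi> i t x" "\<xi> i t y"]
    by (intro mult_mono) (auto simp: a_def b_def \<Delta>_def)
  finally have sq: "\<bar>a\<^sup>2 - b\<^sup>2\<bar> \<le> \<Delta> * (d / 4)" .
  have "\<bar>excess i t x - excess i t y\<bar> \<le> \<bar>scaled_sq i t x - scaled_sq i t y\<bar>" by (simp add: excess_def max_def abs_if)
  also have "\<dots> = \<bar>a\<^sup>2 - b\<^sup>2\<bar> * e"
    using e by (simp add: scaled_sq_def a_def b_def e_def left_diff_distrib[symmetric] abs_mult)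
  also have "\<dots> \<le> \<bar>a\<^sup>2 - b\<^sup>2\<bar>" using e by (simp add: mult_left_le)
  finally have Pd: "\<bar>excess i t x - excess i t y\<bar> \<le> \<Delta> * (d / 4)" using sq by simp
  have mx: "0 \<le> mx" using excess_nonneg[of i t x] by (simp add: mx_def)
  have "\<bar>excess i t x ^ (n - 1) - excess i t y ^ (n - 1)\<bar> \<le> real (n - 1) * mx ^ (n - 2) * \<bar>excess i t x - excess i t y\<bar>"
    unfolding mx_def by (rule pos_part_power_diff_le) (use excess_nonneg n in auto)
  also have "\<dots> \<le> real n * mx ^ (n - 2) * (\<Delta> * (d / 4))"
    using Pd mx by (intro mult_mono) auto
  finally have w: "\<bar>excess i t x ^ (n - 1) - excess i t y ^ (n - 1)\<bar> \<le> real n * mx ^ (n - 2) * (\<Delta> * (d / 4))" .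
  have "?lhs = real n * e * \<bar>excess i t x ^ (n - 1) - excess i t y ^ (n - 1)\<bar> * \<bar>\<xi> i t x \<bullet> biot_savart (\<xi> i t x - \<xi> i t y)\<bar>"
  proof -
    have "real n * excess i t x ^ (n - 1) * e - real n * excess i t y ^ (n - 1) * e
        = (real n * e) * (excess i t x ^ (n - 1) - excess i t y ^ (n - 1))" by (simp add: algebra_simps)
    then show ?thesis using e unfolding e_def[symmetric] by (simp only: abs_mult) simp
  qed
  also have "\<dots> \<le> real n * 1 * (real n * mx ^ (n - 2) * (\<Delta> * (d / 4))) * (mn / (2 * pi * \<Delta>))"
    using w e ab abs_inner_biot_savart_le[of "\<xi> i t x" "\<xi> i t y"] mx \<Delta> pos
    by (intro mult_mono) (auto simp: a_def b_def mn_def \<Delta>_def)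
  also have "\<dots> = (real n)\<^sup>2 * mx ^ (n - 2) * mn * d * (1 / (8 * pi))"
    using \<Delta> by (simp add: field_simps power2_eq_square)
  also have "\<dots> \<le> (real n)\<^sup>2 * mx ^ (n - 2) * mn * d * (1 / 2)"
    using mx ab pos pi_gt3 by (intro mult_left_mono) (auto simp: field_simps)
  also have "\<dots> \<le> ?rhs"
  proof (cases "b \<le> a")
    case True
    then have "scaled_sq i t y \<le> scaled_sq i t x" unfolding scaled_sq_def
      using ab by (intro mult_right_mono power_mono) (auto simp: a_def b_def)
    then have "mx = excess i t x" "mn = norm (\<xi> i t y)" using True by (auto simp: mx_def excess_def mn_def b_def)
    moreover have "0 \<le> (real n)\<^sup>2 * d / 2 * excess i t y ^ (n - 2) * norm (\<xi> i t x)"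
      using excess_nonneg pos by (intro mult_nonneg_nonneg) auto
    ultimately show ?thesis by (simp add: algebra_simps)
  next
    case False
    then have "scaled_sq i t x \<le> scaled_sq i t y" unfolding scaled_sq_def
      using ab by (intro mult_right_mono power_mono) (auto simp: a_def b_def)
    then have "mx = excess i t y" "mn = norm (\<xi> i t x)" using False by (auto simp: mx_def excess_def mn_def a_def)
    moreover have "0 \<le> (real n)\<^sup>2 * d / 2 * excess i t x ^ (n - 2) * norm (\<xi> i t y)"
      using excess_nonneg pos by (intro mult_nonneg_nonneg) auto
    ultimately show ?thesis by (simp add: algebra_simps)
  qed
  finally show ?thesis .
qed

text \<open>Where the weight does not vanish, the expanding frame absorbs the external velocity. The
  self-interaction is bounded by symmetrisation with \<open>weight_kernel_bound\<close>.\<close>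

lemma tail_moment_derivative:
  assumes \<tau>: "confined \<tau>" and t: "t \<in> {0..\<tau>}" and i: "i \<in> I" and n: "n \<ge> 2"
  defines "f' \<equiv> \<lambda>t x. real n * excess i t x ^ (n - 1) *
     (scaled_sq_rate i t x)"
  shows "(tail_moment n i has_real_derivative (\<integral>x. f' t x \<partial>M i)) (at t within {0..\<tau>})"
    and "(\<integral>x. f' t x \<partial>M i) \<le> (real n)\<^sup>2 * d * (2 * A) * \<epsilon> * tail_moment (n - 2) i t"
proof -
  have T\<tau>: "\<tau> \<in> {0..T}" using \<tau> by (auto simp: confined_def)
  have d: "AE x in M i. \<forall>t\<in>{0..\<tau>}. ((\<lambda>t. excess i t x ^ n) has_real_derivative f' t x) (at t within {0..\<tau>})"
    using \<xi>_derivative[OF i T\<tau>]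
  proof eventually_elim
    case (elim x)
    show ?case
    proof
      fix t assume "t \<in> {0..\<tau>}"
      then have "((\<lambda>t. scaled_sq i t x) has_real_derivative
         scaled_sq_rate i t x) (at t within {0..\<tau>})"
        using elim by (intro scaled_sq_derivative) auto
      then have "((\<lambda>t. scaled_sq i t x - (d / 100)\<^sup>2) has_real_derivative
         scaled_sq_rate i t x) (at t within {0..\<tau>})"
        by (auto intro!: derivative_eq_intros)
      from DERIV_chain2[OF has_real_derivative_pos_part_power[OF n] this]
      show "((\<lambda>t. excess i t x ^ n) has_real_derivative f' t x) (at t within {0..\<tau>})"
        by (simp only: excess_def f'_def)
    qed
  qed
  have "AE x in M i. \<forall>t\<in>{0..\<tau>}. norm (\<xi> i t x) \<le> d / 8"
    using \<tau> i by (auto simp: confined_def)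
  then have b: "AE x in M i. \<forall>t\<in>{0..\<tau>}. \<bar>f' t x\<bar> \<le>
      (real n * (d\<^sup>2) ^ (n - 1)) * (2 * 1 * (d / 8 * (speed_bound + A / d) + expansion_rate * (d / 8)\<^sup>2))"
  proof eventually_elim
    case (elim x)
    show ?case
    proof
      fix t assume t: "t \<in> {0..\<tau>}"
      note t' = confinedD[OF \<tau> t]
      have \<xi>: "norm (\<xi> i t x) \<le> d / 8" using elim t by auto
      have "\<bar>\<xi> i t x \<bullet> (u t (Z t x) - V i t)\<bar> \<le> norm (\<xi> i t x) * norm (u t (Z t x) - V i t)"
        by (rule Cauchy_Schwarz_ineq2)
      also have "\<dots> \<le> d / 8 * (speed_bound + A / d)"
        using \<xi> pos norm_u_le[OF t', of "Z t x"] norm_V_le[OF t' i]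
          norm_triangle_ineq4[of "u t (Z t x)" "V i t"] by (intro mult_mono) auto
      finally have 1: "\<bar>\<xi> i t x \<bullet> (u t (Z t x) - V i t)\<bar> \<le> d / 8 * (speed_bound + A / d)" .
      have "(norm (\<xi> i t x))\<^sup>2 \<le> (d / 8)\<^sup>2" using \<xi> by (intro power_mono) auto
      then have 2: "\<bar>expansion_rate * (norm (\<xi> i t x))\<^sup>2\<bar> \<le> expansion_rate * (d / 8)\<^sup>2" using expansion_rate_nonneg by (simp add: abs_mult mult_left_mono)
      have 3: "\<bar>real n * excess i t x ^ (n - 1)\<bar> \<le> real n * (d\<^sup>2) ^ (n - 1)"
        using excess_nonneg excess_le[OF t' \<xi>] by (auto simp: abs_mult power_abs intro!: mult_left_mono power_mono)
      show "\<bar>f' t x\<bar> \<le> (real n * (d\<^sup>2) ^ (n - 1)) * (2 * 1 * (d / 8 * (speed_bound + A / d) + expansion_rate * (d / 8)\<^sup>2))"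
        unfolding f'_def abs_mult[of "real n * excess i t x ^ (n - 1)"] 
      proof (intro mult_mono 3)
        have "\<bar>2 * exp (- 2 * expansion_rate * t)\<bar> \<le> 2 * 1" using exp_le_1[OF t'] by simp
        moreover have "\<bar>\<xi> i t x \<bullet> (u t (Z t x) - V i t) - expansion_rate * (norm (\<xi> i t x))\<^sup>2\<bar> \<le> d / 8 * (speed_bound + A / d) + expansion_rate * (d / 8)\<^sup>2"
          using 1 2 by linarith
        ultimately show "\<bar>scaled_sq_rate i t x\<bar>
           \<le> 2 * 1 * (d / 8 * (speed_bound + A / d) + expansion_rate * (d / 8)\<^sup>2)"
          unfolding abs_mult[of "2 * exp (- 2 * expansion_rate * t)"] by (intro mult_mono) auto
      qed auto
    qed
  qed
  have m: "f' t \<in> borel_measurable (M i)" if "t \<in> {0..\<tau>}" for t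
  proof -
    note t' = confinedD[OF \<tau> that]
    note [measurable] = Z_measurable[OF t' i] \<xi>_measurable[OF t' i] u_measurable[OF t'] excess_measurable[OF t' i]
    show ?thesis unfolding f'_def by measurable
  qed
  note der = has_real_derivative_integral[OF fin[OF i] tail_moment_integrable[OF \<tau> _ i] m d b t]
  show "(tail_moment n i has_real_derivative (\<integral>x. f' t x \<partial>M i)) (at t within {0..\<tau>})"
    unfolding tail_moment_def using der(1) by simp
  note t' = confinedD[OF \<tau> t]
  note [measurable] = excess_measurable[OF t' i]
  define w where "w x = real n * excess i t x ^ (n - 1) * exp (- 2 * expansion_rate * t)" for x
  have wm: "w \<in> borel_measurable (M i)" unfolding w_def by measurable
  have wb: "\<bar>w x\<bar> \<le> real n * (d\<^sup>2) ^ (n - 1) * 1" if "norm (\<xi> i t x) \<le> d / 8" for x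
    unfolding w_def abs_mult using excess_nonneg excess_le[OF t' that] exp_le_1[OF t']
    by (intro mult_mono) (auto simp: power_abs intro!: power_mono)
  have "(\<integral>x. f' t x \<partial>M i) \<le> (\<integral>x. 2 * s i * (w x * (\<xi> i t x \<bullet> v i t (Z t x))) \<partial>M i)"
  proof (rule integral_mono_AE[OF der(2)])
    show "integrable (M i) (\<lambda>x. 2 * s i * (w x * (\<xi> i t x \<bullet> v i t (Z t x))))"
      using radial_integrable[OF \<tau> t i wm wb] by auto
    show "AE x in M i. f' t x \<le> 2 * s i * (w x * (\<xi> i t x \<bullet> v i t (Z t x)))"
      using \<xi>_bound[OF \<tau> t i]
    proof eventually_elim
      case (elim x)
      have eq: "f' t x = 2 * w x * (\<xi> i t x \<bullet> (u t (Z t x) - V i t) - expansion_rate * (norm (\<xi> i t x))\<^sup>2)"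
        by (simp add: f'_def w_def)
      show ?case
      proof (cases "excess i t x = 0")
        case True
        then have "w x = 0" using n by (simp add: w_def)
        then show ?thesis by (simp add: eq)
      next
        case False
        then have "(d / 100)\<^sup>2 \<le> scaled_sq i t x" by (auto simp: excess_def max_def split: if_splits)
        then have "d / 100 \<le> norm (\<xi> i t x)" by (intro scaled_sq_ge_imp[OF t']) (use pos in auto)
        from drift_compensated[OF \<tau> t i elim this]
        have "f' t x \<le> 2 * w x * (s i * (\<xi> i t x \<bullet> v i t (Z t x)))"
          unfolding eq using excess_nonneg by (intro mult_left_mono) (auto simp: w_def)
        then show ?thesis by (simp add: algebra_simps)
      qed
    qed
  qed
  also have "\<dots> = 2 * (s i * (\<integral>x. w x * (\<xi> i t x \<bullet> v i t (Z t x)) \<partial>M i))" by simp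
  also have "\<dots> \<le> 2 * \<bar>\<integral>x. w x * (\<xi> i t x \<bullet> v i t (Z t x)) \<partial>M i\<bar>"
    using sgn[OF i] abs_ge_self[of "s i * (\<integral>x. w x * (\<xi> i t x \<bullet> v i t (Z t x)) \<partial>M i)"]
    by (simp add: abs_mult)
  also have "\<dots> \<le> 2 * ((\<integral>x. (real n)\<^sup>2 * d / 2 * excess i t x ^ (n - 2) \<partial>M i) * (\<integral>x. norm (\<xi> i t x) \<partial>M i))"
  proof (rule mult_left_mono)
    show "\<bar>\<integral>x. w x * (\<xi> i t x \<bullet> v i t (Z t x)) \<partial>M i\<bar>
        \<le> (\<integral>x. (real n)\<^sup>2 * d / 2 * excess i t x ^ (n - 2) \<partial>M i) * (\<integral>x. norm (\<xi> i t x) \<partial>M i)"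
      by (rule self_interaction_bound[OF \<tau> t i wm wb])
        (use tail_moment_integrable[OF \<tau> t i] weight_kernel_bound[OF t' n] in \<open>auto simp: w_def\<close>)
  qed simp
  also have "\<dots> = (real n)\<^sup>2 * d * tail_moment (n - 2) i t * (\<integral>x. norm (\<xi> i t x) \<partial>M i)"
    by (simp add: tail_moment_def)
  also have "\<dots> \<le> (real n)\<^sup>2 * d * tail_moment (n - 2) i t * (2 * A * \<epsilon>)"
    using first_moment_ge[OF \<tau> t i] first_moment_le_linear[OF \<tau> t] tail_moment_nonneg pos by (intro mult_left_mono) auto
  finally show "(\<integral>x. f' t x \<partial>M i) \<le> (real n)\<^sup>2 * d * (2 * A) * \<epsilon> * tail_moment (n - 2) i t"
    by (simp add: algebra_simps)
qed

lemma tail_const_nonneg: "0 \<le> tail_const A d k"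
  using pos by (induction k) auto

text \<open>Order \<open>0\<close> is the total mass. The moments of positive order vanish at time \<open>0\<close>, and integrating
  the differential inequality over a time at most \<open>1\<close> gains a factor \<open>\<epsilon>\<close> per step.\<close>

lemma tail_moment_le:
  assumes \<tau>: "confined \<tau>" and i: "i \<in> I"
  shows "\<forall>t\<in>{0..\<tau>}. tail_moment (2 * k) i t \<le> tail_const A d k * \<epsilon> ^ k"
proof (induction k)
  case 0
  then show ?case using m_le[OF i] by (auto simp: tail_moment_def)
next
  case (Suc k)
  define n where "n = 2 * k + 2"
  define c where "c = (real n)\<^sup>2 * d * (2 * A) * \<epsilon> * (tail_const A d k * \<epsilon> ^ k)"
  have n: "n \<ge> 2" "n - 2 = 2 * k" by (auto simp: n_def)
  have \<tau>': "0 \<le> \<tau>" "\<tau> \<le> T" using \<tau> by (auto simp: confined_def)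
  have c0: "0 \<le> c" unfolding c_def using pos tail_const_nonneg by (intro mult_nonneg_nonneg) auto
  have "tail_moment n i 0 = (\<integral>x. 0 \<partial>M i)"
    unfolding tail_moment_def
  proof (rule integral_cong_AE)
    show "(\<lambda>x. excess i 0 x ^ n) \<in> borel_measurable (M i)"
      by (intro borel_measurable_power excess_measurable) (use pos i in auto)
    show "AE x in M i. excess i 0 x ^ n = 0"
      using initial_support[OF i]
    proof eventually_elim
      case (elim x)
      then have "(norm (\<xi> i 0 x))\<^sup>2 \<le> (d / 100)\<^sup>2" by (intro power_mono) (auto simp: \<xi>_def)
      then show ?case using n by (simp add: excess_def scaled_sq_def)
    qed
  qed simp
  then have E0: "tail_moment n i 0 = 0" by simp
  show ?case
  proof
    fix t assume t: "t \<in> {0..\<tau>}"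
    have "tail_moment n i t \<le> tail_moment n i 0 + c * (t - 0)"
    proof (rule linear_growth[OF tail_moment_derivative(1)[OF \<tau> _ i n(1)]])
      fix r assume r: "0 \<le> r" "r \<le> \<tau>"
      note tail_moment_derivative(2)[OF \<tau> _ i n(1), of r]
      also have "(real n)\<^sup>2 * d * (2 * A) * \<epsilon> * tail_moment (n - 2) i r \<le> c"
        unfolding c_def n(2) using Suc r pos by (intro mult_left_mono) auto
      finally show "(\<integral>x. real n * excess i r x ^ (n - 1) *
         (scaled_sq_rate i r x) \<partial>M i) \<le> c"
        using r by simp
    qed (use t in auto)
    also have "\<dots> \<le> c" using E0 c0 t \<tau>' small(2) by (simp add: mult_left_le)
    also have "c = tail_const A d (Suc k) * \<epsilon> ^ Suc k" by (simp add: c_def n_def)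
    finally show "tail_moment (2 * Suc k) i t \<le> tail_const A d (Suc k) * \<epsilon> ^ Suc k" by (simp add: n_def)
  qed
qed

section \<open>Confinement\<close>

text \<open>The three terms are the contribution of the bulk of the blob, and, for the mass far from the
  vortex, the two terms of \<open>le_powr_interpolate\<close>; the far mass itself is estimated by
  Chebyshev's inequality from the tail moment of order \<open>2 * k\<close>.\<close>

definition radial_bound :: "nat \<Rightarrow> real \<Rightarrow> real" where
  "radial_bound k h = 2 * A * \<epsilon> / (d / 100) + d * B * h powr \<theta>
     + d / h * (tail_const A d k * \<epsilon> ^ k / (8 * (d / 100)\<^sup>2) ^ (2 * k))"

lemma radial_bound_nonneg: "h > 0 \<Longrightarrow> 0 \<le> radial_bound k h"
  unfolding radial_bound_def using pos tail_const_nonneg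
  by (intro add_nonneg_nonneg mult_nonneg_nonneg divide_nonneg_nonneg) auto

text \<open>A particle \<open>y\<close> at less than half the distance of \<open>x\<close> from the vortex acts almost tangentially,
  with radial part of order \<open>\<bar>\<xi> y\<bar>\<close>. Any other particle lies where the excess is at least
  \<open>8 (d / 100)\<^sup>2\<close>.\<close>

lemma radial_kernel_bound:
  assumes t: "t \<in> {0..T}" and x: "norm (\<xi> i t x) \<le> d / 8" "36 * (d / 100)\<^sup>2 \<le> scaled_sq i t x"
    and h: "h > 0"
  shows "\<bar>\<xi> i t x \<bullet> biot_savart (Z t x - Z t y)\<bar>
    \<le> norm (\<xi> i t y) / (d / 100) + d * h powr \<theta> * norm (biot_savart (Z t x - Z t y)) powr (1 + \<theta>)
      + d / h * (excess i t y ^ (2 * k) / (8 * (d / 100)\<^sup>2) ^ (2 * k))"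
proof -
  have eq: "Z t x - Z t y = \<xi> i t x - \<xi> i t y" by (simp add: \<xi>_def)
  have six: "6 * (d / 100) \<le> norm (\<xi> i t x)"
    by (rule scaled_sq_ge_imp[OF t]) (use x pos in \<open>auto simp: power2_eq_square\<close>)
  have nn: "0 \<le> norm (\<xi> i t y) / (d / 100)"
      "0 \<le> d * h powr \<theta> * norm (biot_savart (Z t x - Z t y)) powr (1 + \<theta>)"
      "0 \<le> d / h * (excess i t y ^ (2 * k) / (8 * (d / 100)\<^sup>2) ^ (2 * k))"
    using pos h excess_nonneg by auto
  show ?thesis
  proof (cases "norm (\<xi> i t y) \<le> norm (\<xi> i t x) / 2")
    case True
    have "norm (\<xi> i t x) - norm (\<xi> i t y) \<le> norm (\<xi> i t x - \<xi> i t y)" by (rule norm_triangle_ineq2)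
    then have far: "d / 100 \<le> norm (\<xi> i t x - \<xi> i t y)" using True six pos by linarith
    have "1 * (d / 100) \<le> (2 * pi) * norm (\<xi> i t x - \<xi> i t y)"
      using far pi_gt3 pos by (intro mult_mono) auto
    moreover have "\<bar>\<xi> i t x \<bullet> biot_savart (\<xi> i t x - \<xi> i t y)\<bar>
        \<le> norm (\<xi> i t y) / (2 * pi * norm (\<xi> i t x - \<xi> i t y))"
      by (rule order_trans[OF abs_inner_biot_savart_le]) (intro divide_right_mono, auto)
    moreover have "norm (\<xi> i t y) / (2 * pi * norm (\<xi> i t x - \<xi> i t y)) \<le> norm (\<xi> i t y) / (d / 100)"
    proof (rule divide_left_mono)
      have "0 < norm (\<xi> i t x - \<xi> i t y)" using far pos by linarith
      then show "0 < 2 * pi * norm (\<xi> i t x - \<xi> i t y) * (d / 100)"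
        using pos by (intro mult_pos_pos) auto
    qed (use calculation(1) in auto)
    ultimately show ?thesis using nn unfolding eq by linarith
  next
    case False
    have "scaled_sq i t x / 4 \<le> scaled_sq i t y"
    proof -
      have "(norm (\<xi> i t x) / 2)\<^sup>2 \<le> (norm (\<xi> i t y))\<^sup>2" using False by (intro power_mono) auto
      then have "(norm (\<xi> i t x) / 2)\<^sup>2 * exp (- 2 * expansion_rate * t) \<le> (norm (\<xi> i t y))\<^sup>2 * exp (- 2 * expansion_rate * t)"
        by (intro mult_right_mono) auto
      then show ?thesis unfolding scaled_sq_def by (simp add: power_divide)
    qed
    then have "8 * (d / 100)\<^sup>2 \<le> excess i t y" using x(2) unfolding excess_def by linarith
    then have "(8 * (d / 100)\<^sup>2) ^ (2 * k) \<le> excess i t y ^ (2 * k)" by (intro power_mono) auto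
    then have 1: "1 \<le> excess i t y ^ (2 * k) / (8 * (d / 100)\<^sup>2) ^ (2 * k)" using pos by (simp add: divide_simps)
    define \<kappa> where "\<kappa> = norm (biot_savart (Z t x - Z t y))"
    have "\<bar>\<xi> i t x \<bullet> biot_savart (Z t x - Z t y)\<bar> \<le> norm (\<xi> i t x) * \<kappa>"
      unfolding \<kappa>_def by (rule Cauchy_Schwarz_ineq2)
    also have "\<dots> \<le> d * (\<kappa> powr (1 + \<theta>) * h powr \<theta> + 1 / h)"
      using le_powr_interpolate[of \<kappa> h \<theta>] x(1) h pos by (intro mult_mono) (auto simp: \<kappa>_def)
    also have "\<dots> = d * h powr \<theta> * \<kappa> powr (1 + \<theta>) + d / h * 1" by (simp add: algebra_simps)
    also have "\<dots> \<le> d * h powr \<theta> * \<kappa> powr (1 + \<theta>)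
        + d / h * (excess i t y ^ (2 * k) / (8 * (d / 100)\<^sup>2) ^ (2 * k))"
      using 1 pos h by (intro add_left_mono mult_left_mono) auto
    finally show ?thesis using nn unfolding \<kappa>_def by linarith
  qed
qed

lemma radial_velocity_le:
  assumes \<tau>: "confined \<tau>" and t: "t \<in> {0..\<tau>}" and i: "i \<in> I"
    and x: "norm (\<xi> i t x) \<le> d / 8" "36 * (d / 100)\<^sup>2 \<le> scaled_sq i t x"
    and h: "h > 0"
  shows "\<bar>\<xi> i t x \<bullet> v i t (Z t x)\<bar> \<le> radial_bound k h"
proof -
  note t' = confinedD[OF \<tau> t]
  note Ki = kernel_integrable(1)[OF t' i, of "Z t x"]
  note kp = kernel[OF t' i, of "Z t x"]
  note Pi = tail_moment_integrable[OF \<tau> t i, of "2 * k"]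
  note \<xi>i = \<xi>_integrable(1)[OF \<tau> t i]
  have "\<xi> i t x \<bullet> v i t (Z t x) = (\<integral>y. \<xi> i t x \<bullet> biot_savart (Z t x - Z t y) \<partial>M i)"
    unfolding v_def by (rule integral_inner_right[symmetric]) (use Ki in auto)
  also have "\<bar>\<dots>\<bar> \<le> (\<integral>y. \<bar>\<xi> i t x \<bullet> biot_savart (Z t x - Z t y)\<bar> \<partial>M i)"
    by (rule integral_abs_bound)
  also have "\<dots> \<le> (\<integral>y. norm (\<xi> i t y) / (d / 100)
      + d * h powr \<theta> * norm (biot_savart (Z t x - Z t y)) powr (1 + \<theta>)
      + d / h * (excess i t y ^ (2 * k) / (8 * (d / 100)\<^sup>2) ^ (2 * k)) \<partial>M i)"
    by (rule integral_mono) (use Ki kp Pi \<xi>i radial_kernel_bound[OF t' x h] in auto)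
  also have "\<dots> = (\<integral>y. norm (\<xi> i t y) \<partial>M i) / (d / 100)
      + d * h powr \<theta> * (\<integral>y. norm (biot_savart (Z t x - Z t y)) powr (1 + \<theta>) \<partial>M i)
      + d / h * (tail_moment (2 * k) i t / (8 * (d / 100)\<^sup>2) ^ (2 * k))"
    unfolding tail_moment_def using kp Pi \<xi>i by simp
  also have "\<dots> \<le> radial_bound k h"
    unfolding radial_bound_def
  proof (intro add_mono)
    show "(\<integral>y. norm (\<xi> i t y) \<partial>M i) / (d / 100) \<le> 2 * A * \<epsilon> / (d / 100)"
      using first_moment_ge[OF \<tau> t i] first_moment_le_linear[OF \<tau> t] pos by (intro divide_right_mono) auto
    have "d * h powr \<theta> * (\<integral>y. norm (biot_savart (Z t x - Z t y)) powr (1 + \<theta>) \<partial>M i) \<le> d * h powr \<theta> * B"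
      using kp pos by (intro mult_left_mono) auto
    then show "d * h powr \<theta> * (\<integral>y. norm (biot_savart (Z t x - Z t y)) powr (1 + \<theta>) \<partial>M i) \<le> d * B * h powr \<theta>"
      by (simp add: mult_ac)
    show "d / h * (tail_moment (2 * k) i t / (8 * (d / 100)\<^sup>2) ^ (2 * k))
        \<le> d / h * (tail_const A d k * \<epsilon> ^ k / (8 * (d / 100)\<^sup>2) ^ (2 * k))"
      using tail_moment_le[OF \<tau> i, of k] t pos h by (intro mult_left_mono divide_right_mono) auto
  qed
  finally show ?thesis .
qed

text \<open>While the rescaled squared distance of a particle exceeds \<open>36 (d / 100)\<^sup>2\<close>, it grows at rate
  \<open>2 radial_bound\<close> at most. Starting below \<open>36 (d / 100)\<^sup>2\<close> it stays below \<open>49 (d / 100)\<^sup>2\<close> up to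
  time \<open>1\<close>, and undoing the rescaling costs a factor \<open>(10 / 9)\<^sup>2\<close>.\<close>

lemma confinement_improved:
  assumes \<tau>: "confined \<tau>" and i: "i \<in> I" and h: "h > 0"
    and small_bound: "2 * radial_bound k h \<le> 13 * (d / 100)\<^sup>2"
  shows "AE x in M i. \<forall>t\<in>{0..\<tau>}. norm (\<xi> i t x) \<le> 8 * (d / 100)"
proof -
  have T\<tau>: "\<tau> \<in> {0..T}" using \<tau> by (auto simp: confined_def)
  have "AE x in M i. \<forall>t\<in>{0..\<tau>}. norm (\<xi> i t x) \<le> d / 8"
    using \<tau> i by (auto simp: confined_def)
  with \<xi>_derivative[OF i T\<tau>] initial_support[OF i] show ?thesis
  proof eventually_elim
    case (elim x)
    show ?case
    proof
      fix t assume t: "t \<in> {0..\<tau>}"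
      note t' = confinedD[OF \<tau> t]
      have "scaled_sq i t x \<le> 36 * (d / 100)\<^sup>2 + 2 * radial_bound k h * t"
      proof (rule linear_growth_above[where b = \<tau>])
        fix r assume r: "0 \<le> r" "r \<le> \<tau>"
        then have r': "r \<in> {0..\<tau>}" by simp
        note rT = confinedD[OF \<tau> r']
        show "((\<lambda>t. scaled_sq i t x) has_real_derivative scaled_sq_rate i r x) (at r within {0..\<tau>})"
          using elim(1) r' by (intro scaled_sq_derivative) auto
        assume qr: "36 * (d / 100)\<^sup>2 \<le> scaled_sq i r x"
        have \<xi>r: "norm (\<xi> i r x) \<le> d / 8" using elim r' by auto
        have "(6 * (d / 100))\<^sup>2 \<le> scaled_sq i r x" using qr by (simp add: power2_eq_square)
        then have "6 * (d / 100) \<le> norm (\<xi> i r x)" by (rule scaled_sq_ge_imp[OF rT, rotated]) (use pos in auto)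
        then have "d / 100 \<le> norm (\<xi> i r x)" using pos by linarith
        note drift_compensated[OF \<tau> r' i \<xi>r this]
        also have "s i * (\<xi> i r x \<bullet> v i r (Z r x)) \<le> \<bar>s i * (\<xi> i r x \<bullet> v i r (Z r x))\<bar>" by (rule abs_ge_self)
        also have "\<dots> \<le> radial_bound k h"
          using radial_velocity_le[OF \<tau> r' i \<xi>r qr h] sgn[OF i] by (simp add: abs_mult)
        finally have le: "\<xi> i r x \<bullet> (u r (Z r x) - V i r) - expansion_rate * (norm (\<xi> i r x))\<^sup>2 \<le> radial_bound k h" .
        have "scaled_sq_rate i r x
            \<le> 2 * exp (- 2 * expansion_rate * r) * radial_bound k h" using le by (intro mult_left_mono) auto
        also have "\<dots> \<le> 2 * 1 * radial_bound k h"
          using exp_le_1[OF rT] radial_bound_nonneg[OF h] by (intro mult_right_mono) auto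
        finally show "scaled_sq_rate i r x
            \<le> 2 * radial_bound k h" by simp
      next
        have "(norm (\<xi> i 0 x))\<^sup>2 \<le> (d / 100)\<^sup>2" using elim(2) by (intro power_mono) (auto simp: \<xi>_def)
        also have "\<dots> \<le> 36 * (d / 100)\<^sup>2" by simp
        finally show "scaled_sq i 0 x \<le> 36 * (d / 100)\<^sup>2" by (simp add: scaled_sq_def)
      qed (use t radial_bound_nonneg[OF h] in auto)
      also have "\<dots> \<le> 36 * (d / 100)\<^sup>2 + 2 * radial_bound k h * 1"
        using t' small(2) radial_bound_nonneg[OF h] by (intro add_left_mono mult_left_mono) auto
      also have "\<dots> \<le> 49 * (d / 100)\<^sup>2" using small_bound by simp
      finally have scaled_sq: "scaled_sq i t x \<le> 49 * (d / 100)\<^sup>2" .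
      have "(norm (\<xi> i t x))\<^sup>2 = scaled_sq i t x * (exp (expansion_rate * t))\<^sup>2"
        by (simp add: scaled_sq_def exp_double[symmetric] exp_add[symmetric])
      also have "\<dots> \<le> 49 * (d / 100)\<^sup>2 * (10 / 9)\<^sup>2"
        using scaled_sq exp_small[OF expansion_rate_t_le[OF t']] by (intro mult_mono power_mono) (auto simp: scaled_sq_def)
      also have "\<dots> \<le> (8 * (d / 100))\<^sup>2" by (simp add: power2_eq_square)
      finally show "norm (\<xi> i t x) \<le> 8 * (d / 100)" by (rule power2_le_imp_le) (use pos in auto)
    qed
  qed
qed

text \<open>The gap between \<open>8 d / 100\<close> and \<open>d / 8\<close> is crossed in a time bounded below, because all
  speeds are bounded (by a constant that may depend on \<open>\<epsilon>\<close>). So continuous induction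
  proceeds in steps of fixed length.\<close>

theorem confined_always:
  assumes h: "h > 0" and small_bound: "2 * radial_bound k h \<le> 13 * (d / 100)\<^sup>2"
  shows "confined T"
proof -
  define W where "W = speed_bound + A / d + 1"
  have "speed_bound \<ge> 0" unfolding speed_bound_def using pos by (intro add_nonneg_nonneg mult_nonneg_nonneg) auto
  then have W: "W > 0" using pos by (simp add: W_def add_nonneg_pos)
  define \<tau>0 where "\<tau>0 = (d / 8 - 8 * (d / 100)) / W"
  have \<tau>0: "\<tau>0 > 0" using W pos by (auto simp: \<tau>0_def)
  show ?thesis
  proof (rule induct_by_fixed_steps[where P = confined and \<tau> = \<tau>0 and T = T and t = T])
    show "confined 0" unfolding confined_def
    proof (intro conjI ballI)
      fix i assume "i \<in> I"
      from initial_support[OF this] show "AE x in M i. \<forall>t\<in>{0..0}. norm (\<xi> i t x) \<le> d / 8"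
        by eventually_elim (use pos in \<open>auto simp: \<xi>_def\<close>)
    qed (use pos in auto)
  next
    fix t r assume t: "0 \<le> t" "t \<le> T" and prev: "\<And>s. 0 \<le> s \<Longrightarrow> s \<le> t \<Longrightarrow> confined s"
      and r: "t \<le> r" "r \<le> t + \<tau>0" "r \<le> T"
    have ct: "confined t" using prev[of t] t by auto
    have rT: "r \<in> {0..T}" using r t by auto
    show "confined r" unfolding confined_def
    proof (intro conjI ballI)
      show "r \<in> {0..T}" by (rule rT)
      fix i assume i: "i \<in> I"
      from confinement_improved[OF ct i h small_bound] \<xi>_derivative[OF i rT]
      show "AE x in M i. \<forall>t\<in>{0..r}. norm (\<xi> i t x) \<le> d / 8"
      proof eventually_elim
        case (elim x)
        show ?case
        proof
          fix t' assume t': "t' \<in> {0..r}"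
          show "norm (\<xi> i t' x) \<le> d / 8"
          proof (cases "t' \<le> t")
            case True
            then have "norm (\<xi> i t' x) \<le> 8 * (d / 100)" using elim(1) t' by auto
            then show ?thesis using pos by simp
          next
            case False
            have "norm (\<xi> i t' x - \<xi> i t x) \<le> W * norm (t' - t)"
            proof (rule differentiable_bound[of "{0..r}" "\<lambda>t. \<xi> i t x" "\<lambda>t h. h *\<^sub>R (u t (Z t x) - V i t)"])
              fix y assume y: "y \<in> {0..r}"
              then have yT: "y \<in> {0..T}" using rT by auto
              show "((\<lambda>t. \<xi> i t x) has_derivative (\<lambda>h. h *\<^sub>R (u y (Z y x) - V i y))) (at y within {0..r})"
                using elim(2) y by (auto simp: has_vector_derivative_def)
              show "onorm (\<lambda>h. h *\<^sub>R (u y (Z y x) - V i y)) \<le> W"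
              proof (rule onorm_le)
                fix h :: real
                have "norm (u y (Z y x) - V i y) \<le> W"
                  using norm_u_le[OF yT, of "Z y x"] norm_V_le[OF yT i]
                    norm_triangle_ineq4[of "u y (Z y x)" "V i y"] by (simp add: W_def)
                then show "norm (h *\<^sub>R (u y (Z y x) - V i y)) \<le> W * norm h"
                  using mult_left_mono[of "norm (u y (Z y x) - V i y)" W "\<bar>h\<bar>"]
                  by (simp add: mult.commute)
              qed
            qed (use t' r t in auto)
            also have "\<dots> \<le> W * \<tau>0" using False t' r W by (intro mult_left_mono) auto
            also have "\<dots> = d / 8 - 8 * (d / 100)" using W by (simp add: \<tau>0_def)
            finally have "norm (\<xi> i t' x - \<xi> i t x) \<le> d / 8 - 8 * (d / 100)" .
            moreover have "norm (\<xi> i t x) \<le> 8 * (d / 100)" using elim(1) t by auto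
            moreover have "norm (\<xi> i t' x) \<le> norm (\<xi> i t' x - \<xi> i t x) + norm (\<xi> i t x)"
              using norm_triangle_ineq[of "\<xi> i t' x - \<xi> i t x" "\<xi> i t x"] by simp
            ultimately show ?thesis by linarith
          qed
        qed
      qed
    qed
  qed (use pos \<tau>0 in auto)
qed

end

section \<open>Supports, test functions and signed measures\<close>

text \<open>By Lindelof's theorem countably many of the open null sets already cover the complement of the
  support.\<close>

lemma AE_zero_outside_spt: "AE x in lborel. x \<notin> spt f \<longrightarrow> f x = 0"
proof -
  define \<F> where "\<F> = {U. open U \<and> (AE x in lborel. x \<in> U \<longrightarrow> f x = 0)}"
  obtain \<F>' where \<F>': "\<F>' \<subseteq> \<F>" "countable \<F>'" "\<Union>\<F>' = \<Union>\<F>"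
    using Lindelof[of \<F>] by (auto simp: \<F>_def)
  have "AE x in lborel. \<forall>U\<in>\<F>'. x \<in> U \<longrightarrow> f x = 0"
    unfolding AE_ball_countable[OF \<F>'(2)] using \<F>'(1) by (auto simp: \<F>_def)
  then show ?thesis
  proof eventually_elim
    case (elim x)
    show ?case
    proof
      assume "x \<notin> spt f"
      then have "x \<in> \<Union>\<F>" unfolding spt_def \<F>_def by blast
      then show "f x = 0" using elim \<F>'(3) by blast
    qed
  qed
qed

lemma one_signed_mass:
  assumes "one_signed f" "f \<in> borel_measurable lborel" "(\<integral>x. f x \<partial>lborel) = a" "a \<noteq> 0"
  shows "integrable lborel f" "(\<integral>x. \<bar>f x\<bar> \<partial>lborel) = \<bar>a\<bar>" "AE x in lborel. f x = sgn a * \<bar>f x\<bar>"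
proof -
  show i: "integrable lborel f" using assms(3,4) not_integrable_integral_eq by blast
  have "(AE x in lborel. f x \<ge> 0) \<or> (AE x in lborel. f x \<le> 0)" using assms(1) by (simp add: one_signed_def)
  then show "(\<integral>x. \<bar>f x\<bar> \<partial>lborel) = \<bar>a\<bar>" and "AE x in lborel. f x = sgn a * \<bar>f x\<bar>"
  proof (atomize (full), elim disjE)
    assume AE: "AE x in lborel. f x \<ge> 0"
    then have "0 \<le> a" using integral_nonneg_AE[OF AE] assms(3) by simp
    then have a: "a > 0" using assms(4) by simp
    have "(\<integral>x. \<bar>f x\<bar> \<partial>lborel) = (\<integral>x. f x \<partial>lborel)"
      by (rule integral_cong_AE) (use AE assms(2) in \<open>auto elim!: eventually_mono\<close>)
    moreover have "AE x in lborel. f x = sgn a * \<bar>f x\<bar>" using AE by eventually_elim (use a in auto)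
    ultimately show "(\<integral>x. \<bar>f x\<bar> \<partial>lborel) = \<bar>a\<bar> \<and> (AE x in lborel. f x = sgn a * \<bar>f x\<bar>)"
      using a assms(3) by simp
  next
    assume AE: "AE x in lborel. f x \<le> 0"
    have AE': "AE x in lborel. 0 \<le> - f x" using AE by eventually_elim auto
    then have "a \<le> 0" using integral_nonneg_AE[OF AE'] assms(3) by simp
    then have a: "a < 0" using assms(4) by simp
    have "(\<integral>x. \<bar>f x\<bar> \<partial>lborel) = (\<integral>x. - f x \<partial>lborel)"
      by (rule integral_cong_AE) (use AE assms(2) in \<open>auto elim!: eventually_mono\<close>)
    moreover have "AE x in lborel. f x = sgn a * \<bar>f x\<bar>" using AE by eventually_elim (use a in auto)
    ultimately show "(\<integral>x. \<bar>f x\<bar> \<partial>lborel) = \<bar>a\<bar> \<and> (AE x in lborel. f x = sgn a * \<bar>f x\<bar>)"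
      using a assms(3) by simp
  qed
qed

lemma lborel_AE_translate:
  fixes c :: "'a::euclidean_space"
  assumes "AE x in lborel. Q x" shows "AE x in lborel. Q (c + x)"
proof (rule AE_distrD[where M' = borel and f = "(+) c"])
  show "AE x in distr lborel borel ((+) c). Q x" by (subst lborel_distr_plus) (rule assms)
qed simp

lemma lborel_distr_reflect:
  fixes z :: "'a::euclidean_space"
  shows "distr lborel borel (\<lambda>y. z - y) = lborel"
  using lborel_affine[of "- 1" z] by (simp add: density_1)

text \<open>A Lipschitz function need not be differentiable at any point of a given segment. Averaging
  over small translates of the segment makes almost every point of it good.\<close>

lemma W1_test_imp_lipschitz:
  assumes "W1_test \<zeta>"
  shows "\<bar>\<zeta> y - \<zeta> z\<bar> \<le> norm (y - z)"
proof -
  obtain L where L: "L-lipschitz_on UNIV \<zeta>"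
    and AE: "AE x in lborel. \<exists>g. GDERIV \<zeta> x :> g \<and> norm g \<le> 1"
    using assms by (auto simp: W1_test_def)
  have L0: "L \<ge> 0" using L by (rule lipschitz_on_nonneg)
  have lip: "\<bar>\<zeta> x - \<zeta> y\<bar> \<le> L * norm (x - y)" for x y
    using lipschitz_onD[OF L, of x y] by (simp add: dist_norm)
  have cont: "continuous_on UNIV \<zeta>" using L by (rule lipschitz_on_continuous_on)
  have [measurable]: "\<zeta> \<in> borel_measurable borel" using cont by (rule borel_measurable_continuous_onI)
  define w where "w = y - z"
  have key: "\<bar>\<zeta> y - \<zeta> z\<bar> \<le> norm w + 2 * L * r" if r: "r > 0" for r
  proof -
    define M where "M = density lborel (indicator (ball z r))"
    have emM: "emeasure M (space M) = emeasure lborel (ball z r)"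
      unfolding M_def by (subst emeasure_density) (auto intro!: borel_measurable_indicator)
    have fin: "finite_measure M"
      by (rule finite_measureI) (use emeasure_lborel_ball_finite[of z r] in \<open>auto simp: emM\<close>)
    interpret finite_measure M by (rule fin)
    have sets [measurable_cong, simp]: "sets M = sets borel" by (simp add: M_def)
    have im: "(indicator (ball z r) :: plane \<Rightarrow> ennreal) \<in> borel_measurable lborel"
      by (auto intro!: borel_measurable_indicator)
    have AEM: "AE x in M. x \<in> ball z r"
      unfolding M_def AE_density[OF im] by (rule AE_I2) (auto simp: indicator_def split: if_splits)
    have AEM': "AE x in M. Q x" if "AE x in lborel. Q x" for Q
      using that unfolding M_def AE_density[OF im] by (auto elim!: eventually_mono)
    define \<mu> where "\<mu> = measure M (space M)"
    have \<mu>: "\<mu> > 0"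
      using r by (simp add: \<mu>_def measure_def emM emeasure_ball enn2real_positive_iff)
    define f where "f t x = \<zeta> (x + t *\<^sub>R w)" for t x
    have fm [measurable]: "f t \<in> borel_measurable M" for t unfolding f_def by measurable
    have fi: "integrable M (f t)" for t
    proof (rule integrable_const_bound[where B = "\<bar>\<zeta> z\<bar> + L * (r + \<bar>t\<bar> * norm w)"])
      show "AE x in M. norm (f t x) \<le> \<bar>\<zeta> z\<bar> + L * (r + \<bar>t\<bar> * norm w)"
        using AEM
      proof eventually_elim
        case (elim x)
        have "norm (x + t *\<^sub>R w - z) \<le> norm (x - z) + norm (t *\<^sub>R w)"
          using norm_triangle_ineq[of "x - z" "t *\<^sub>R w"] by (simp add: algebra_simps)
        also have "\<dots> \<le> r + \<bar>t\<bar> * norm w" using elim by (simp add: dist_norm norm_minus_commute)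
        finally have "L * norm (x + t *\<^sub>R w - z) \<le> L * (r + \<bar>t\<bar> * norm w)" using L0 by (rule mult_left_mono)
        then show ?case using lip[of "x + t *\<^sub>R w" z] unfolding f_def by simp
      qed
    qed simp
    define f' where "f' t x = lim (\<lambda>n. (f (t + 1 / Suc n) x - f t x) / (1 / Suc n))" for t x
    have f'm: "f' t \<in> borel_measurable M" for t unfolding f'_def by measurable
    have d: "AE x in M. ((\<lambda>t. f t x) has_real_derivative f' t x) (at t) \<and> \<bar>f' t x\<bar> \<le> norm w" for t
    proof -
      have "AE x in M. \<exists>g. GDERIV \<zeta> (t *\<^sub>R w + x) :> g \<and> norm g \<le> 1"
        by (rule AEM'[OF lborel_AE_translate[OF AE]])
      then show ?thesis
      proof eventually_elim
        case (elim x)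
        then obtain g where g: "GDERIV \<zeta> (x + t *\<^sub>R w) :> g" "norm g \<le> 1" by (auto simp: add.commute)
        have "((\<lambda>t. x + t *\<^sub>R w) has_derivative (\<lambda>h. h *\<^sub>R w)) (at t)"
          by (auto intro!: derivative_eq_intros)
        from has_derivative_compose[OF this, of \<zeta> "\<lambda>h. h \<bullet> g"]
        have "((\<lambda>t. f t x) has_derivative (\<lambda>h. (h *\<^sub>R w) \<bullet> g)) (at t)"
          using g(1) unfolding gderiv_def f_def by simp
        then have D: "((\<lambda>t. f t x) has_real_derivative (w \<bullet> g)) (at t)"
          unfolding has_field_derivative_def by (rule has_derivative_eq_rhs) (simp add: fun_eq_iff)
        then have lim: "((\<lambda>h. (f (t + h) x - f t x) / h) \<longlongrightarrow> w \<bullet> g) (at 0)" by (simp add: DERIV_def)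
        have "(\<lambda>n. (f (t + 1 / Suc n) x - f t x) / (1 / Suc n)) \<longlonglongrightarrow> w \<bullet> g"
        proof (rule filterlim_compose[OF lim])
          show "filterlim (\<lambda>n. 1 / real (Suc n)) (at 0) sequentially"
            unfolding filterlim_at using LIMSEQ_inverse_real_of_nat by (auto simp: inverse_eq_divide)
        qed
        then have "f' t x = w \<bullet> g" unfolding f'_def by (rule limI)
        moreover have "\<bar>w \<bullet> g\<bar> \<le> norm w * norm g" by (rule Cauchy_Schwarz_ineq2)
        moreover have "norm w * norm g \<le> norm w * 1" using g by (intro mult_left_mono) auto
        ultimately show ?case using D by simp
      qed
    qed
    have D: "((\<lambda>t. \<integral>x. f t x \<partial>M) has_real_derivative (\<integral>x. f' t x \<partial>M)) (at t)" for t
    proof (rule has_real_derivative_integral_lipschitz[OF fin fi f'm])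
      show "AE x in M. ((\<lambda>t. f t x) has_real_derivative f' t x) (at t)" using d by (auto elim!: eventually_mono)
      show "AE x in M. \<bar>f s x - f t x\<bar> \<le> (L * norm w) * \<bar>s - t\<bar>" for s
      proof (rule AE_I2)
        fix x
        have "(x + s *\<^sub>R w) - (x + t *\<^sub>R w) = (s - t) *\<^sub>R w" by (simp add: scaleR_diff_left)
        then show "\<bar>f s x - f t x\<bar> \<le> (L * norm w) * \<bar>s - t\<bar>"
          using lip[of "x + s *\<^sub>R w" "x + t *\<^sub>R w"] by (simp add: f_def mult_ac)
      qed
    qed simp
    have f'b: "\<bar>\<integral>x. f' t x \<partial>M\<bar> \<le> norm w * \<mu>" for t
    proof -
      have "\<bar>\<integral>x. f' t x \<partial>M\<bar> \<le> (\<integral>x. \<bar>f' t x\<bar> \<partial>M)" by (rule integral_abs_bound)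
      also have "\<dots> \<le> (\<integral>x. norm w \<partial>M)"
      proof (rule integral_mono_AE)
        show "integrable M (\<lambda>x. \<bar>f' t x\<bar>)"
          by (rule integrable_const_bound[where B = "norm w"])
            (use d[of t] f'm in \<open>auto elim!: eventually_mono\<close>)
        show "AE x in M. \<bar>f' t x\<bar> \<le> norm w" using d[of t] by (auto elim!: eventually_mono)
      qed simp
      finally show ?thesis by (simp add: \<mu>_def mult.commute)
    qed
    have "norm ((\<integral>x. f 1 x \<partial>M) - (\<integral>x. f 0 x \<partial>M)) \<le> (norm w * \<mu>) * norm (1 - 0 :: real)"
      by (rule field_differentiable_bound[of UNIV "\<lambda>t. \<integral>x. f t x \<partial>M" "\<lambda>t. \<integral>x. f' t x \<partial>M"])
        (use D f'b in auto)
    then have 1: "\<bar>\<integral>x. f 1 x - f 0 x \<partial>M\<bar> \<le> norm w * \<mu>" using fi by simp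
    have "\<bar>(\<integral>x. f 1 x - f 0 x \<partial>M) - (\<zeta> y - \<zeta> z) * \<mu>\<bar> = \<bar>\<integral>x. f 1 x - f 0 x - (\<zeta> y - \<zeta> z) \<partial>M\<bar>"
      using fi by (simp add: \<mu>_def mult.commute)
    also have "\<dots> \<le> (\<integral>x. \<bar>f 1 x - f 0 x - (\<zeta> y - \<zeta> z)\<bar> \<partial>M)" by (rule integral_abs_bound)
    also have "\<dots> \<le> (\<integral>x. 2 * L * r \<partial>M)"
    proof (rule integral_mono_AE)
      show "AE x in M. \<bar>f 1 x - f 0 x - (\<zeta> y - \<zeta> z)\<bar> \<le> 2 * L * r"
        using AEM
      proof eventually_elim
        case (elim x)
        have "x + w - y = x - z" by (simp add: w_def)
        then have "\<bar>\<zeta> (x + w) - \<zeta> y\<bar> \<le> L * norm (x - z)" using lip[of "x + w" y] by metis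
        moreover have "\<bar>\<zeta> x - \<zeta> z\<bar> \<le> L * norm (x - z)" by (rule lip)
        moreover have "L * norm (x - z) \<le> L * r"
          using elim L0 by (intro mult_left_mono) (auto simp: dist_norm norm_minus_commute)
        ultimately show ?case by (simp add: f_def)
      qed
    qed (use fi in auto)
    also have "\<dots> = 2 * L * r * \<mu>" by (simp add: \<mu>_def)
    finally have "\<bar>\<zeta> y - \<zeta> z\<bar> * \<mu> \<le> (norm w + 2 * L * r) * \<mu>"
      using 1 \<mu> abs_mult[of "\<zeta> y - \<zeta> z" \<mu>] by (simp add: distrib_right)
    then show ?thesis using \<mu> by simp
  qed
  show ?thesis
  proof (rule field_le_epsilon)
    fix e :: real assume e: "e > 0"
    have "2 * L * (e / (2 * L + 1)) \<le> e" using L0 e by (simp add: field_simps)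
    then show "\<bar>\<zeta> y - \<zeta> z\<bar> \<le> norm (y - z) + e"
      using key[of "e / (2 * L + 1)"] L0 e by (simp add: w_def)
  qed
qed

text \<open>Integrability of \<open>f \<zeta>\<close> excludes the default value of the integral in both parts.\<close>

lemma signed_integral_density:
  assumes [measurable]: "f \<in> borel_measurable borel" "\<zeta> \<in> borel_measurable borel"
    and int: "integrable lborel (\<lambda>x. f x * \<zeta> x)"
  shows "signed_integral (signed_density f) \<zeta> = (\<integral>x. f x * \<zeta> x \<partial>lborel)"
proof -
  have part: "(\<integral>x. \<zeta> x \<partial>density lborel (\<lambda>x. ennreal (g x))) = (\<integral>x. max 0 (g x) * \<zeta> x \<partial>lborel)"
    if [measurable]: "g \<in> borel_measurable borel" for g :: "plane \<Rightarrow> real"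
  proof -
    have "(\<lambda>x. ennreal (g x)) = (\<lambda>x. ennreal (max 0 (g x)))"
      by (auto simp: max_def ennreal_neg fun_eq_iff)
    then show ?thesis by (simp only:) (subst integral_density, auto)
  qed
  have 1: "integrable lborel (\<lambda>x. max 0 (f x) * \<zeta> x)" "integrable lborel (\<lambda>x. max 0 (- f x) * \<zeta> x)"
    by (rule Bochner_Integration.integrable_bound[OF int];
        auto intro!: AE_I2 mult_right_mono simp: abs_mult)+
  have "signed_integral (signed_density f) \<zeta>
      = (\<integral>x. max 0 (f x) * \<zeta> x \<partial>lborel) - (\<integral>x. max 0 (- f x) * \<zeta> x \<partial>lborel)"
    unfolding signed_integral_def signed_density_def fst_conv snd_conv by (simp add: part)
  also have "\<dots> = (\<integral>x. max 0 (f x) * \<zeta> x - max 0 (- f x) * \<zeta> x \<partial>lborel)" using 1 by simp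
  also have "\<dots> = (\<integral>x. f x * \<zeta> x \<partial>lborel)"
    by (rule Bochner_Integration.integral_cong) (auto simp: max_def)
  finally show ?thesis .
qed

lemma signed_integral_dirac_sum:
  assumes I: "finite I" and [measurable]: "\<zeta> \<in> borel_measurable borel"
  shows "signed_integral (signed_dirac_sum I a Y) \<zeta> = (\<Sum>i\<in>I. a i * \<zeta> (Y i))"
proof -
  have part: "(\<integral>x. \<zeta> x \<partial>distr (density (count_space I) (\<lambda>i. ennreal (b i))) borel Y)
      = (\<Sum>i\<in>I. max 0 (b i) * \<zeta> (Y i))" for b :: "nat \<Rightarrow> real"
  proof -
    have "(\<lambda>i. ennreal (b i)) = (\<lambda>i. ennreal (max 0 (b i)))"
      by (auto simp: max_def ennreal_neg fun_eq_iff)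
    then have "(\<integral>x. \<zeta> x \<partial>distr (density (count_space I) (\<lambda>i. ennreal (b i))) borel Y)
        = (\<integral>i. \<zeta> (Y i) \<partial>density (count_space I) (\<lambda>i. ennreal (max 0 (b i))))"
      by (simp only:) (subst integral_distr, auto)
    also have "\<dots> = (\<integral>i. max 0 (b i) * \<zeta> (Y i) \<partial>count_space I)"
      by (subst integral_density) auto
    also have "\<dots> = (\<Sum>i\<in>I. max 0 (b i) * \<zeta> (Y i))" using I by (rule lebesgue_integral_count_space_finite)
    finally show ?thesis .
  qed
  have "signed_integral (signed_dirac_sum I a Y) \<zeta>
      = (\<Sum>i\<in>I. max 0 (a i) * \<zeta> (Y i)) - (\<Sum>i\<in>I. max 0 (- a i) * \<zeta> (Y i))"
    unfolding signed_integral_def signed_dirac_sum_def fst_conv snd_conv by (simp add: part)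
  also have "\<dots> = (\<Sum>i\<in>I. a i * \<zeta> (Y i))"
    unfolding sum_subtractf[symmetric] by (rule sum.cong) (auto simp: max_def)
  finally show ?thesis .
qed

section \<open>Integrability of the kernel against \<open>L\<^sup>p\<close> densities\<close>

text \<open>Comparison with a geometric series over dyadic discs: the kernel is at most \<open>2\<^sup>n\<^sup>+\<^sup>1\<close> on the
  \<open>n\<close>-th shell, whose area is of order \<open>4\<^sup>-\<^sup>n\<close>.\<close>

lemma kernel_power_integrable:
  assumes "0 < \<sigma>" "\<sigma> < 2"
  shows "(\<integral>\<^sup>+y. ennreal (indicator (ball 0 1) y * norm (biot_savart y) powr \<sigma>) \<partial>lborel) < \<infinity>"
proof -
  define c where "c = unit_ball_vol (real DIM(plane))"
  define b where "b n = (2 ^ Suc n) powr \<sigma>" for n :: nat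
  have term_le_suminf: "F k \<le> (\<Sum>n. F n)" for F :: "nat \<Rightarrow> ennreal" and k
    using sum_le_suminf[of F "{k}"] by simp
  have pw: "ennreal (indicator (ball 0 1) y * norm (biot_savart y) powr \<sigma>)
      \<le> (\<Sum>n. ennreal (b n) * indicator (ball 0 (1 / 2 ^ n)) y)" for y :: plane
  proof (cases "y \<in> ball 0 1 \<and> y \<noteq> 0")
    case True
    then have y: "0 < norm y" "norm y < 1" by auto
    have "\<exists>m. (1 / 2) ^ m < norm y" by (rule real_arch_pow_inv) (use y in auto)
    then obtain m where m: "(1 / 2) ^ m < norm y" by blast
    define n where "n = (LEAST m. (1 / 2) ^ m < norm y)"
    have n: "(1 / 2) ^ n < norm y" unfolding n_def
      by (rule LeastI[of "\<lambda>m. (1 / 2) ^ m < norm y", OF m])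
    have "n \<noteq> 0" using n y by (intro notI) simp
    then obtain k where k: "n = Suc k" by (cases n) auto
    have "\<not> (1 / 2) ^ k < norm y" using not_less_Least[of k "\<lambda>m. (1 / 2) ^ m < norm y"] k by (simp add: n_def)
    then have yk: "norm y \<le> 1 / 2 ^ k" by (simp add: power_one_over)
    (* The balls are open, so a point on the circle of radius 1 / 2 ^ k is put into the previous shell. *)
    show ?thesis
    proof (cases "norm y = 1 / 2 ^ k")
      case False
      have "norm (biot_savart y) \<le> 1 / norm y" by (rule norm_biot_savart_le_inverse)
      also have "\<dots> \<le> 2 ^ Suc k" using n y unfolding k by (simp add: power_one_over field_simps)
      finally have "norm (biot_savart y) powr \<sigma> \<le> b k" unfolding b_def using assms by (intro powr_mono2) auto
      then have "ennreal (indicator (ball 0 1) y * norm (biot_savart y) powr \<sigma>)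
          \<le> ennreal (b k) * indicator (ball 0 (1 / 2 ^ k)) y"
        using True False yk by (auto intro!: ennreal_leI)
      also have "\<dots> \<le> (\<Sum>n. ennreal (b n) * indicator (ball 0 (1 / 2 ^ n)) y)"
        by (rule term_le_suminf[of "\<lambda>n. ennreal (b n) * indicator (ball 0 (1 / 2 ^ n)) y" k])
      finally show ?thesis .
    next
      case eq: True
      then obtain j where j: "k = Suc j" using y by (cases k) auto
      have "norm (biot_savart y) \<le> 1 / norm y" by (rule norm_biot_savart_le_inverse)
      also have "\<dots> \<le> 2 ^ Suc j" using eq by (simp add: j)
      finally have "norm (biot_savart y) powr \<sigma> \<le> b j" unfolding b_def using assms by (intro powr_mono2) auto
      moreover have "norm y < 1 / 2 ^ j" using eq by (simp add: j field_simps)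
      ultimately have "ennreal (indicator (ball 0 1) y * norm (biot_savart y) powr \<sigma>)
          \<le> ennreal (b j) * indicator (ball 0 (1 / 2 ^ j)) y"
        using True by (auto intro!: ennreal_leI)
      also have "\<dots> \<le> (\<Sum>n. ennreal (b n) * indicator (ball 0 (1 / 2 ^ n)) y)"
        by (rule term_le_suminf[of "\<lambda>n. ennreal (b n) * indicator (ball 0 (1 / 2 ^ n)) y" j])
      finally show ?thesis .
    qed
  next
    case False
    then have "indicator (ball 0 1) y * norm (biot_savart y) powr \<sigma> = 0"
      by (auto simp: norm_biot_savart)
    then show ?thesis by (simp only: ennreal_0 zero_le)
  qed
  define \<rho> where "\<rho> = 2 powr \<sigma> / 4"
  have \<rho>: "0 < \<rho>" "\<rho> < 1"
    using assms powr_less_mono[of \<sigma> 2 2] by (auto simp: \<rho>_def)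
  have term_eq: "b n * (c * (1 / 2 ^ n)\<^sup>2) = 2 powr \<sigma> * c * \<rho> ^ n" for n
  proof -
    have "b n = 2 powr \<sigma> * (2 powr \<sigma>) ^ n"
      by (simp add: b_def powr_realpow[symmetric] powr_powr powr_add[symmetric] powr_mult algebra_simps)
    moreover have "(1 / 2 ^ n)\<^sup>2 = 1 / (4 ^ n :: real)"
      by (simp add: power_divide power_mult[symmetric] mult.commute[of n]) (simp add: power_mult)
    ultimately show ?thesis by (simp add: \<rho>_def power_divide)
  qed
  have "(\<integral>\<^sup>+y. ennreal (indicator (ball 0 1) y * norm (biot_savart y) powr \<sigma>) \<partial>lborel)
      \<le> (\<integral>\<^sup>+y. (\<Sum>n. ennreal (b n) * indicator (ball 0 (1 / 2 ^ n)) (y :: plane)) \<partial>lborel)"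
    by (rule nn_integral_mono) (rule pw)
  also have "\<dots> = (\<Sum>n. \<integral>\<^sup>+y. ennreal (b n) * indicator (ball 0 (1 / 2 ^ n)) (y :: plane) \<partial>lborel)"
    by (rule nn_integral_suminf)
      (auto intro!: borel_measurable_times_ennreal borel_measurable_indicator)
  also have "\<dots> = (\<Sum>n. ennreal (2 powr \<sigma> * c * \<rho> ^ n))"
  proof (rule arg_cong[where f = suminf], rule ext)
    fix n
    have "(\<integral>\<^sup>+y. ennreal (b n) * indicator (ball 0 (1 / 2 ^ n)) (y :: plane) \<partial>lborel)
        = ennreal (b n) * emeasure lborel (ball (0::plane) (1 / 2 ^ n))"
      by (rule nn_integral_cmult_indicator) auto
    also have "\<dots> = ennreal (b n * (c * (1 / 2 ^ n)\<^sup>2))"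
      by (subst emeasure_ball) (auto simp: c_def b_def ennreal_mult[symmetric])
    finally show "(\<integral>\<^sup>+y. ennreal (b n) * indicator (ball 0 (1 / 2 ^ n)) (y :: plane) \<partial>lborel)
        = ennreal (2 powr \<sigma> * c * \<rho> ^ n)" by (simp only: term_eq)
  qed
  also have "\<dots> < \<infinity>"
  proof -
    have "summable (\<lambda>n. 2 powr \<sigma> * c * \<rho> ^ n)" using \<rho> by (intro summable_mult summable_geometric) auto
    then have "(\<Sum>n. ennreal (2 powr \<sigma> * c * \<rho> ^ n)) = ennreal (\<Sum>n. 2 powr \<sigma> * c * \<rho> ^ n)"
      by (intro suminf_ennreal2) (use \<rho> in \<open>auto simp: c_def\<close>)
    then show ?thesis by simp
  qed
  finally show ?thesis .
qed

definition kernel_bound :: "real \<Rightarrow> real \<Rightarrow> real \<Rightarrow> bool" where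
  "kernel_bound p \<theta> c \<longleftrightarrow> 0 < \<theta> \<and> 0 \<le> c \<and>
    (\<forall>f z. in_Lp p f \<longrightarrow> integrable lborel f \<longrightarrow>
       integrable lborel (\<lambda>y. norm (biot_savart (z - y)) powr (1 + \<theta>) * \<bar>f y\<bar>) \<and>
       (\<integral>y. norm (biot_savart (z - y)) powr (1 + \<theta>) * \<bar>f y\<bar> \<partial>lborel)
         \<le> c + (\<integral>y. \<bar>f y\<bar> powr p \<partial>lborel) + (\<integral>y. \<bar>f y\<bar> \<partial>lborel))"

text \<open>Young's inequality with the exponents \<open>p\<close> and \<open>p / (p - 1)\<close> reduces the claim to the local
  integrability of the power \<open>(1 + \<theta>) p / (p - 1)\<close> of the kernel. As \<open>p > 2\<close>, this exponent is below
  \<open>2\<close> for \<open>\<theta> = (p - 2) / (2 p)\<close>.\<close>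

lemma kernel_bound_exists:
  assumes p: "2 < p"
  shows "\<exists>\<theta> c. kernel_bound p \<theta> c"
proof -
  define \<theta> where "\<theta> = (p - 2) / (2 * p)"
  define \<sigma> where "\<sigma> = (1 + \<theta>) * (p / (p - 1))"
  have \<theta>: "\<theta> > 0" using p by (simp add: \<theta>_def)
  have "\<sigma> = (3 * p - 2) / (2 * (p - 1))" using p by (simp add: \<sigma>_def \<theta>_def field_simps)
  also have "\<dots> < 2" using p by (simp add: field_simps)
  finally have \<sigma>: "\<sigma> > 0" "\<sigma> < 2" using p \<theta> by (auto simp: \<sigma>_def intro!: mult_pos_pos)
  define g where "g y = indicator (ball 0 1) y * norm (biot_savart y) powr \<sigma>" for y
  have gm [measurable]: "g \<in> borel_measurable borel" unfolding g_def
    by (intro borel_measurable_times borel_measurable_indicator powr_real_measurable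
        borel_measurable_norm biot_savart_measurable) auto
  have g0: "g y \<ge> 0" for y by (simp add: g_def)
  have gi: "integrable lborel g"
    by (rule integrableI_nonneg) (use kernel_power_integrable[OF \<sigma>] g0 in \<open>auto simp: g_def\<close>)
  define c where "c = (\<integral>y. g y \<partial>lborel)"
  have young: "\<alpha> * \<phi> \<le> \<alpha> powr (p / (p - 1)) + \<phi> powr p" if "\<alpha> \<ge> 0" "\<phi> \<ge> 0" for \<alpha> \<phi> :: real
  proof (cases "\<phi> \<le> \<alpha> powr (1 / (p - 1))")
    case True
    have "\<alpha> * \<phi> \<le> \<alpha> powr 1 * \<alpha> powr (1 / (p - 1))" using True that by (intro mult_mono) auto
    also have "\<dots> = \<alpha> powr (1 + 1 / (p - 1))" by (simp only: powr_add)
    also have "1 + 1 / (p - 1) = p / (p - 1)" using p by (simp add: field_simps)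
    finally show ?thesis using powr_ge_zero[of \<phi> p] by linarith
  next
    case False
    then have "(\<alpha> powr (1 / (p - 1))) powr (p - 1) \<le> \<phi> powr (p - 1)" using p by (intro powr_mono2) auto
    then have "\<alpha> \<le> \<phi> powr (p - 1)" using p that by (simp add: powr_powr)
    then have "\<alpha> * \<phi> \<le> \<phi> powr (p - 1) * \<phi> powr 1" using that by (intro mult_mono) auto
    also have "\<dots> = \<phi> powr (p - 1 + 1)" by (simp only: powr_add)
    also have "p - 1 + 1 = p" by simp
    finally show ?thesis using powr_ge_zero[of \<alpha> "p / (p - 1)"] by linarith
  qed
  have pw: "norm (biot_savart x) powr (1 + \<theta>) * \<phi> \<le> g x + \<phi> powr p + \<phi>" if \<phi>: "\<phi> \<ge> 0" for x \<phi>
  proof (cases "norm x < 1")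
    case True
    have "norm (biot_savart x) powr (1 + \<theta>) * \<phi> \<le> (norm (biot_savart x) powr (1 + \<theta>)) powr (p / (p - 1)) + \<phi> powr p"
      using \<phi> by (intro young) auto
    also have "(norm (biot_savart x) powr (1 + \<theta>)) powr (p / (p - 1)) = g x"
      using True by (simp add: g_def powr_powr \<sigma>_def)
    finally show ?thesis using \<phi> by linarith
  next
    case False
    have "norm (biot_savart x) \<le> 1 / norm x" by (rule norm_biot_savart_le_inverse)
    also have "\<dots> \<le> 1" using False by (simp add: divide_le_eq_1)
    finally have "norm (biot_savart x) powr (1 + \<theta>) \<le> 1" using \<theta> by (intro powr_le1) auto
    then have "norm (biot_savart x) powr (1 + \<theta>) * \<phi> \<le> 1 * \<phi>" using \<phi> by (intro mult_right_mono) auto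
    then show ?thesis using g0[of x] powr_ge_zero[of \<phi> p] by linarith
  qed
  have "kernel_bound p \<theta> c"
    unfolding kernel_bound_def
  proof (intro conjI allI impI \<theta>)
    show "0 \<le> c" unfolding c_def using g0 by (intro integral_nonneg_AE) auto
    fix f z assume f: "in_Lp p f" "integrable lborel f"
    have fm [measurable]: "f \<in> borel_measurable borel" and fp: "integrable lborel (\<lambda>y. \<bar>f y\<bar> powr p)"
      using f(1) by (auto simp: in_Lp_def)
    have giz: "integrable lborel (\<lambda>y. g (z - y))" and ciz: "(\<integral>y. g (z - y) \<partial>lborel) = c"
      using gi lborel_distr_reflect[of z] integrable_distr_eq[of "\<lambda>y. z - y" lborel borel g]
        integral_distr[of "\<lambda>y. z - y" lborel borel g] by (simp_all add: c_def)
    have dom: "integrable lborel (\<lambda>y. g (z - y) + \<bar>f y\<bar> powr p + \<bar>f y\<bar>)" using giz fp f(2) by auto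
    show i: "integrable lborel (\<lambda>y. norm (biot_savart (z - y)) powr (1 + \<theta>) * \<bar>f y\<bar>)"
      by (rule Bochner_Integration.integrable_bound[OF dom])
        (use pw g0 in \<open>auto intro!: AE_I2 simp: abs_mult\<close>)
    have "(\<integral>y. norm (biot_savart (z - y)) powr (1 + \<theta>) * \<bar>f y\<bar> \<partial>lborel)
        \<le> (\<integral>y. g (z - y) + \<bar>f y\<bar> powr p + \<bar>f y\<bar> \<partial>lborel)"
      by (rule integral_mono[OF i dom]) (use pw in auto)
    also have "\<dots> = c + (\<integral>y. \<bar>f y\<bar> powr p \<partial>lborel) + (\<integral>y. \<bar>f y\<bar> \<partial>lborel)"
      using giz fp f(2) ciz by simp
    finally show "(\<integral>y. norm (biot_savart (z - y)) powr (1 + \<theta>) * \<bar>f y\<bar> \<partial>lborel)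
        \<le> c + (\<integral>y. \<bar>f y\<bar> powr p \<partial>lborel) + (\<integral>y. \<bar>f y\<bar> \<partial>lborel)" .
  qed
  then show ?thesis by blast
qed

section \<open>The initial data\<close>

locale blob_data =
  fixes N :: nat and p \<gamma> \<Lambda> R \<delta> :: real and a :: "nat \<Rightarrow> real" and Y0 :: "nat \<Rightarrow> plane"
    and \<epsilon> :: real and w0 :: "nat \<Rightarrow> plane \<Rightarrow> real"
  assumes admissible: "admissible_data N p \<gamma> \<Lambda> R \<delta> a Y0 \<epsilon> w0"
    and p: "2 < p" and a_nonzero: "\<And>i. i \<in> {1..N} \<Longrightarrow> a i \<noteq> 0"
    and pos: "0 < \<epsilon>" "0 < R" "0 < \<delta>"
begin

lemma w0_measurable [measurable]: "i \<in> {1..N} \<Longrightarrow> w0 i \<in> borel_measurable borel"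
  using admissible by (auto simp: admissible_data_def in_Lp_def)

lemma w0_mass:
  assumes "i \<in> {1..N}"
  shows "integrable lborel (w0 i)" "(\<integral>x. \<bar>w0 i x\<bar> \<partial>lborel) = \<bar>a i\<bar>"
    "AE x in lborel. w0 i x = sgn (a i) * \<bar>w0 i x\<bar>"
  using one_signed_mass[of "w0 i" "a i"] admissible assms a_nonzero[OF assms]
  by (auto simp: admissible_data_def in_Lp_def)

lemma w0_support:
  assumes "i \<in> {1..N}"
  shows "AE x in lborel. w0 i x \<noteq> 0 \<longrightarrow> x \<in> spt (w0 i) \<and> norm (x - center (w0 i)) \<le> R"
  using AE_zero_outside_spt[of "w0 i"]
proof eventually_elim
  case (elim x)
  have "spt (w0 i) \<subseteq> ball (center (w0 i)) R" using admissible assms by (auto simp: admissible_data_def)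
  then show ?case using elim by (auto simp: dist_norm norm_minus_commute)
qed

lemma bounded_on_support_integrable:
  fixes g :: "plane \<Rightarrow> 'b::{banach, second_countable_topology}"
  assumes i: "i \<in> {1..N}" and g [measurable]: "g \<in> borel_measurable borel"
    and b: "\<And>x. norm (x - center (w0 i)) \<le> R \<Longrightarrow> norm (g x) \<le> b"
  shows "integrable lborel (\<lambda>x. \<bar>w0 i x\<bar> *\<^sub>R g x)" "integrable lborel (\<lambda>x. w0 i x *\<^sub>R g x)"
proof -
  note [measurable] = w0_measurable[OF i]
  have dom: "integrable lborel (\<lambda>x. b * \<bar>w0 i x\<bar>)" using w0_mass(1)[OF i] by auto
  have bd: "AE x in lborel. \<bar>w0 i x\<bar> * norm (g x) \<le> norm (b * \<bar>w0 i x\<bar>)"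
    using w0_support[OF i]
  proof eventually_elim
    case (elim x)
    show ?case
    proof (cases "w0 i x = 0")
      case False
      then have *: "norm (g x) \<le> b" using b elim by auto
      then have "\<bar>w0 i x\<bar> * norm (g x) \<le> \<bar>w0 i x\<bar> * \<bar>b\<bar>" by (intro mult_left_mono) auto
      then show ?thesis by (simp add: abs_mult mult.commute)
    qed simp
  qed
  show "integrable lborel (\<lambda>x. \<bar>w0 i x\<bar> *\<^sub>R g x)"
    by (rule Bochner_Integration.integrable_bound[OF dom]) (use bd in auto)
  show "integrable lborel (\<lambda>x. w0 i x *\<^sub>R g x)"
    by (rule Bochner_Integration.integrable_bound[OF dom]) (use bd in auto)
qed

lemma w0_moment:
  assumes i: "i \<in> {1..N}"
  shows "integrable lborel (\<lambda>x. \<bar>w0 i x\<bar> * (norm (x - Y0 i))\<^sup>2)"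
    "(\<integral>x. \<bar>w0 i x\<bar> * (norm (x - Y0 i))\<^sup>2 \<partial>lborel) \<le> \<bar>a i\<bar> * \<epsilon>\<^sup>2"
proof -
  note [measurable] = w0_measurable[OF i]
  have "norm ((norm (x - Y0 i))\<^sup>2) \<le> (R + norm (center (w0 i) - Y0 i))\<^sup>2"
    if "norm (x - center (w0 i)) \<le> R" for x
    using norm_triangle_ineq[of "x - center (w0 i)" "center (w0 i) - Y0 i"] that
    by (auto intro!: power_mono)
  from bounded_on_support_integrable(1)[OF i _ this]
  show int: "integrable lborel (\<lambda>x. \<bar>w0 i x\<bar> * (norm (x - Y0 i))\<^sup>2)" by simp
  define J where "J = (\<integral>x. \<bar>w0 i x\<bar> * (norm (x - Y0 i))\<^sup>2 \<partial>lborel)"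
  have J: "(\<integral>x. (norm (x - Y0 i))\<^sup>2 * w0 i x \<partial>lborel) = sgn (a i) * J"
  proof -
    have "(\<integral>x. (norm (x - Y0 i))\<^sup>2 * w0 i x \<partial>lborel) = (\<integral>x. sgn (a i) * (\<bar>w0 i x\<bar> * (norm (x - Y0 i))\<^sup>2) \<partial>lborel)"
    proof (rule integral_cong_AE)
      show "AE x in lborel. (norm (x - Y0 i))\<^sup>2 * w0 i x = sgn (a i) * (\<bar>w0 i x\<bar> * (norm (x - Y0 i))\<^sup>2)"
        using w0_mass(3)[OF i]
      proof eventually_elim
        case (elim x)
        show ?case by (subst elim) simp
      qed
    qed auto
    then show ?thesis by (simp add: J_def)
  qed
  have "W2_dirac (w0 i) (Y0 i) \<le> \<epsilon>" and "(\<integral>x. w0 i x \<partial>lborel) = a i"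
    using admissible i by (auto simp: admissible_data_def)
  then have "sqrt (1 / a i * (sgn (a i) * J)) \<le> \<epsilon>" by (simp add: W2_dirac_def J)
  moreover have "1 / a i * (sgn (a i) * J) = J / \<bar>a i\<bar>"
    using a_nonzero[OF i] by (simp add: sgn_if)
  ultimately have "sqrt (J / \<bar>a i\<bar>) \<le> \<epsilon>" by simp
  then have "J / \<bar>a i\<bar> \<le> \<epsilon>\<^sup>2" using pos by (simp add: real_le_lsqrt sqrt_le_D)
  then show "J \<le> \<bar>a i\<bar> * \<epsilon>\<^sup>2" using a_nonzero[OF i] by (simp add: field_simps)
qed

text \<open>The mean displacement is bounded by \<open>\<bar>\<xi>\<bar> \<le> \<bar>\<xi>\<bar>\<^sup>2 / (2 \<epsilon>) + \<epsilon> / 2\<close>, integrated.\<close>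

lemma center_near:
  assumes i: "i \<in> {1..N}"
  shows "norm (center (w0 i) - Y0 i) \<le> \<epsilon>"
proof -
  note [measurable] = w0_measurable[OF i]
  have int: "(\<integral>x. w0 i x \<partial>lborel) = a i" using admissible i by (auto simp: admissible_data_def)
  have bi: "integrable lborel (\<lambda>x. w0 i x *\<^sub>R (x - c))" for c
  proof (rule bounded_on_support_integrable(2)[OF i, where b = "R + norm (center (w0 i) - c)"])
    show "norm (x - c) \<le> R + norm (center (w0 i) - c)" if "norm (x - center (w0 i)) \<le> R" for x
      using norm_triangle_ineq[of "x - center (w0 i)" "center (w0 i) - c"] that by auto
  qed simp
  have xi: "integrable lborel (\<lambda>x. w0 i x *\<^sub>R x)" using bi[of 0] by simp
  have "(\<integral>x. w0 i x *\<^sub>R (x - Y0 i) \<partial>lborel) = (\<integral>x. w0 i x *\<^sub>R x - w0 i x *\<^sub>R Y0 i \<partial>lborel)"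
    by (simp add: scaleR_diff_right)
  also have "\<dots> = (\<integral>x. w0 i x *\<^sub>R x \<partial>lborel) - a i *\<^sub>R Y0 i"
    using xi w0_mass(1)[OF i] int by simp
  finally have "(\<integral>x. w0 i x *\<^sub>R (x - Y0 i) \<partial>lborel) = a i *\<^sub>R (center (w0 i) - Y0 i)"
    unfolding center_def int using a_nonzero[OF i] by (simp add: scaleR_diff_right)
  then have "\<bar>a i\<bar> * norm (center (w0 i) - Y0 i) = norm (\<integral>x. w0 i x *\<^sub>R (x - Y0 i) \<partial>lborel)" by simp
  also have "\<dots> \<le> (\<integral>x. norm (w0 i x *\<^sub>R (x - Y0 i)) \<partial>lborel)" by (rule integral_norm_bound)
  also have "\<dots> \<le> (\<integral>x. (1 / (2 * \<epsilon>)) * (\<bar>w0 i x\<bar> * (norm (x - Y0 i))\<^sup>2) + \<epsilon> / 2 * \<bar>w0 i x\<bar> \<partial>lborel)"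
  proof (rule integral_mono)
    show "integrable lborel (\<lambda>x. norm (w0 i x *\<^sub>R (x - Y0 i)))" using bi by (rule integrable_norm)
    show "integrable lborel (\<lambda>x. (1 / (2 * \<epsilon>)) * (\<bar>w0 i x\<bar> * (norm (x - Y0 i))\<^sup>2) + \<epsilon> / 2 * \<bar>w0 i x\<bar>)"
      using w0_moment(1)[OF i] w0_mass(1)[OF i]
      by (intro Bochner_Integration.integrable_add integrable_mult_right) auto
    fix x
    have "0 \<le> (norm (x - Y0 i) - \<epsilon>)\<^sup>2" by simp
    then have "norm (x - Y0 i) \<le> (1 / (2 * \<epsilon>)) * (norm (x - Y0 i))\<^sup>2 + \<epsilon> / 2"
      using pos by (simp add: field_simps power2_eq_square)
    then have "\<bar>w0 i x\<bar> * norm (x - Y0 i) \<le> \<bar>w0 i x\<bar> * ((1 / (2 * \<epsilon>)) * (norm (x - Y0 i))\<^sup>2 + \<epsilon> / 2)"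
      by (intro mult_left_mono) auto
    then show "norm (w0 i x *\<^sub>R (x - Y0 i)) \<le> (1 / (2 * \<epsilon>)) * (\<bar>w0 i x\<bar> * (norm (x - Y0 i))\<^sup>2) + \<epsilon> / 2 * \<bar>w0 i x\<bar>"
      unfolding norm_scaleR by (simp add: algebra_simps)
  qed
  also have "\<dots> = (1 / (2 * \<epsilon>)) * (\<integral>x. \<bar>w0 i x\<bar> * (norm (x - Y0 i))\<^sup>2 \<partial>lborel) + \<epsilon> / 2 * \<bar>a i\<bar>"
    using w0_moment(1)[OF i] w0_mass(1,2)[OF i]
    by (subst Bochner_Integration.integral_add) auto
  also have "\<dots> \<le> (1 / (2 * \<epsilon>)) * (\<bar>a i\<bar> * \<epsilon>\<^sup>2) + \<epsilon> / 2 * \<bar>a i\<bar>"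
    using w0_moment(2)[OF i] pos by (intro add_right_mono mult_left_mono) auto
  also have "\<dots> = \<bar>a i\<bar> * \<epsilon>" using pos by (simp add: field_simps power2_eq_square)
  finally show ?thesis using a_nonzero[OF i] by simp
qed

lemma w0_support_near:
  assumes i: "i \<in> {1..N}"
  shows "AE x in lborel. w0 i x \<noteq> 0 \<longrightarrow> norm (x - Y0 i) \<le> R + \<epsilon>"
  using w0_support[OF i]
proof eventually_elim
  case (elim x)
  show ?case
    using elim center_near[OF i] norm_triangle_ineq[of "x - center (w0 i)" "center (w0 i) - Y0 i"] by auto
qed

lemma spt_disjoint:
  assumes "i \<in> {1..N}" "j \<in> {1..N}" "i \<noteq> j" "x \<in> spt (w0 i)" "y \<in> spt (w0 j)"
  shows "\<delta> \<le> norm (x - y)"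
proof -
  have "\<delta> \<le> setdist (spt (w0 i)) (spt (w0 j))" using admissible assms by (auto simp: admissible_data_def)
  also have "\<dots> \<le> dist x y" using assms by (intro setdist_le_dist)
  finally show ?thesis by (simp add: dist_norm)
qed

lemma spt_witness:
  assumes i: "i \<in> {1..N}"
  obtains x where "x \<in> spt (w0 i)" "norm (x - Y0 i) \<le> R + \<epsilon>"
proof -
  have "\<exists>x. x \<in> spt (w0 i) \<and> norm (x - Y0 i) \<le> R + \<epsilon>"
  proof (rule ccontr)
    assume none: "\<nexists>x. x \<in> spt (w0 i) \<and> norm (x - Y0 i) \<le> R + \<epsilon>"
    have "AE x in lborel. \<bar>w0 i x\<bar> = 0"
      using w0_support[OF i] w0_support_near[OF i] by eventually_elim (use none in auto)
    then have "(\<integral>x. \<bar>w0 i x\<bar> \<partial>lborel) = 0" by (rule integral_eq_zero_AE)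
    then show False using w0_mass(2)[OF i] a_nonzero[OF i] by simp
  qed
  then show ?thesis using that by blast
qed

text \<open>A blob with nonzero mass has a point in its support, which is close to the vortex; the distance of
  the supports passes to the vortices.\<close>

lemma Y0_separated:
  assumes "i \<in> {1..N}" "j \<in> {1..N}" "i \<noteq> j"
  shows "\<delta> - 2 * (R + \<epsilon>) \<le> norm (Y0 i - Y0 j)"
proof -
  obtain x where x: "x \<in> spt (w0 i)" "norm (x - Y0 i) \<le> R + \<epsilon>" using spt_witness[OF assms(1)] .
  obtain y where y: "y \<in> spt (w0 j)" "norm (y - Y0 j) \<le> R + \<epsilon>" using spt_witness[OF assms(2)] .
  have eq: "x - y = (Y0 i - Y0 j) + (x - Y0 i) - (y - Y0 j)" by simp
  have "norm (x - y) \<le> norm ((Y0 i - Y0 j) + (x - Y0 i)) + norm (y - Y0 j)"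
    unfolding eq by (rule norm_triangle_ineq4)
  moreover have "norm ((Y0 i - Y0 j) + (x - Y0 i)) \<le> norm (Y0 i - Y0 j) + norm (x - Y0 i)"
    by (rule norm_triangle_ineq)
  ultimately show ?thesis using spt_disjoint[OF assms x(1) y(1)] x(2) y(2)
    unfolding distrib_left by linarith
qed

text \<open>The supports are disjoint, so the \<open>p\<close>-th power of the sum is the sum of the \<open>p\<close>-th powers.\<close>

lemma w0_Lp:
  assumes i: "i \<in> {1..N}"
  shows "in_Lp p (w0 i)" "(\<integral>x. \<bar>w0 i x\<bar> powr p \<partial>lborel) \<le> (\<Lambda> * \<epsilon> powr (- \<gamma>)) powr p"
proof -
  have Lp: "in_Lp p (w0 j)" if "j \<in> {1..N}" for j using admissible that by (auto simp: admissible_data_def)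
  show "in_Lp p (w0 i)" by (rule Lp[OF i])
  note [measurable] = w0_measurable
  have sp: "AE x in lborel. \<forall>j\<in>{1..N}. w0 j x \<noteq> 0 \<longrightarrow> x \<in> spt (w0 j)"
  proof (subst AE_finite_all)
    show "\<forall>j\<in>{1..N}. AE x in lborel. w0 j x \<noteq> 0 \<longrightarrow> x \<in> spt (w0 j)"
    proof
      fix j assume "j \<in> {1..N}"
      from w0_support[OF this] show "AE x in lborel. w0 j x \<noteq> 0 \<longrightarrow> x \<in> spt (w0 j)"
        by eventually_elim auto
    qed
  qed simp
  have eq: "AE x in lborel. \<bar>\<Sum>j\<in>{1..N}. w0 j x\<bar> powr p = (\<Sum>j\<in>{1..N}. \<bar>w0 j x\<bar> powr p)"
    using sp
  proof eventually_elim
    case (elim x)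
    show ?case
    proof (cases "\<exists>k\<in>{1..N}. w0 k x \<noteq> 0")
      case True
      then obtain k where k: "k \<in> {1..N}" "w0 k x \<noteq> 0" by auto
      have z: "w0 j x = 0" if j: "j \<in> {1..N} - {k}" for j
      proof (rule ccontr)
        assume "w0 j x \<noteq> 0"
        then have "\<delta> \<le> norm (x - x)" using elim j k by (intro spt_disjoint[of j k]) auto
        then show False using pos by simp
      qed
      have "(\<Sum>j\<in>{1..N}. w0 j x) = w0 k x" using k z by (subst sum.remove[of _ k]) auto
      moreover have "(\<Sum>j\<in>{1..N}. \<bar>w0 j x\<bar> powr p) = \<bar>w0 k x\<bar> powr p"
        using k z by (subst sum.remove[of _ k]) auto
      ultimately show ?thesis by simp
    qed simp
  qed
  have si: "integrable lborel (\<lambda>x. \<Sum>j\<in>{1..N}. \<bar>w0 j x\<bar> powr p)"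
    using Lp by (intro Bochner_Integration.integrable_sum) (auto simp: in_Lp_def)
  have "(\<integral>x. \<bar>w0 i x\<bar> powr p \<partial>lborel) \<le> (\<integral>x. (\<Sum>j\<in>{1..N}. \<bar>w0 j x\<bar> powr p) \<partial>lborel)"
    using si Lp[OF i] i by (intro integral_mono) (auto simp: in_Lp_def intro: member_le_sum)
  also have "\<dots> = (\<integral>x. \<bar>\<Sum>j\<in>{1..N}. w0 j x\<bar> powr p \<partial>lborel)"
    by (rule integral_cong_AE) (use eq in \<open>auto elim!: eventually_mono\<close>)
  also have "\<dots> = (Lp_norm p (\<lambda>x. \<Sum>j\<in>{1..N}. w0 j x)) powr p"
    unfolding Lp_norm_def using p by (simp add: powr_powr integral_nonneg_AE)
  also have "\<dots> \<le> (\<Lambda> * \<epsilon> powr (- \<gamma>)) powr p"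
    using admissible p by (intro powr_mono2) (auto simp: admissible_data_def Lp_norm_def)
  finally show "(\<integral>x. \<bar>w0 i x\<bar> powr p \<partial>lborel) \<le> (\<Lambda> * \<epsilon> powr (- \<gamma>)) powr p" .
qed

definition M :: "nat \<Rightarrow> plane measure" where
  "M i = density lborel (\<lambda>x. ennreal \<bar>w0 i x\<bar>)"

lemma sets_M [measurable_cong, simp]: "sets (M i) = sets borel" "space (M i) = UNIV"
  by (simp_all add: M_def)

lemma M_integral:
  fixes g :: "plane \<Rightarrow> 'b::{banach, second_countable_topology}"
  assumes "i \<in> {1..N}" "g \<in> borel_measurable borel"
  shows "integral\<^sup>L (M i) g = (\<integral>x. \<bar>w0 i x\<bar> *\<^sub>R g x \<partial>lborel)"
    "integrable (M i) g \<longleftrightarrow> integrable lborel (\<lambda>x. \<bar>w0 i x\<bar> *\<^sub>R g x)"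
proof -
  note [measurable] = w0_measurable[OF assms(1)] assms(2)
  show "integral\<^sup>L (M i) g = (\<integral>x. \<bar>w0 i x\<bar> *\<^sub>R g x \<partial>lborel)"
    unfolding M_def by (rule integral_density) auto
  show "integrable (M i) g \<longleftrightarrow> integrable lborel (\<lambda>x. \<bar>w0 i x\<bar> *\<^sub>R g x)"
    unfolding M_def by (rule integrable_density) auto
qed

lemma M_AE:
  assumes "i \<in> {1..N}"
  shows "(AE x in M i. Q x) \<longleftrightarrow> (AE x in lborel. w0 i x \<noteq> 0 \<longrightarrow> Q x)"
  unfolding M_def using w0_measurable[OF assms] by (subst AE_density) (auto simp: ennreal_less_zero_iff)

lemma M_finite:
  assumes "i \<in> {1..N}"
  shows "finite_measure (M i)" "measure (M i) (space (M i)) = \<bar>a i\<bar>"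
proof -
  have "emeasure (M i) (space (M i)) = (\<integral>\<^sup>+x. ennreal \<bar>w0 i x\<bar> \<partial>lborel)"
    unfolding M_def using w0_measurable[OF assms] by (subst emeasure_density) auto
  also have "\<dots> = ennreal (\<integral>x. \<bar>w0 i x\<bar> \<partial>lborel)"
    using w0_mass(1)[OF assms] by (intro nn_integral_eq_integral) auto
  finally have *: "emeasure (M i) (space (M i)) = ennreal \<bar>a i\<bar>" by (simp add: w0_mass(2)[OF assms])
  then show "finite_measure (M i)" by (intro finite_measureI) auto
  show "measure (M i) (space (M i)) = \<bar>a i\<bar>" using * by (simp add: measure_def)
qed

end

section \<open>The Lagrangian form of the evolution\<close>

locale blob_flow = blob_data +
  fixes w :: "real \<Rightarrow> plane \<Rightarrow> real" and ws :: "nat \<Rightarrow> real \<Rightarrow> plane \<Rightarrow> real"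
    and X :: "real \<Rightarrow> plane \<Rightarrow> plane" and \<theta> c A :: real
  assumes evolution: "euler_evolution N p w0 w ws"
    and flow: "lagrangian_flow (\<lambda>t. velocity (w t)) X"
    and solution: "transport_solution p (\<lambda>t. velocity (w t)) X w (\<lambda>x. \<Sum>i\<in>{1..N}. w0 i x)"
    and transport: "\<And>i. i \<in> {1..N} \<Longrightarrow> transport_solution p (\<lambda>t. velocity (w t)) X (ws i) (w0 i)"
    and kernel: "kernel_bound p \<theta> c"
    and A: "(\<Sum>i\<in>{1..N}. \<bar>a i\<bar>) \<le> A"
begin

lemma \<theta>: "0 < \<theta>" and c: "0 \<le> c"
  using kernel by (auto simp: kernel_bound_def)

text \<open>The bound for the kernel integrals. It blows up like \<open>\<epsilon> powr (- \<gamma> * p)\<close>.\<close>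

definition B :: real where "B = c + (\<Lambda> * \<epsilon> powr (- \<gamma>)) powr p + A"

lemma a_le_A: "i \<in> {1..N} \<Longrightarrow> \<bar>a i\<bar> \<le> A"
  using A member_le_sum[of i "{1..N}" "\<lambda>i. \<bar>a i\<bar>"] by simp

lemma A_nonneg: "0 \<le> A" using A by (rule order_trans[rotated]) (simp add: sum_nonneg)

lemma B_nonneg: "0 \<le> B" unfolding B_def using c A_nonneg by simp

lemma X_measurable [measurable]: "0 \<le> t \<Longrightarrow> X t \<in> borel_measurable borel"
  and X_preserves: "0 \<le> t \<Longrightarrow> distr lborel lborel (X t) = lborel"
  using flow by (auto simp: lagrangian_flow_def)

lemma ws_Lp: "i \<in> {1..N} \<Longrightarrow> 0 \<le> t \<Longrightarrow> in_Lp p (ws i t)"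
  using transport[of i] by (auto simp: transport_solution_def continuous_Lp_def)

lemma ws_measurable [measurable]: "i \<in> {1..N} \<Longrightarrow> 0 \<le> t \<Longrightarrow> ws i t \<in> borel_measurable borel"
  using ws_Lp[of i t] by (auto simp: in_Lp_def)

lemma w_measurable [measurable]: "0 \<le> t \<Longrightarrow> w t \<in> borel_measurable borel"
  using solution by (auto simp: transport_solution_def continuous_Lp_def in_Lp_def)

lemma ws_mass:
  assumes i: "i \<in> {1..N}" and t: "0 \<le> t"
  shows "integrable lborel (ws i t)" "(\<integral>x. \<bar>ws i t x\<bar> \<partial>lborel) = \<bar>a i\<bar>"
    "AE x in lborel. ws i t x = sgn (a i) * \<bar>ws i t x\<bar>"
proof -
  have 1: "(AE x in lborel. w0 i x \<ge> 0) \<longrightarrow> (AE x in lborel. ws i t x \<ge> 0)"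
    "(AE x in lborel. w0 i x \<le> 0) \<longrightarrow> (AE x in lborel. ws i t x \<le> 0)"
    "(\<integral>x. ws i t x \<partial>lborel) = (\<integral>x. w0 i x \<partial>lborel)"
    using evolution i t unfolding euler_evolution_def by blast+
  have "one_signed (w0 i)" "(\<integral>x. w0 i x \<partial>lborel) = a i"
    using admissible i by (auto simp: admissible_data_def)
  then have "one_signed (ws i t)" "(\<integral>x. ws i t x \<partial>lborel) = a i"
    using 1 by (auto simp: one_signed_def)
  from one_signed_mass[OF this(1) _ this(2) a_nonzero[OF i]] ws_measurable[OF i t]
  show "integrable lborel (ws i t)" "(\<integral>x. \<bar>ws i t x\<bar> \<partial>lborel) = \<bar>a i\<bar>"
    "AE x in lborel. ws i t x = sgn (a i) * \<bar>ws i t x\<bar>" by auto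
qed

lemma ws_Lp_bound:
  assumes i: "i \<in> {1..N}" and t: "0 \<le> t"
  shows "(\<integral>x. \<bar>ws i t x\<bar> powr p \<partial>lborel) \<le> (\<Lambda> * \<epsilon> powr (- \<gamma>)) powr p"
proof -
  have "Lp_norm p (ws i t) = Lp_norm p (w0 i)"
    using evolution i t unfolding euler_evolution_def by blast
  then have "Lp_norm p (ws i t) powr p = Lp_norm p (w0 i) powr p" by simp
  then have "(\<integral>x. \<bar>ws i t x\<bar> powr p \<partial>lborel) = (\<integral>x. \<bar>w0 i x\<bar> powr p \<partial>lborel)"
    unfolding Lp_norm_def using p by (simp add: powr_powr integral_nonneg_AE)
  then show ?thesis using w0_Lp(2)[OF i] by simp
qed

text \<open>Change of variables along the measure preserving flow, which transports the vorticity. Integrals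
  over the blob at time \<open>t\<close> are integrals over labels.\<close>

lemma label_integral:
  fixes g :: "plane \<Rightarrow> 'b::{banach, second_countable_topology}"
  assumes i: "i \<in> {1..N}" and t: "0 \<le> t" and g [measurable]: "g \<in> borel_measurable borel"
  shows "integral\<^sup>L (M i) (\<lambda>y. g (X t y)) = (\<integral>z. \<bar>ws i t z\<bar> *\<^sub>R g z \<partial>lborel)"
    "integrable (M i) (\<lambda>y. g (X t y)) \<longleftrightarrow> integrable lborel (\<lambda>z. \<bar>ws i t z\<bar> *\<^sub>R g z)"
proof -
  note [measurable] = X_measurable[OF t] ws_measurable[OF i t] w0_measurable[OF i]
  have Xm: "X t \<in> measurable lborel lborel" by simp
  have AE: "AE y in lborel. \<bar>w0 i y\<bar> *\<^sub>R g (X t y) = \<bar>ws i t (X t y)\<bar> *\<^sub>R g (X t y)"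
  proof -
    have "AE y in lborel. ws i t (X t y) = w0 i y"
      using transport[OF i] t by (auto simp: transport_solution_def transported_by_def)
    then show ?thesis by eventually_elim simp
  qed
  have m: "(\<lambda>z. \<bar>ws i t z\<bar> *\<^sub>R g z) \<in> borel_measurable lborel" by measurable
  have m2: "(\<lambda>y. g (X t y)) \<in> borel_measurable borel" by measurable
  have "integral\<^sup>L (M i) (\<lambda>y. g (X t y)) = (\<integral>y. \<bar>w0 i y\<bar> *\<^sub>R g (X t y) \<partial>lborel)"
    by (rule M_integral(1)[OF i m2])
  also have "\<dots> = (\<integral>y. \<bar>ws i t (X t y)\<bar> *\<^sub>R g (X t y) \<partial>lborel)"
    by (rule integral_cong_AE) (use AE in auto)
  also have "\<dots> = (\<integral>z. \<bar>ws i t z\<bar> *\<^sub>R g z \<partial>distr lborel lborel (X t))"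
    using integral_distr[OF Xm m] by simp
  finally show "integral\<^sup>L (M i) (\<lambda>y. g (X t y)) = (\<integral>z. \<bar>ws i t z\<bar> *\<^sub>R g z \<partial>lborel)"
    by (simp only: X_preserves[OF t])
  have "integrable (M i) (\<lambda>y. g (X t y)) \<longleftrightarrow> integrable lborel (\<lambda>y. \<bar>w0 i y\<bar> *\<^sub>R g (X t y))"
    by (rule M_integral(2)[OF i m2])
  also have "\<dots> \<longleftrightarrow> integrable lborel (\<lambda>y. \<bar>ws i t (X t y)\<bar> *\<^sub>R g (X t y))"
    by (rule integrable_cong_AE) (use AE in auto)
  also have "\<dots> \<longleftrightarrow> integrable (distr lborel lborel (X t)) (\<lambda>z. \<bar>ws i t z\<bar> *\<^sub>R g z)"
    using integrable_distr_eq[OF Xm m] by simp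
  finally show "integrable (M i) (\<lambda>y. g (X t y)) \<longleftrightarrow> integrable lborel (\<lambda>z. \<bar>ws i t z\<bar> *\<^sub>R g z)"
    by (simp only: X_preserves[OF t])
qed

lemma label_kernel:
  assumes i: "i \<in> {1..N}" and t: "0 \<le> t"
  shows "integrable (M i) (\<lambda>y. norm (biot_savart (z - X t y)) powr (1 + \<theta>))"
    "(\<integral>y. norm (biot_savart (z - X t y)) powr (1 + \<theta>) \<partial>M i) \<le> B"
proof -
  have m: "(\<lambda>y. norm (biot_savart (z - y)) powr (1 + \<theta>)) \<in> borel_measurable borel" by measurable
  note k = kernel[unfolded kernel_bound_def, THEN conjunct2, THEN conjunct2,
      rule_format, OF ws_Lp[OF i t] ws_mass(1)[OF i t], of z]
  show "integrable (M i) (\<lambda>y. norm (biot_savart (z - X t y)) powr (1 + \<theta>))"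
    using k label_integral(2)[OF i t m] by (simp add: mult.commute)
  have "(\<integral>y. norm (biot_savart (z - X t y)) powr (1 + \<theta>) \<partial>M i)
      = (\<integral>y. norm (biot_savart (z - y)) powr (1 + \<theta>) * \<bar>ws i t y\<bar> \<partial>lborel)"
    using label_integral(1)[OF i t m] by (simp add: mult.commute)
  also have "\<dots> \<le> B" using k ws_Lp_bound[OF i t] ws_mass(2)[OF i t] a_le_A[OF i] by (simp add: B_def)
  finally show "(\<integral>y. norm (biot_savart (z - X t y)) powr (1 + \<theta>) \<partial>M i) \<le> B" .
qed

lemma label_kernel_integrable:
  assumes i: "i \<in> {1..N}" and t: "0 \<le> t"
  shows "integrable (M i) (\<lambda>y. biot_savart (z - X t y))"
proof -
  interpret finite_measure "M i" by (rule M_finite[OF i])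
  note [measurable] = X_measurable[OF t]
  have dom: "integrable (M i) (\<lambda>y. norm (biot_savart (z - X t y)) powr (1 + \<theta>) + 1)"
    using label_kernel(1)[OF i t] by auto
  have "norm (biot_savart (z - X t y)) \<le> norm (biot_savart (z - X t y)) powr (1 + \<theta>) + 1" for y
    using le_powr_interpolate[of "norm (biot_savart (z - X t y))" 1 \<theta>] \<theta> by simp
  then show ?thesis
    by (intro Bochner_Integration.integrable_bound[OF dom]) (auto intro!: AE_I2)
qed

lemma velocity_eq:
  assumes t: "0 \<le> t"
  shows "velocity (w t) z = (\<Sum>j\<in>{1..N}. sgn (a j) *\<^sub>R (\<integral>y. biot_savart (z - X t y) \<partial>M j))"
proof -
  note [measurable] = w_measurable[OF t] ws_measurable
  have m: "(\<lambda>y. biot_savart (z - y)) \<in> borel_measurable borel" by measurable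
  have int: "integrable lborel (\<lambda>y. \<bar>ws j t y\<bar> *\<^sub>R biot_savart (z - y))" if "j \<in> {1..N}" for j
    using label_integral(2)[OF that t m] label_kernel_integrable[OF that t] by simp
  have "AE y in lborel. w t y = (\<Sum>j\<in>{1..N}. ws j t y)"
    using evolution t unfolding euler_evolution_def by blast
  moreover have "AE y in lborel. \<forall>j\<in>{1..N}. ws j t y = sgn (a j) * \<bar>ws j t y\<bar>"
    using ws_mass(3)[OF _ t] by (subst AE_finite_all) auto
  ultimately have AE: "AE y in lborel. w t y *\<^sub>R biot_savart (z - y)
      = (\<Sum>j\<in>{1..N}. sgn (a j) *\<^sub>R (\<bar>ws j t y\<bar> *\<^sub>R biot_savart (z - y)))"
  proof eventually_elim
    case (elim y)
    have "w t y = (\<Sum>j\<in>{1..N}. sgn (a j) * \<bar>ws j t y\<bar>)"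
      unfolding elim(1) by (rule sum.cong) (use elim(2) in auto)
    then show ?case by (simp add: scaleR_sum_left)
  qed
  have "velocity (w t) z = (\<integral>y. (\<Sum>j\<in>{1..N}. sgn (a j) *\<^sub>R (\<bar>ws j t y\<bar> *\<^sub>R biot_savart (z - y))) \<partial>lborel)"
    unfolding velocity_def
    by (rule integral_cong_AE) (use AE t in \<open>auto intro!: borel_measurable_sum\<close>)
  also have "\<dots> = (\<Sum>j\<in>{1..N}. (\<integral>y. sgn (a j) *\<^sub>R (\<bar>ws j t y\<bar> *\<^sub>R biot_savart (z - y)) \<partial>lborel))"
    using int by (intro Bochner_Integration.integral_sum integrable_scaleR_right) auto
  also have "\<dots> = (\<Sum>j\<in>{1..N}. sgn (a j) *\<^sub>R (\<integral>y. biot_savart (z - X t y) \<partial>M j))"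
  proof (rule sum.cong[OF refl])
    fix j assume j: "j \<in> {1..N}"
    have "(\<integral>y. sgn (a j) *\<^sub>R (\<bar>ws j t y\<bar> *\<^sub>R biot_savart (z - y)) \<partial>lborel)
        = sgn (a j) *\<^sub>R (\<integral>y. \<bar>ws j t y\<bar> *\<^sub>R biot_savart (z - y) \<partial>lborel)"
      by (rule integral_scaleR_right)
    then show "(\<integral>y. sgn (a j) *\<^sub>R (\<bar>ws j t y\<bar> *\<^sub>R biot_savart (z - y)) \<partial>lborel)
        = sgn (a j) *\<^sub>R (\<integral>y. biot_savart (z - X t y) \<partial>M j)"
      by (simp only: label_integral(1)[OF j t m])
  qed
  finally show ?thesis .
qed

definition good :: "plane \<Rightarrow> bool" where
  "good x \<longleftrightarrow> (\<forall>t\<ge>0. (\<lambda>s. velocity (w s) (X s x)) absolutely_integrable_on {0..t} \<and>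
        X t x = x + integral {0..t} (\<lambda>s. velocity (w s) (X s x)))"

lemma AE_good: "AE x in lborel. good x"
  using flow by (simp add: lagrangian_flow_def good_def)

lemma good_initial: "good x \<Longrightarrow> X 0 x = x"
  unfolding good_def by (metis add.right_neutral integral_refl order_refl atLeastAtMost_singleton integral_singleton)

lemma trajectory_continuous:
  assumes "good x" "0 \<le> T" shows "continuous_on {0..T} (\<lambda>s. X s x)"
proof -
  have "(\<lambda>s. velocity (w s) (X s x)) integrable_on {0..T}"
    using assms by (auto simp: good_def absolutely_integrable_on_def)
  then have "continuous_on {0..T} (\<lambda>s. x + integral {0..s} (\<lambda>s. velocity (w s) (X s x)))"
    by (intro continuous_intros indefinite_integral_continuous_1)
  moreover have "X s x = x + integral {0..s} (\<lambda>s. velocity (w s) (X s x))" if "s \<in> {0..T}" for s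
    using assms that by (auto simp: good_def)
  ultimately show ?thesis by (intro continuous_on_eq[of "{0..T}" _ "\<lambda>s. X s x"]) auto
qed

definition smooth_velocity :: "real \<Rightarrow> real \<Rightarrow> plane \<Rightarrow> plane" where
  "smooth_velocity \<eta> t z = (\<Sum>j\<in>{1..N}. sgn (a j) *\<^sub>R (\<integral>y. truncated_kernel \<eta> (z - X t y) \<partial>M j))"

lemma truncated_kernel_measurable [measurable]:
  "\<eta> > 0 \<Longrightarrow> truncated_kernel \<eta> \<in> borel_measurable borel"
  by (rule borel_measurable_continuous_onI) (rule continuous_truncated_kernel)

lemma truncated_integrable:
  assumes "j \<in> {1..N}" "\<eta> > 0" "0 \<le> t"
  shows "integrable (M j) (\<lambda>y. truncated_kernel \<eta> (z - X t y))"
proof -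
  interpret finite_measure "M j" by (rule M_finite[OF assms(1)])
  note [measurable] = X_measurable[OF assms(3)] truncated_kernel_measurable[OF assms(2)]
  show ?thesis
    by (rule integrable_const_bound[where B = "1 / \<eta>"]) (use truncated_kernel_bounded[OF assms(2)] in auto)
qed

lemma smooth_velocity_error:
  assumes \<eta>: "\<eta> > 0" and t: "0 \<le> t"
  shows "norm (velocity (w t) z - smooth_velocity \<eta> t z) \<le> real N * B * (2 * pi * \<eta>) powr \<theta>"
proof -
  have one: "norm (\<integral>y. biot_savart (z - X t y) - truncated_kernel \<eta> (z - X t y) \<partial>M j) \<le> B * (2 * pi * \<eta>) powr \<theta>"
    if j: "j \<in> {1..N}" for j
  proof -
    have "norm (\<integral>y. biot_savart (z - X t y) - truncated_kernel \<eta> (z - X t y) \<partial>M j)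
        \<le> (\<integral>y. norm (biot_savart (z - X t y) - truncated_kernel \<eta> (z - X t y)) \<partial>M j)"
      by (rule integral_norm_bound)
    also have "\<dots> \<le> (\<integral>y. norm (biot_savart (z - X t y)) powr (1 + \<theta>) * (2 * pi * \<eta>) powr \<theta> \<partial>M j)"
      using label_kernel_integrable[OF j t] truncated_integrable[OF j \<eta> t] label_kernel(1)[OF j t]
        truncated_kernel_error[OF \<eta> \<theta>]
      by (intro integral_mono integrable_norm Bochner_Integration.integrable_diff integrable_mult_left) auto
    also have "\<dots> = (\<integral>y. norm (biot_savart (z - X t y)) powr (1 + \<theta>) \<partial>M j) * (2 * pi * \<eta>) powr \<theta>" by simp
    also have "\<dots> \<le> B * (2 * pi * \<eta>) powr \<theta>" using label_kernel(2)[OF j t] by (intro mult_right_mono) auto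
    finally show ?thesis .
  qed
  have "velocity (w t) z - smooth_velocity \<eta> t z = (\<Sum>j\<in>{1..N}. sgn (a j) *\<^sub>R
      (\<integral>y. biot_savart (z - X t y) - truncated_kernel \<eta> (z - X t y) \<partial>M j))"
    unfolding velocity_eq[OF t] smooth_velocity_def sum_subtractf[symmetric]
  proof (rule sum.cong[OF refl])
    fix j assume j: "j \<in> {1..N}"
    have "(\<integral>y. biot_savart (z - X t y) - truncated_kernel \<eta> (z - X t y) \<partial>M j)
        = (\<integral>y. biot_savart (z - X t y) \<partial>M j) - (\<integral>y. truncated_kernel \<eta> (z - X t y) \<partial>M j)"
      by (rule Bochner_Integration.integral_diff[OF label_kernel_integrable[OF j t] truncated_integrable[OF j \<eta> t]])
    then show "sgn (a j) *\<^sub>R (\<integral>y. biot_savart (z - X t y) \<partial>M j) - sgn (a j) *\<^sub>R (\<integral>y. truncated_kernel \<eta> (z - X t y) \<partial>M j)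
        = sgn (a j) *\<^sub>R (\<integral>y. biot_savart (z - X t y) - truncated_kernel \<eta> (z - X t y) \<partial>M j)"
      by (simp only: scaleR_diff_right)
  qed
  also have "norm \<dots> \<le> (\<Sum>j\<in>{1..N}. norm (sgn (a j) *\<^sub>R
      (\<integral>y. biot_savart (z - X t y) - truncated_kernel \<eta> (z - X t y) \<partial>M j)))" by (rule norm_sum)
  also have "\<dots> \<le> (\<Sum>j\<in>{1..N}. B * (2 * pi * \<eta>) powr \<theta>)"
  proof (rule sum_mono)
    fix j assume j: "j \<in> {1..N}"
    have "\<bar>sgn (a j)\<bar> = 1" using a_nonzero[OF j] by (simp add: abs_sgn_eq)
    then show "norm (sgn (a j) *\<^sub>R (\<integral>y. biot_savart (z - X t y) - truncated_kernel \<eta> (z - X t y) \<partial>M j))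
        \<le> B * (2 * pi * \<eta>) powr \<theta>" using one[OF j] by simp
  qed
  also have "\<dots> = real N * B * (2 * pi * \<eta>) powr \<theta>" by simp
  finally show ?thesis .
qed

text \<open>The truncated kernel is bounded and continuous, so dominated convergence over the labels applies.\<close>

lemma smooth_velocity_continuous:
  assumes x: "good x" and \<eta>: "\<eta> > 0" and T: "0 \<le> T"
  shows "continuous_on {0..T} (\<lambda>t. smooth_velocity \<eta> t (X t x))"
  unfolding smooth_velocity_def
proof (intro continuous_on_sum continuous_on_scaleR continuous_on_const)
  fix j assume j: "j \<in> {1..N}"
  interpret finite_measure "M j" by (rule M_finite[OF j])
  note [measurable] = truncated_kernel_measurable[OF \<eta>] X_measurable
  show "continuous_on {0..T} (\<lambda>t. \<integral>y. truncated_kernel \<eta> (X t x - X t y) \<partial>M j)"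
    unfolding continuous_on_sequentially comp_def
  proof (intro allI ballI impI)
    fix S t assume t: "t \<in> {0..T}" and S: "(\<forall>n. S n \<in> {0..T}) \<and> S \<longlonglongrightarrow> t"
    show "(\<lambda>n. \<integral>y. truncated_kernel \<eta> (X (S n) x - X (S n) y) \<partial>M j)
        \<longlonglongrightarrow> (\<integral>y. truncated_kernel \<eta> (X t x - X t y) \<partial>M j)"
    proof (rule integral_dominated_convergence[where w = "\<lambda>y. 1 / \<eta>"])
      show "AE y in M j. (\<lambda>n. truncated_kernel \<eta> (X (S n) x - X (S n) y))
          \<longlonglongrightarrow> truncated_kernel \<eta> (X t x - X t y)"
        unfolding M_AE[OF j]
        using AE_good
      proof eventually_elim
        case (elim y)
        have "(\<lambda>n. X (S n) x - X (S n) y) \<longlonglongrightarrow> X t x - X t y"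
          using trajectory_continuous[OF x T] trajectory_continuous[OF elim T] S t
          by (intro tendsto_diff) (auto simp: continuous_on_sequentially comp_def)
        moreover have "isCont (truncated_kernel \<eta>) (X t x - X t y)"
          using continuous_truncated_kernel[OF \<eta>] by (simp add: continuous_on_eq_continuous_at)
        ultimately show ?case by (auto intro: isCont_tendsto_compose)
      qed
      show "AE y in M j. norm (truncated_kernel \<eta> (X (S n) x - X (S n) y)) \<le> 1 / \<eta>" for n
        using truncated_kernel_bounded[OF \<eta>] by auto
      show "(\<lambda>y. truncated_kernel \<eta> (X t x - X t y)) \<in> borel_measurable (M j)"
      proof -
        have "0 \<le> t" using t by auto
        note [measurable] = X_measurable[OF this]
        show ?thesis by measurable
      qed
      show "(\<lambda>y. truncated_kernel \<eta> (X (S n) x - X (S n) y)) \<in> borel_measurable (M j)" for n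
      proof -
        have "0 \<le> S n" using S by auto
        note [measurable] = X_measurable[OF this]
        show ?thesis by measurable
      qed
    qed simp
  qed
qed

text \<open>By \<open>smooth_velocity_error\<close> the velocity along a trajectory is a uniform limit of continuous
  functions of time.\<close>

lemma trajectory_C1:
  assumes x: "good x" and T: "0 \<le> T" and t: "t \<in> {0..T}"
  shows "((\<lambda>t. X t x) has_vector_derivative velocity (w t) (X t x)) (at t within {0..T})"
proof -
  define F where "F s = velocity (w s) (X s x)" for s
  define \<eta> where "\<eta> n = 1 / real (Suc n)" for n
  have \<eta>: "\<eta> n > 0" for n by (simp add: \<eta>_def)
  have lim: "(\<lambda>n. real N * B * (2 * pi * \<eta> n) powr \<theta>) \<longlonglongrightarrow> real N * B * (2 * pi * 0) powr \<theta>"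
  proof (intro tendsto_intros tendsto_powr')
    show "\<eta> \<longlonglongrightarrow> 0" unfolding \<eta>_def using LIMSEQ_inverse_real_of_nat by (simp add: inverse_eq_divide)
  qed (use \<theta> \<eta> in \<open>auto intro!: always_eventually mult_nonneg_nonneg less_imp_le\<close>)
  have "uniform_limit {0..T} (\<lambda>n s. smooth_velocity (\<eta> n) s (X s x)) F sequentially"
    unfolding uniform_limit_iff
  proof (intro allI impI)
    fix e :: real assume "e > 0"
    then have "\<forall>\<^sub>F n in sequentially. real N * B * (2 * pi * \<eta> n) powr \<theta> < e"
      using lim by (intro order_tendstoD(2)) auto
    then show "\<forall>\<^sub>F n in sequentially. \<forall>s\<in>{0..T}. dist (smooth_velocity (\<eta> n) s (X s x)) (F s) < e"
    proof eventually_elim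
      case (elim n)
      show ?case
      proof
        fix s assume "s \<in> {0..T}"
        then have "norm (F s - smooth_velocity (\<eta> n) s (X s x)) \<le> real N * B * (2 * pi * \<eta> n) powr \<theta>"
          unfolding F_def by (intro smooth_velocity_error \<eta>) auto
        then show "dist (smooth_velocity (\<eta> n) s (X s x)) (F s) < e"
          using elim by (simp add: dist_norm norm_minus_commute)
      qed
    qed
  qed
  then have cont: "continuous_on {0..T} F"
    by (rule uniform_limit_theorem[rotated])
      (use smooth_velocity_continuous[OF x \<eta> T] in auto)
  have "((\<lambda>t. integral {0..t} F) has_vector_derivative F t) (at t within {0..T})"
    by (rule integral_has_vector_derivative[OF cont t])
  then have "((\<lambda>t. x + integral {0..t} F) has_vector_derivative F t) (at t within {0..T})"
    using has_vector_derivative_add[OF has_vector_derivative_const] by fastforce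
  then have "((\<lambda>t. X t x) has_vector_derivative F t) (at t within {0..T})"
  proof (rule has_vector_derivative_transform[OF t, rotated])
    fix s assume "s \<in> {0..T}"
    moreover have "F = (\<lambda>s. velocity (w s) (X s x))" by (simp add: F_def fun_eq_iff)
    ultimately show "X s x = x + integral {0..s} F" using x by (simp add: good_def)
  qed
  then show ?thesis by (simp add: F_def)
qed

lemma vortex_blobs_axioms:
  assumes Y: "point_vortex_solution N a Y0 T Y" and T: "0 < T" "T \<le> 1"
    and A0: "0 < A" and d: "0 < d" "R + \<epsilon> \<le> d / 100" "30 * A * T \<le> d\<^sup>2"
    and sep: "\<And>i j t. i \<in> {1..N} \<Longrightarrow> j \<in> {1..N} \<Longrightarrow> i \<noteq> j \<Longrightarrow> t \<in> {0..T} \<Longrightarrow>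
             3 * d / 4 \<le> norm (Y i t - Y j t)"
  shows "vortex_blobs {1..N} M (\<lambda>i. sgn (a i)) X Y T A d \<theta> B \<epsilon>"
proof (rule vortex_blobs.intro)
  show "finite {1..N}" by simp
  show "finite_measure (M i)" if "i \<in> {1..N}" for i by (rule M_finite[OF that])
  show "X t \<in> borel_measurable (M i)" if "t \<in> {0..T}" "i \<in> {1..N}" for t i
    using X_measurable[of t] that by simp
  show "\<bar>sgn (a i)\<bar> = 1" if "i \<in> {1..N}" for i using a_nonzero[OF that] by (simp add: abs_sgn_eq)
  show "(\<Sum>i\<in>{1..N}. measure (M i) (space (M i))) \<le> A" using A M_finite(2) by simp
  show "integrable (M j) (\<lambda>y. norm (biot_savart (z - X t y)) powr (1 + \<theta>)) \<and>
      (\<integral>y. norm (biot_savart (z - X t y)) powr (1 + \<theta>) \<partial>M j) \<le> B"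
    if "t \<in> {0..T}" "j \<in> {1..N}" for t j z
    using label_kernel[OF that(2), of t z] that(1) by auto
  show "AE x in M i. \<forall>t\<in>{0..T}. ((\<lambda>t. X t x) has_vector_derivative
      (\<Sum>j\<in>{1..N}. sgn (a j) *\<^sub>R (\<integral>y. biot_savart (X t x - X t y) \<partial>M j))) (at t within {0..T})"
    if i: "i \<in> {1..N}" for i
    unfolding M_AE[OF i] using AE_good
  proof eventually_elim
    case (elim x)
    show ?case
    proof (intro impI ballI)
      fix t assume t: "t \<in> {0..T}"
      then have t0: "0 \<le> t" by auto
      show "((\<lambda>t. X t x) has_vector_derivative
          (\<Sum>j\<in>{1..N}. sgn (a j) *\<^sub>R (\<integral>y. biot_savart (X t x - X t y) \<partial>M j))) (at t within {0..T})"
        using trajectory_C1[OF elim _ t] T unfolding velocity_eq[OF t0] by simp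
    qed
  qed
  have eq: "sgn (a j) * measure (M j) (space (M j)) = a j" if "j \<in> {1..N}" for j
    using M_finite(2)[OF that] by (simp add: sgn_mult_abs)
  show "(Y i has_vector_derivative (\<Sum>j\<in>{1..N} - {i}. (sgn (a j) * measure (M j) (space (M j))) *\<^sub>R
      biot_savart (Y i t - Y j t))) (at t within {0..T})" if "i \<in> {1..N}" "t \<in> {0..T}" for i t
  proof -
    have "(\<Sum>j\<in>{1..N} - {i}. (sgn (a j) * measure (M j) (space (M j))) *\<^sub>R biot_savart (Y i t - Y j t))
        = (\<Sum>j\<in>{1..N} - {i}. a j *\<^sub>R biot_savart (Y i t - Y j t))"
      by (rule sum.cong[OF refl]) (use eq in auto)
    then show ?thesis using Y that by (simp only: point_vortex_solution_def)
  qed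
  have Yinit: "Y i 0 = Y0 i" if "i \<in> {1..N}" for i using Y that by (auto simp: point_vortex_solution_def)
  have mom: "(\<integral>x. (norm (X 0 x - Y i 0))\<^sup>2 \<partial>M i) \<le> \<bar>a i\<bar> * \<epsilon>\<^sup>2" if i: "i \<in> {1..N}" for i
  proof -
    note [measurable] = X_measurable[of 0, simplified] w0_measurable[OF i]
    have "(\<integral>x. (norm (X 0 x - Y i 0))\<^sup>2 \<partial>M i) = (\<integral>x. \<bar>w0 i x\<bar> *\<^sub>R (norm (X 0 x - Y0 i))\<^sup>2 \<partial>lborel)"
      unfolding Yinit[OF i] by (rule M_integral(1)[OF i]) measurable
    also have "\<dots> = (\<integral>x. \<bar>w0 i x\<bar> * (norm (x - Y0 i))\<^sup>2 \<partial>lborel)"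
    proof (rule integral_cong_AE)
      show "AE x in lborel. \<bar>w0 i x\<bar> *\<^sub>R (norm (X 0 x - Y0 i))\<^sup>2 = \<bar>w0 i x\<bar> * (norm (x - Y0 i))\<^sup>2"
        using AE_good by eventually_elim (simp add: good_initial)
    qed auto
    also have "\<dots> \<le> \<bar>a i\<bar> * \<epsilon>\<^sup>2" by (rule w0_moment(2)[OF i])
    finally show ?thesis .
  qed
  have "(\<Sum>i\<in>{1..N}. \<integral>x. (norm (X 0 x - Y i 0))\<^sup>2 \<partial>M i) \<le> (\<Sum>i\<in>{1..N}. \<bar>a i\<bar> * \<epsilon>\<^sup>2)"
    by (rule sum_mono) (rule mom)
  also have "\<dots> = (\<Sum>i\<in>{1..N}. \<bar>a i\<bar>) * \<epsilon>\<^sup>2" by (rule sum_distrib_right[symmetric])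
  also have "\<dots> \<le> A * \<epsilon>\<^sup>2" using A by (intro mult_right_mono) auto
  finally show "(\<Sum>i\<in>{1..N}. \<integral>x. (norm (X 0 x - Y i 0))\<^sup>2 \<partial>M i) \<le> A * \<epsilon>\<^sup>2" .
  show "AE x in M i. norm (X 0 x - Y i 0) \<le> d / 100" if i: "i \<in> {1..N}" for i
    unfolding M_AE[OF i] using AE_good w0_support_near[OF i]
    by eventually_elim (use d Yinit[OF i] in \<open>auto simp: good_initial\<close>)
qed (use T A0 d sep pos \<theta> B_nonneg in auto)

text \<open>A test function is \<open>1\<close>-Lipschitz and the mass of blob \<open>j\<close> is exactly \<open>\<bar>a j\<bar>\<close>, so the difference of
  the two integrals is at most the first moment.\<close>

lemma W1_bound:
  assumes Y: "point_vortex_solution N a Y0 T Y" and T: "0 < T" "T \<le> 1"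
    and A0: "0 < A" and d: "0 < d" "R + \<epsilon> \<le> d / 100" "30 * A * T \<le> d\<^sup>2"
    and sep: "\<And>i j t. i \<in> {1..N} \<Longrightarrow> j \<in> {1..N} \<Longrightarrow> i \<noteq> j \<Longrightarrow> t \<in> {0..T} \<Longrightarrow>
             3 * d / 4 \<le> norm (Y i t - Y j t)"
    and h: "0 < h"
    and small: "2 * (2 * A * \<epsilon> / (d / 100) + d * B * h powr \<theta>
       + d / h * (tail_const A d k * \<epsilon> ^ k / (8 * (d / 100)\<^sup>2) ^ (2 * k))) \<le> 13 * (d / 100)\<^sup>2"
    and t: "t \<in> {0..T}"
  shows "W1 (signed_density (w t)) (signed_dirac_sum {1..N} a (\<lambda>i. Y i t))
           \<le> ereal (A * \<epsilon> * exp (2 * A / d\<^sup>2 * t))"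
proof -
  interpret vb: vortex_blobs "{1..N}" M "\<lambda>i. sgn (a i)" X Y T A d \<theta> B \<epsilon>
    by (rule vortex_blobs_axioms[OF Y T A0 d sep])
  have conf: "vb.confined T"
    by (rule vb.confined_always[OF h]) (use small in \<open>simp add: vb.radial_bound_def\<close>)
  have t0: "0 \<le> t" using t by auto
  note [measurable] = w_measurable[OF t0] ws_measurable[OF _ t0] X_measurable[OF t0]
  have "signed_integral (signed_density (w t)) \<zeta> - signed_integral (signed_dirac_sum {1..N} a (\<lambda>i. Y i t)) \<zeta>
      \<le> vb.first_moment t" if \<zeta>: "W1_test \<zeta>" for \<zeta>
  proof -
    have lip: "\<bar>\<zeta> x - \<zeta> y\<bar> \<le> norm (x - y)" for x y by (rule W1_test_imp_lipschitz[OF \<zeta>])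
    have "continuous_on UNIV \<zeta>"
      using \<zeta> by (auto simp: W1_test_def intro: lipschitz_on_continuous_on)
    then have [measurable]: "\<zeta> \<in> borel_measurable borel" by (rule borel_measurable_continuous_onI)
    have Mi: "integrable (M j) (\<lambda>y. \<zeta> (X t y))" if j: "j \<in> {1..N}" for j
    proof -
      interpret finite_measure "M j" by (rule M_finite[OF j])
      show ?thesis
      proof (rule integrable_const_bound[where B = "\<bar>\<zeta> (Y j t)\<bar> + d / 8"])
        show "AE y in M j. norm (\<zeta> (X t y)) \<le> \<bar>\<zeta> (Y j t)\<bar> + d / 8"
          using vb.\<xi>_bound[OF conf t j]
        proof eventually_elim
          case (elim y)
          then show ?case using lip[of "X t y" "Y j t"] by (simp add: vb.\<xi>_def)
        qed
      qed simp
    qed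
    have int: "integrable lborel (\<lambda>z. \<bar>ws j t z\<bar> * \<zeta> z)" if "j \<in> {1..N}" for j
      using label_integral(2)[OF that t0, of \<zeta>] Mi[OF that] by simp
    have "AE y in lborel. w t y = (\<Sum>j\<in>{1..N}. ws j t y)"
      using evolution t0 unfolding euler_evolution_def by blast
    moreover have "AE y in lborel. \<forall>j\<in>{1..N}. ws j t y = sgn (a j) * \<bar>ws j t y\<bar>"
      using ws_mass(3)[OF _ t0] by (subst AE_finite_all) auto
    ultimately have AE: "AE y in lborel. w t y * \<zeta> y = (\<Sum>j\<in>{1..N}. sgn (a j) * (\<bar>ws j t y\<bar> * \<zeta> y))"
    proof eventually_elim
      case (elim y)
      have "w t y = (\<Sum>j\<in>{1..N}. sgn (a j) * \<bar>ws j t y\<bar>)"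
        unfolding elim(1) by (rule sum.cong) (use elim(2) in auto)
      then show ?case by (simp add: sum_distrib_right mult.assoc)
    qed
    have si: "integrable lborel (\<lambda>y. \<Sum>j\<in>{1..N}. sgn (a j) * (\<bar>ws j t y\<bar> * \<zeta> y))"
      using int by (intro Bochner_Integration.integrable_sum integrable_mult_right) auto
    have rm: "(\<lambda>y. \<Sum>j\<in>{1..N}. sgn (a j) * (\<bar>ws j t y\<bar> * \<zeta> y)) \<in> borel_measurable borel"
      using si by (auto dest: borel_measurable_integrable)
    have wi: "integrable lborel (\<lambda>y. w t y * \<zeta> y)"
      by (subst integrable_cong_AE[OF _ _ AE]) (use si rm in auto)
    have "(\<integral>y. w t y * \<zeta> y \<partial>lborel) = (\<integral>y. (\<Sum>j\<in>{1..N}. sgn (a j) * (\<bar>ws j t y\<bar> * \<zeta> y)) \<partial>lborel)"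
      by (rule integral_cong_AE[OF _ _ AE]) (use rm in auto)
    also have "\<dots> = (\<Sum>j\<in>{1..N}. \<integral>y. sgn (a j) * (\<bar>ws j t y\<bar> * \<zeta> y) \<partial>lborel)"
      using int by (intro Bochner_Integration.integral_sum integrable_mult_right) auto
    also have "\<dots> = (\<Sum>j\<in>{1..N}. sgn (a j) * (\<integral>y. \<zeta> (X t y) \<partial>M j))"
    proof (rule sum.cong[OF refl])
      fix j assume j: "j \<in> {1..N}"
      show "(\<integral>y. sgn (a j) * (\<bar>ws j t y\<bar> * \<zeta> y) \<partial>lborel) = sgn (a j) * (\<integral>y. \<zeta> (X t y) \<partial>M j)"
        using label_integral(1)[OF j t0, of \<zeta>] by simp
    qed
    finally have 1: "signed_integral (signed_density (w t)) \<zeta> = (\<Sum>j\<in>{1..N}. sgn (a j) * (\<integral>y. \<zeta> (X t y) \<partial>M j))"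
      using wi by (subst signed_integral_density) auto
    have 2: "signed_integral (signed_dirac_sum {1..N} a (\<lambda>i. Y i t)) \<zeta> = (\<Sum>j\<in>{1..N}. a j * \<zeta> (Y j t))"
      by (rule signed_integral_dirac_sum) auto
    have "(\<Sum>j\<in>{1..N}. sgn (a j) * (\<integral>y. \<zeta> (X t y) \<partial>M j)) - (\<Sum>j\<in>{1..N}. a j * \<zeta> (Y j t))
        = (\<Sum>j\<in>{1..N}. sgn (a j) * (\<integral>y. \<zeta> (X t y) - \<zeta> (Y j t) \<partial>M j))"
      unfolding sum_subtractf[symmetric]
    proof (rule sum.cong[OF refl])
      fix j assume j: "j \<in> {1..N}"
      interpret finite_measure "M j" by (rule M_finite[OF j])
      have "(\<integral>y. \<zeta> (X t y) - \<zeta> (Y j t) \<partial>M j) = (\<integral>y. \<zeta> (X t y) \<partial>M j) - \<bar>a j\<bar> * \<zeta> (Y j t)"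
        using Mi[OF j] M_finite(2)[OF j] by simp
      then show "sgn (a j) * (\<integral>y. \<zeta> (X t y) \<partial>M j) - a j * \<zeta> (Y j t)
          = sgn (a j) * (\<integral>y. \<zeta> (X t y) - \<zeta> (Y j t) \<partial>M j)"
        by (simp add: right_diff_distrib mult.assoc[symmetric] sgn_mult_abs)
    qed
    also have "\<dots> \<le> (\<Sum>j\<in>{1..N}. \<integral>y. norm (vb.\<xi> j t y) \<partial>M j)"
    proof (rule sum_mono)
      fix j assume j: "j \<in> {1..N}"
      interpret finite_measure "M j" by (rule M_finite[OF j])
      have "sgn (a j) * (\<integral>y. \<zeta> (X t y) - \<zeta> (Y j t) \<partial>M j) \<le> \<bar>\<integral>y. \<zeta> (X t y) - \<zeta> (Y j t) \<partial>M j\<bar>"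
        by (auto simp: sgn_if)
      also have "\<dots> \<le> (\<integral>y. \<bar>\<zeta> (X t y) - \<zeta> (Y j t)\<bar> \<partial>M j)" by (rule integral_abs_bound)
      also have "\<dots> \<le> (\<integral>y. norm (vb.\<xi> j t y) \<partial>M j)"
        by (rule integral_mono) (use Mi[OF j] vb.\<xi>_integrable(1)[OF conf t j] lip in \<open>auto simp: vb.\<xi>_def\<close>)
      finally show "sgn (a j) * (\<integral>y. \<zeta> (X t y) - \<zeta> (Y j t) \<partial>M j) \<le> (\<integral>y. norm (vb.\<xi> j t y) \<partial>M j)" .
    qed
    finally show ?thesis unfolding 1 2 vb.first_moment_def .
  qed
  then show ?thesis
    unfolding W1_def using vb.first_moment_le[OF conf t] by (intro SUP_least) (auto intro: order_trans)
qed

end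

section \<open>The point vortex system\<close>

lemma sum_abs_remove_le:
  fixes a :: "nat \<Rightarrow> real"
  shows "finite I \<Longrightarrow> (\<Sum>j\<in>I - {i}. \<bar>a j\<bar>) \<le> (\<Sum>j\<in>I. \<bar>a j\<bar>)"
  by (intro sum_mono2) auto

lemma separation_stable:
  fixes y y0 :: "nat \<Rightarrow> plane"
  assumes "d \<le> norm (y0 i - y0 j)" "norm (y i - y0 i) \<le> d / 8" "norm (y j - y0 j) \<le> d / 8"
  shows "3 * d / 4 \<le> norm (y i - y j)"
proof -
  have "y0 i - y0 j = (y i - y j) - (y i - y0 i) + (y j - y0 j)" by simp
  then have "norm (y0 i - y0 j) \<le> norm (y i - y j) + norm (y i - y0 i) + norm (y j - y0 j)"
    using norm_triangle_ineq[of "(y i - y j) - (y i - y0 i)" "y j - y0 j"]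
      norm_triangle_ineq4[of "y i - y j" "y i - y0 i"] by simp
  then show ?thesis using assms by linarith
qed

lemma vortex_speed_le:
  fixes y :: "nat \<Rightarrow> plane"
  assumes A: "(\<Sum>j\<in>{1..N}. \<bar>a j\<bar>) \<le> A" and d: "0 < d"
    and sep: "\<And>j. j \<in> {1..N} \<Longrightarrow> j \<noteq> i \<Longrightarrow> 3 * d / 4 \<le> norm (y i - y j)"
  shows "norm (\<Sum>j\<in>{1..N} - {i}. a j *\<^sub>R biot_savart (y i - y j)) \<le> A / d"
proof -
  have "norm (\<Sum>j\<in>{1..N} - {i}. a j *\<^sub>R biot_savart (y i - y j))
      \<le> (\<Sum>j\<in>{1..N} - {i}. norm (a j *\<^sub>R biot_savart (y i - y j)))" by (rule norm_sum)
  also have "\<dots> \<le> (\<Sum>j\<in>{1..N} - {i}. \<bar>a j\<bar> * (1 / d))"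
  proof (rule sum_mono)
    fix j assume "j \<in> {1..N} - {i}"
    then have "norm (biot_savart (y i - y j)) \<le> 1 / d"
      using sep[of j] d by (intro norm_biot_savart_le) auto
    then show "norm (a j *\<^sub>R biot_savart (y i - y j)) \<le> \<bar>a j\<bar> * (1 / d)"
      unfolding norm_scaleR by (rule mult_left_mono) auto
  qed
  also have "\<dots> = (\<Sum>j\<in>{1..N} - {i}. \<bar>a j\<bar>) * (1 / d)" by (rule sum_distrib_right[symmetric])
  also have "\<dots> \<le> A * (1 / d)"
    using sum_abs_remove_le[of "{1..N}" a i] A d by (intro mult_right_mono) auto
  finally show ?thesis by simp
qed

text \<open>An a priori bound for any solution: as long as all vortices are within \<open>d / 8\<close> of their initial
  positions, their speed is at most \<open>A / d\<close>, which over the time \<open>T\<close> takes them at most \<open>d / 16\<close> away.\<close>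

lemma vortex_confinement:
  assumes Y: "point_vortex_solution N a Y0 T Y" and T: "0 \<le> T"
    and A: "(\<Sum>j\<in>{1..N}. \<bar>a j\<bar>) \<le> A" "0 < A" and d: "0 < d" "16 * A * T \<le> d\<^sup>2"
    and sep: "\<And>i j. i \<in> {1..N} \<Longrightarrow> j \<in> {1..N} \<Longrightarrow> i \<noteq> j \<Longrightarrow> d \<le> norm (Y0 i - Y0 j)"
    and t: "t \<in> {0..T}"
  shows "\<forall>i\<in>{1..N}. norm (Y i t - Y0 i) \<le> d / 8"
proof -
  let ?G = "\<lambda>i t. \<Sum>j\<in>{1..N} - {i}. a j *\<^sub>R biot_savart (Y i t - Y j t)"
  have init: "Y i 0 = Y0 i" if "i \<in> {1..N}" for i using Y that by (auto simp: point_vortex_solution_def)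
  have der: "(Y i has_vector_derivative ?G i t) (at t within {0..T})"
    if "i \<in> {1..N}" "t \<in> {0..T}" for i t using Y that by (auto simp: point_vortex_solution_def)
  have "\<exists>\<tau>>0. \<forall>s\<in>{0..T}. \<forall>t\<in>{0..T}. dist s t < \<tau> \<longrightarrow> dist (Y i s) (Y i t) < d / 16"
    if i: "i \<in> {1..N}" for i
  proof -
    have "continuous_on {0..T} (Y i)"
      unfolding continuous_on_eq_continuous_within
      by (intro ballI has_vector_derivative_continuous[OF der[OF i]])
    then have "uniformly_continuous_on {0..T} (Y i)"
      by (rule compact_uniformly_continuous) simp
    then obtain \<tau> where "\<tau> > 0" "\<And>s t. s \<in> {0..T} \<Longrightarrow> t \<in> {0..T} \<Longrightarrow> dist t s < \<tau> \<Longrightarrow> dist (Y i t) (Y i s) < d / 16"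
      using d(1) unfolding uniformly_continuous_on_def by (metis divide_pos_pos zero_less_numeral)
    then show ?thesis by blast
  qed
  then obtain \<tau> where \<tau>: "\<And>i. i \<in> {1..N} \<Longrightarrow> \<tau> i > 0"
    "\<And>i s t. i \<in> {1..N} \<Longrightarrow> s \<in> {0..T} \<Longrightarrow> t \<in> {0..T} \<Longrightarrow> dist s t < \<tau> i \<Longrightarrow> dist (Y i s) (Y i t) < d / 16"
    by metis
  define \<tau>0 where "\<tau>0 = Min (insert 1 (\<tau> ` {1..N})) / 2"
  have min_pos: "Min (insert 1 (\<tau> ` {1..N})) > 0" using \<tau>(1) by (subst Min_gr_iff) auto
  then have \<tau>0: "\<tau>0 > 0" by (simp add: \<tau>0_def)
  have \<tau>0_less: "\<tau>0 < \<tau> i" if "i \<in> {1..N}" for i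
  proof -
    have "Min (insert 1 (\<tau> ` {1..N})) \<le> \<tau> i" using that by (intro Min_le) auto
    then show ?thesis using min_pos unfolding \<tau>0_def by linarith
  qed
  show ?thesis
  proof (rule induct_by_fixed_steps[where P = "\<lambda>t. \<forall>i\<in>{1..N}. norm (Y i t - Y0 i) \<le> d / 8" and \<tau> = \<tau>0 and T = T])
    show "\<forall>i\<in>{1..N}. norm (Y i 0 - Y0 i) \<le> d / 8" using init d by auto
  next
    fix t s assume t: "0 \<le> t" "t \<le> T"
      and prev: "\<And>s. 0 \<le> s \<Longrightarrow> s \<le> t \<Longrightarrow> \<forall>i\<in>{1..N}. norm (Y i s - Y0 i) \<le> d / 8"
      and s: "t \<le> s" "s \<le> t + \<tau>0" "s \<le> T"
    show "\<forall>i\<in>{1..N}. norm (Y i s - Y0 i) \<le> d / 8"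
    proof
      fix i assume i: "i \<in> {1..N}"
      have "norm (Y i t - Y i 0) \<le> (A / d) * norm (t - 0)"
      proof (rule differentiable_bound[of "{0..t}" "Y i" "\<lambda>r h. h *\<^sub>R ?G i r"])
        fix r assume r: "r \<in> {0..t}"
        have "(Y i has_vector_derivative ?G i r) (at r within {0..t})"
          by (rule has_vector_derivative_within_subset[OF der[OF i]]) (use r t in auto)
        then show "(Y i has_derivative (\<lambda>h. h *\<^sub>R ?G i r)) (at r within {0..t})"
          by (simp only: has_vector_derivative_def)
        have "norm (?G i r) \<le> A / d"
        proof (rule vortex_speed_le[where y = "\<lambda>i. Y i r", OF A(1) d(1)])
          fix j assume "j \<in> {1..N}" "j \<noteq> i"
          then show "3 * d / 4 \<le> norm (Y i r - Y j r)"
            using separation_stable[of d Y0 i j "\<lambda>i. Y i r"] sep[of i j] prev[of r] i r by auto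
        qed
        then have "norm (h *\<^sub>R ?G i r) \<le> A / d * norm h" for h :: real
          using mult_left_mono[of "norm (?G i r)" "A / d" "\<bar>h\<bar>"] by (simp add: mult.commute)
        then show "onorm (\<lambda>h. h *\<^sub>R ?G i r) \<le> A / d" by (rule onorm_le)
      qed (use t in auto)
      also have "\<dots> \<le> (A / d) * T" using t A d by (intro mult_left_mono) auto
      also have "\<dots> \<le> d / 16" using d by (simp add: field_simps power2_eq_square)
      finally have 1: "norm (Y i t - Y0 i) \<le> d / 16" using init[OF i] by simp
      have "dist (Y i s) (Y i t) < d / 16"
        using \<tau>(2)[OF i, of s t] \<tau>0_less[OF i] s t by (auto simp: dist_real_def)
      then have "norm (Y i s - Y i t) \<le> d / 16" by (simp add: dist_norm)
      then show "norm (Y i s - Y0 i) \<le> d / 8"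
        using 1 norm_triangle_ineq[of "Y i s - Y i t" "Y i t - Y0 i"] by simp
    qed
  qed (use T \<tau>0 t in auto)
qed

text \<open>Picard iteration takes place in the complete space of bounded continuous functions on
  \<open>real \<times> real\<close>, where the value at \<open>(real i, t)\<close> is the position of vortex \<open>i\<close> at time \<open>t\<close>. The
  hat function fills in the values between integers continuously.\<close>

definition hat :: "real \<Rightarrow> real" where "hat x = max 0 (1 - \<bar>x\<bar>)"

lemma hat_bounds: "0 \<le> hat x" "hat x \<le> 1"
  by (auto simp: hat_def)

lemma hat_nat: "hat (real i - real j) = (if i = j then 1 else 0)"
  by (cases i j rule: linorder_cases) (auto simp: hat_def)

text \<open>Banach's fixed point theorem on the trajectories that stay within \<open>d / 8\<close> of the initial
  positions. There the kernel is Lipschitz; the factor \<open>N + 1\<close> pays for summing all hat functions.\<close>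

lemma vortex_existence:
  assumes T: "0 \<le> T" and A: "(\<Sum>j\<in>{1..N}. \<bar>a j\<bar>) \<le> A" "0 < A"
    and d: "0 < d" "16 * A * T * real (N + 1) \<le> d\<^sup>2"
    and sep: "\<And>i j. i \<in> {1..N} \<Longrightarrow> j \<in> {1..N} \<Longrightarrow> i \<noteq> j \<Longrightarrow> d \<le> norm (Y0 i - Y0 j)"
  shows "\<exists>Y. point_vortex_solution N a Y0 T Y"
proof -
  define cl where "cl t = max 0 (min t T)" for t
  define S :: "((real \<times> real) \<Rightarrow>\<^sub>C plane) set"
    where "S = PiC (real ` {1..N} \<times> UNIV) (\<lambda>x. cball (Y0 (nat \<lfloor>fst x\<rfloor>)) (d / 8))"
  define G where "G f i t = (\<Sum>j\<in>{1..N} - {i}. a j *\<^sub>R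
      biot_savart (f (real i, t) - f (real j, t)))"
    for f :: "(real \<times> real) \<Rightarrow>\<^sub>C plane" and i t
  define H where "H f i t = Y0 i + integral {0..cl t} (G f i)" for f i t
  define F where "F f x = (\<Sum>i\<in>{1..N}. hat (fst x - real i) *\<^sub>R H f i (snd x))" for f x
  have F_nat: "F f (real i, t) = H f i t" if "i \<in> {1..N}" for f i t
  proof -
    have "F f (real i, t) = (\<Sum>j\<in>{1..N}. if i = j then H f j t else 0)"
      unfolding F_def fst_conv snd_conv hat_nat by (rule sum.cong) auto
    then show ?thesis using that by simp
  qed
  have inS: "norm (f (real i, t) - Y0 i) \<le> d / 8" if "f \<in> S" "i \<in> {1..N}" for f i t
  proof -
    have "f (real i, t) \<in> cball (Y0 (nat \<lfloor>fst (real i, t)\<rfloor>)) (d / 8)"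
      using that(1) unfolding S_def mem_PiC_iff by (rule PiE[of _ _ _ "(real i, t)"]) (use that(2) in auto)
    then show ?thesis by (simp add: dist_norm norm_minus_commute)
  qed
  have sepS: "3 * d / 4 \<le> norm (f (real i, t) - f (real j, t))"
    if "f \<in> S" "i \<in> {1..N}" "j \<in> {1..N}" "i \<noteq> j" for f i j t
    using separation_stable[of d Y0 i j "\<lambda>i. f (real i, t)"] sep[of i j] that
      inS[OF that(1), of i t] inS[OF that(1), of j t] by auto
  have cl: "0 \<le> cl t" "cl t \<le> T" for t using T by (auto simp: cl_def)
  have contG: "continuous_on UNIV (G f i)" if f: "f \<in> S" and i: "i \<in> {1..N}" for f i
    unfolding G_def
  proof (intro continuous_on_sum continuous_on_scaleR continuous_on_const)
    fix j assume j: "j \<in> {1..N} - {i}"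
    have c: "continuous_on UNIV (\<lambda>t. f (real k, t))" for k
      by (rule continuous_on_compose2[OF continuous_on_apply_bcontfun[of UNIV f]])
        (auto intro!: continuous_intros)
    have "f (real i, t) - f (real j, t) \<noteq> 0" for t
      using sepS[OF f i, of j t] j d by auto
    then show "continuous_on UNIV (\<lambda>t. biot_savart (f (real i, t) - f (real j, t)))"
      by (intro continuous_on_compose2[OF biot_savart_continuous_on] continuous_on_diff c) auto
  qed
  have Gb: "norm (G f i t) \<le> A / d" if f: "f \<in> S" and i: "i \<in> {1..N}" for f i t
    unfolding G_def
    by (rule vortex_speed_le[where y = "\<lambda>i. f (real i, t)" and i = i, OF A(1) d(1)])
      (use sepS[OF f i] in auto)
  have AT: "16 * A * T \<le> d\<^sup>2"
  proof -
    have "16 * A * T * 1 \<le> 16 * A * T * real (N + 1)" using A T by (intro mult_left_mono) auto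
    then show ?thesis using d by simp
  qed
  have ATd: "A / d * T \<le> d / 8"
  proof -
    have "A / d * T \<le> d / 16" using d AT by (simp add: field_simps power2_eq_square)
    then show ?thesis using d by linarith
  qed
  have Hb: "norm (H f i t - Y0 i) \<le> d / 8" if f: "f \<in> S" and i: "i \<in> {1..N}" for f i t
  proof -
    have "norm (integral {0..cl t} (G f i)) \<le> A / d * (cl t - 0)"
      by (rule integral_bound) (use cl contG[OF f i] Gb[OF f i] in \<open>auto intro: continuous_on_subset\<close>)
    also have "\<dots> \<le> A / d * T" using cl A d by (intro mult_left_mono) auto
    also note ATd
    finally show ?thesis by (simp add: H_def)
  qed
  have Hc: "continuous_on UNIV (H f i)" if f: "f \<in> S" and i: "i \<in> {1..N}" for f i
  proof -
    have "continuous_on {0..T} (\<lambda>t. integral {0..t} (G f i))"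
      by (intro indefinite_integral_continuous_1 integrable_continuous_real
          continuous_on_subset[OF contG[OF f i]]) auto
    then have "continuous_on UNIV (\<lambda>t. integral {0..cl t} (G f i))"
      by (rule continuous_on_compose2) (use cl in \<open>auto simp: cl_def intro!: continuous_intros\<close>)
    then show ?thesis unfolding H_def by (intro continuous_intros)
  qed
  have Fc: "continuous_on UNIV (F f)" if f: "f \<in> S" for f
    unfolding F_def
  proof (intro continuous_on_sum continuous_on_scaleR)
    fix i assume i: "i \<in> {1..N}"
    show "continuous_on UNIV (\<lambda>x :: real \<times> real. hat (fst x - real i))"
      unfolding hat_def by (intro continuous_intros)
    show "continuous_on UNIV (\<lambda>x :: real \<times> real. H f i (snd x))"
      by (rule continuous_on_compose2[OF Hc[OF f i]]) (auto intro: continuous_intros)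
  qed
  have Fbc: "F f \<in> bcontfun" if f: "f \<in> S" for f
  proof (rule bcontfun_normI[OF Fc[OF f]])
    fix x :: "real \<times> real"
    show "norm (F f x) \<le> (\<Sum>i\<in>{1..N}. norm (Y0 i) + d / 8)"
      unfolding F_def
    proof (rule sum_norm_le)
      fix i assume i: "i \<in> {1..N}"
      have "norm (H f i (snd x)) \<le> norm (Y0 i) + d / 8"
        using Hb[OF f i, of "snd x"] norm_triangle_ineq[of "Y0 i" "H f i (snd x) - Y0 i"] by simp
      then have "hat (fst x - real i) * norm (H f i (snd x)) \<le> 1 * (norm (Y0 i) + d / 8)"
        using hat_bounds by (intro mult_mono) auto
      then show "norm (hat (fst x - real i) *\<^sub>R H f i (snd x)) \<le> norm (Y0 i) + d / 8"
        using hat_bounds(1) by simp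
    qed
  qed
  define \<Phi> where "\<Phi> f = Bcontfun (F f)" for f
  have \<Phi>: "apply_bcontfun (\<Phi> f) = F f" if "f \<in> S" for f
    unfolding \<Phi>_def using Fbc[OF that] by (rule Bcontfun_inverse)
  have "\<exists>!f\<in>S. \<Phi> f = f"
  proof (rule Banach_fix[where c = "1 / 8"])
    show "complete S"
      unfolding S_def complete_eq_closed by (rule closed_PiC) auto
    define y where "y x = (\<Sum>i\<in>{1..N}. hat (fst x - real i) *\<^sub>R Y0 i)" for x :: "real \<times> real"
    have "y \<in> bcontfun"
    proof (rule bcontfun_normI)
      show "continuous_on UNIV y" unfolding y_def hat_def by (intro continuous_intros)
      show "norm (y x) \<le> (\<Sum>i\<in>{1..N}. norm (Y0 i))" for x
        unfolding y_def using hat_bounds by (intro sum_norm_le) (auto intro: mult_left_le_one_le)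
    qed
    then have app: "apply_bcontfun (Bcontfun y) = y" by (rule Bcontfun_inverse)
    have "y (real i, t) = Y0 i" if "i \<in> {1..N}" for i t
    proof -
      have "y (real i, t) = (\<Sum>j\<in>{1..N}. if i = j then Y0 j else 0)"
        unfolding y_def fst_conv hat_nat by (rule sum.cong) auto
      then show ?thesis using that by simp
    qed
    then have "Bcontfun y \<in> S" using d unfolding S_def mem_PiC_iff app by auto
    then show "S \<noteq> {}" by auto
    show "\<Phi> ` S \<subseteq> S"
    proof
      fix g assume "g \<in> \<Phi> ` S"
      then obtain f where f: "f \<in> S" "g = \<Phi> f" by auto
      show "g \<in> S" unfolding f(2) S_def mem_PiC_iff \<Phi>[OF f(1)]
        using F_nat Hb[OF f(1)] by (auto simp: dist_norm norm_minus_commute)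
    qed
    show "dist (\<Phi> f) (\<Phi> g) \<le> 1 / 8 * dist f g" if f: "f \<in> S" and g: "g \<in> S" for f g
    proof (rule dist_bound)
      fix x :: "real \<times> real"
      have Hd: "norm (H f i t - H g i t) \<le> A * (2 * dist f g) / d\<^sup>2 * T" if i: "i \<in> {1..N}" for i t
      proof -
        have Gd: "norm (G f i s - G g i s) \<le> A * (2 * dist f g) / d\<^sup>2" for s
        proof -
          have "G f i s - G g i s = (\<Sum>j\<in>{1..N} - {i}. a j *\<^sub>R
              (biot_savart (f (real i, s) - f (real j, s))
               - biot_savart (g (real i, s) - g (real j, s))))"
            by (simp add: G_def sum_subtractf scaleR_diff_right)
          also have "norm \<dots> \<le> (\<Sum>j\<in>{1..N} - {i}. \<bar>a j\<bar> * (2 * dist f g / d\<^sup>2))"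
          proof (rule sum_norm_le)
            fix j assume j: "j \<in> {1..N} - {i}"
            define u v where "u = f (real i, s) - f (real j, s)"
              and "v = g (real i, s) - g (real j, s)"
            have "3 * d / 4 \<le> norm u" "3 * d / 4 \<le> norm v"
              using sepS[OF f i, of j s] sepS[OF g i, of j s] j by (auto simp: u_def v_def)
            then have "norm (biot_savart u - biot_savart v) \<le> norm (u - v) / d\<^sup>2"
              using d by (intro biot_savart_lipschitz) auto
            also have "norm (u - v) \<le> 2 * dist f g"
            proof -
              have "u - v = (f (real i, s) - g (real i, s))
                  - (f (real j, s) - g (real j, s))"
                by (simp add: u_def v_def)
              then have "norm (u - v) \<le> norm (f (real i, s) - g (real i, s))
                  + norm (f (real j, s) - g (real j, s))"
                by (simp only: norm_triangle_ineq4)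
              then show ?thesis
                using dist_bounded[of f "(real i, s)" g] dist_bounded[of f "(real j, s)" g]
                by (simp add: dist_norm)
            qed
            finally have "norm (biot_savart u - biot_savart v) \<le> 2 * dist f g / d\<^sup>2"
              by (simp add: divide_right_mono)
            then show "norm (a j *\<^sub>R (biot_savart (f (real i, s) - f (real j, s))
                - biot_savart (g (real i, s) - g (real j, s))))
                \<le> \<bar>a j\<bar> * (2 * dist f g / d\<^sup>2)"
              unfolding u_def v_def norm_scaleR by (rule mult_left_mono) auto
          qed
          also have "\<dots> = (\<Sum>j\<in>{1..N} - {i}. \<bar>a j\<bar>) * (2 * dist f g / d\<^sup>2)"
            by (rule sum_distrib_right[symmetric])
          also have "\<dots> \<le> A * (2 * dist f g / d\<^sup>2)"
            using sum_abs_remove_le[of "{1..N}" a i] A d by (intro mult_right_mono) auto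
          finally show ?thesis by simp
        qed
        have int: "G h i integrable_on {0..cl t}" if "h \<in> S" for h
          by (intro integrable_continuous_real continuous_on_subset[OF contG[OF that i]]) auto
        have "H f i t - H g i t = integral {0..cl t} (\<lambda>s. G f i s - G g i s)"
          using int[OF f] int[OF g] by (simp add: H_def integral_diff)
        also have "norm \<dots> \<le> A * (2 * dist f g) / d\<^sup>2 * (cl t - 0)"
          by (rule integral_bound)
            (use cl Gd contG[OF f i] contG[OF g i] in \<open>auto intro!: continuous_on_diff intro: continuous_on_subset\<close>)
        also have "\<dots> \<le> A * (2 * dist f g) / d\<^sup>2 * T" using cl A by (intro mult_left_mono) auto
        finally show ?thesis .
      qed
      have "F f x - F g x = (\<Sum>i\<in>{1..N}. hat (fst x - real i) *\<^sub>R (H f i (snd x) - H g i (snd x)))"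
        by (simp add: F_def sum_subtractf scaleR_diff_right)
      also have "norm \<dots> \<le> (\<Sum>i\<in>{1..N}. A * (2 * dist f g) / d\<^sup>2 * T)"
      proof (rule sum_norm_le)
        fix i assume i: "i \<in> {1..N}"
        have "hat (fst x - real i) * norm (H f i (snd x) - H g i (snd x)) \<le> 1 * (A * (2 * dist f g) / d\<^sup>2 * T)"
          using hat_bounds Hd[OF i, of "snd x"] by (intro mult_mono) auto
        then show "norm (hat (fst x - real i) *\<^sub>R (H f i (snd x) - H g i (snd x))) \<le> A * (2 * dist f g) / d\<^sup>2 * T"
          using hat_bounds(1) by simp
      qed
      also have "\<dots> = real N * (A * (2 * dist f g) / d\<^sup>2 * T)" by simp
      also have "\<dots> \<le> real (N + 1) * (A * (2 * dist f g) / d\<^sup>2 * T)"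
        using A T by (intro mult_right_mono) auto
      also have "\<dots> = (16 * A * T * real (N + 1)) / d\<^sup>2 * (dist f g / 8)" by simp
      also have "\<dots> \<le> 1 * (dist f g / 8)" using d by (intro mult_right_mono) (auto simp: divide_le_eq_1)
      finally show "dist (apply_bcontfun (\<Phi> f) x) (apply_bcontfun (\<Phi> g) x) \<le> 1 / 8 * dist f g"
        by (simp add: \<Phi>[OF f] \<Phi>[OF g] dist_norm)
    qed
  qed auto
  then obtain f where f: "f \<in> S" "\<Phi> f = f" by blast
  define Y where "Y i t = f (real i, t)" for i t
  have fix_eq: "Y i t = Y0 i + integral {0..t} (G f i)" if "i \<in> {1..N}" "t \<in> {0..T}" for i t
  proof -
    have "Y i t = F f (real i, t)" using \<Phi>[OF f(1)] f(2) by (simp add: Y_def)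
    then show ?thesis using F_nat[OF that(1)] that(2) by (simp add: H_def cl_def)
  qed
  have "point_vortex_solution N a Y0 T Y"
    unfolding point_vortex_solution_def
  proof (intro conjI ballI)
    show "Y i 0 = Y0 i" if "i \<in> {1..N}" for i using fix_eq[OF that, of 0] T by simp
    show "inj_on (\<lambda>i. Y i t) {1..N}" for t
    proof (rule inj_onI, rule ccontr)
      fix i j assume "i \<in> {1..N}" "j \<in> {1..N}" "Y i t = Y j t" "i \<noteq> j"
      then show False using sepS[OF f(1), of i j t] d by (simp add: Y_def)
    qed
    fix i t assume i: "i \<in> {1..N}" and t: "t \<in> {0..T}"
    have "((\<lambda>t. integral {0..t} (G f i)) has_vector_derivative G f i t) (at t within {0..T})"
      by (rule integral_has_vector_derivative[OF continuous_on_subset[OF contG[OF f(1) i]] t]) simp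
    then have "((\<lambda>t. Y0 i + integral {0..t} (G f i)) has_vector_derivative G f i t) (at t within {0..T})"
      using has_vector_derivative_add[OF has_vector_derivative_const] by fastforce
    then have "(Y i has_vector_derivative G f i t) (at t within {0..T})"
      by (rule has_vector_derivative_transform[OF t, rotated]) (rule fix_eq[OF i])
    then show "(Y i has_vector_derivative (\<Sum>j\<in>{1..N} - {i}. a j *\<^sub>R biot_savart (Y i t - Y j t))) (at t within {0..T})"
      by (simp add: G_def Y_def)
  qed
  then show ?thesis by blast
qed

section \<open>Choice of the constants\<close>

text \<open>The last clause makes \<open>d\<close> the largest such number up to \<open>\<delta>\<close>. It serves to bound \<open>d\<close> from below in
  terms of \<open>\<delta>\<close> as soon as an admissible solution exists.\<close>

lemma minimal_separation:
  fixes Y0 :: "nat \<Rightarrow> plane"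
  assumes "inj_on Y0 {1..N}" "0 < \<delta>"
  obtains d where "0 < d" "d \<le> \<delta>"
    "\<And>i j. i \<in> {1..N} \<Longrightarrow> j \<in> {1..N} \<Longrightarrow> i \<noteq> j \<Longrightarrow> d \<le> norm (Y0 i - Y0 j)"
    "\<And>x. x \<le> \<delta> \<Longrightarrow> \<forall>i\<in>{1..N}. \<forall>j\<in>{1..N}. i \<noteq> j \<longrightarrow> x \<le> norm (Y0 i - Y0 j) \<Longrightarrow> x \<le> d"
proof
  define D where "D = (\<lambda>(i, j). norm (Y0 i - Y0 j)) ` {(i, j). i \<in> {1..N} \<and> j \<in> {1..N} \<and> i \<noteq> j}"
  have "finite {(i, j). i \<in> {1..N} \<and> j \<in> {1..N} \<and> i \<noteq> j}"
    by (rule finite_subset[of _ "{1..N} \<times> {1..N}"]) auto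
  then have fin: "finite (insert \<delta> D)" by (simp add: D_def)
  show "0 < Min (insert \<delta> D)"
  proof -
    have "0 < x" if "x \<in> D" for x
    proof -
      obtain i j where "i \<in> {1..N}" "j \<in> {1..N}" "i \<noteq> j" "x = norm (Y0 i - Y0 j)"
        using \<open>x \<in> D\<close> unfolding D_def by auto
      then show ?thesis using inj_onD[OF assms(1), of i j] by auto
    qed
    then show ?thesis using fin assms(2) by (simp add: Min_gr_iff)
  qed
  show "Min (insert \<delta> D) \<le> \<delta>" using fin by (intro Min_le) auto
  show "Min (insert \<delta> D) \<le> norm (Y0 i - Y0 j)" if "i \<in> {1..N}" "j \<in> {1..N}" "i \<noteq> j" for i j
    using fin that by (intro Min_le) (auto simp: D_def)
  show "x \<le> Min (insert \<delta> D)"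
    if "x \<le> \<delta>" "\<forall>i\<in>{1..N}. \<forall>j\<in>{1..N}. i \<noteq> j \<longrightarrow> x \<le> norm (Y0 i - Y0 j)" for x
    using fin that by (subst Min_ge_iff) (auto simp: D_def)
qed

text \<open>Choose \<open>h = \<epsilon>\<^sup>m\<close> in \<open>radial_bound\<close>, with \<open>m\<close> so large that \<open>h\<^sup>\<theta>\<close> beats the blow-up of the kernel
  bound, and then \<open>k = m + 1\<close>, so that the tail moment beats the factor \<open>1 / h\<close>.\<close>

lemma tail_exponents:
  assumes A: "0 < A" and d: "0 < d" and \<theta>: "0 < \<theta>" and c: "0 \<le> c" and p: "0 < p"
    and \<gamma>: "0 < \<gamma>" and \<Lambda>: "0 < \<Lambda>"
  obtains k :: nat and m :: nat and K :: real where "0 < K"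
    "\<And>\<epsilon>. 0 < \<epsilon> \<Longrightarrow> \<epsilon> \<le> 1 \<Longrightarrow>
      2 * (2 * A * \<epsilon> / (d / 100) + d * (c + (\<Lambda> * \<epsilon> powr (- \<gamma>)) powr p + A) * (\<epsilon> ^ m) powr \<theta>
       + d / \<epsilon> ^ m * (tail_const A d k * \<epsilon> ^ k / (8 * (d / 100)\<^sup>2) ^ (2 * k))) \<le> K * \<epsilon>"
proof -
  obtain m :: nat where m: "(\<gamma> * p + 1) / \<theta> \<le> real m" using real_arch_simple by blast
  then have m': "\<gamma> * p + 1 \<le> real m * \<theta>" using \<theta> by (simp add: pos_divide_le_eq)
  define k where "k = Suc m"
  define K where "K = 2 * (2 * A / (d / 100) + d * (c + \<Lambda> powr p + A)
      + d * tail_const A d k / (8 * (d / 100)\<^sup>2) ^ (2 * k))"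
  have tc: "0 \<le> tail_const A d k" for k using A d by (induction k) auto
  show ?thesis
  proof (rule that)
    have "0 \<le> d * (c + \<Lambda> powr p + A)" using A d c by (intro mult_nonneg_nonneg) auto
    moreover have "0 \<le> d * tail_const A d k / (8 * (d / 100)\<^sup>2) ^ (2 * k)"
      using d tc by (intro divide_nonneg_nonneg mult_nonneg_nonneg) auto
    moreover have "0 < 2 * A / (d / 100)" using A d by simp
    ultimately show "0 < K" unfolding K_def by (intro mult_pos_pos[of 2] add_pos_nonneg) simp_all
    fix \<epsilon> :: real assume \<epsilon>: "0 < \<epsilon>" "\<epsilon> \<le> 1"
    have h: "(\<epsilon> ^ m) powr \<theta> = \<epsilon> powr (real m * \<theta>)"
      using \<epsilon> by (simp add: powr_realpow[symmetric] powr_powr)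
    have le: "\<epsilon> powr e \<le> \<epsilon>" if "1 \<le> e" for e
      using powr_mono'[OF that, of \<epsilon>] \<epsilon> by simp
    have m1: "1 \<le> real m * \<theta>" using m' \<gamma> p by (smt (verit) mult_pos_pos)
    have "(c + (\<Lambda> * \<epsilon> powr (- \<gamma>)) powr p + A) * (\<epsilon> ^ m) powr \<theta>
        = (c + A) * \<epsilon> powr (real m * \<theta>) + \<Lambda> powr p * \<epsilon> powr (real m * \<theta> - \<gamma> * p)"
    proof -
      have 1: "(\<Lambda> * \<epsilon> powr (- \<gamma>)) powr p = \<Lambda> powr p * \<epsilon> powr (- \<gamma> * p)"
        using \<Lambda> by (simp add: powr_mult powr_powr)
      have 2: "\<epsilon> powr (real m * \<theta> - \<gamma> * p) = \<epsilon> powr (- \<gamma> * p) * \<epsilon> powr (real m * \<theta>)"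
        by (simp add: powr_add[symmetric])
      show ?thesis unfolding h 1 2 by (simp only: distrib_right mult.assoc add_ac)
    qed
    also have "\<dots> \<le> (c + A) * \<epsilon> + \<Lambda> powr p * \<epsilon>"
      using m1 m' c A by (intro add_mono mult_left_mono le) auto
    also have "\<dots> = (c + \<Lambda> powr p + A) * \<epsilon>" by (simp add: algebra_simps)
    finally have "d * ((c + (\<Lambda> * \<epsilon> powr (- \<gamma>)) powr p + A) * (\<epsilon> ^ m) powr \<theta>) \<le> d * ((c + \<Lambda> powr p + A) * \<epsilon>)"
      using d by (intro mult_left_mono) auto
    moreover have "d / \<epsilon> ^ m * (tail_const A d k * \<epsilon> ^ k / (8 * (d / 100)\<^sup>2) ^ (2 * k))
        = d * tail_const A d k / (8 * (d / 100)\<^sup>2) ^ (2 * k) * \<epsilon>"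
      using \<epsilon> by (simp add: k_def)
    ultimately show "2 * (2 * A * \<epsilon> / (d / 100) + d * (c + (\<Lambda> * \<epsilon> powr (- \<gamma>)) powr p + A) * (\<epsilon> ^ m) powr \<theta>
       + d / \<epsilon> ^ m * (tail_const A d k * \<epsilon> ^ k / (8 * (d / 100)\<^sup>2) ^ (2 * k))) \<le> K * \<epsilon>"
      unfolding K_def by (simp add: algebra_simps)
  qed
qed

text \<open>If an admissible solution exists then \<open>d \<ge> \<delta> - 2 (R + \<epsilon>)\<close>, and with \<open>R\<close> and \<open>\<epsilon>\<close> at most
  \<open>\<delta> / 400\<close> the blobs start within \<open>d / 100\<close> of the vortices.\<close>

lemma vortex_approximation:
  fixes N :: nat and p \<gamma> \<Lambda> R \<delta> :: real and a :: "nat \<Rightarrow> real" and Y0 :: "nat \<Rightarrow> plane"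
  assumes p: "2 < p" and \<gamma>: "0 < \<gamma>" and \<Lambda>: "0 < \<Lambda>" and R: "0 < R" "R < \<delta>" "R \<le> 1 / 400 * \<delta>"
    and a: "\<forall>i\<in>{1..N}. a i \<noteq> 0" and inj: "inj_on Y0 {1..N}"
  shows "\<exists>\<epsilon>0 T C :: real. 0 < \<epsilon>0 \<and> \<epsilon>0 \<le> 1 \<and> 0 < T \<and> 0 < C \<and>
        (\<exists>Y. point_vortex_solution N a Y0 T Y) \<and>
        (\<forall>Y. point_vortex_solution N a Y0 T Y \<longrightarrow>
          (\<forall>\<epsilon> w0 w ws. 0 < \<epsilon> \<and> \<epsilon> \<le> \<epsilon>0 \<and> admissible_solution N p \<gamma> \<Lambda> R \<delta> a Y0 \<epsilon> w0 w ws \<longrightarrow>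
            (\<forall>t\<in>{0..T}.
              W1 (signed_density (w t)) (signed_dirac_sum {1..N} a (\<lambda>i. Y i t))
                \<le> ereal (C * exp (C * t) * \<epsilon>))))"
proof -
  have \<delta>: "0 < \<delta>" using R by simp
  define A where "A = 1 + (\<Sum>i\<in>{1..N}. \<bar>a i\<bar>)"
  have A: "(\<Sum>i\<in>{1..N}. \<bar>a i\<bar>) \<le> A" "0 < A" by (auto simp: A_def sum_nonneg add_pos_nonneg)
  obtain d where d: "0 < d" "d \<le> \<delta>"
    "\<And>i j. i \<in> {1..N} \<Longrightarrow> j \<in> {1..N} \<Longrightarrow> i \<noteq> j \<Longrightarrow> d \<le> norm (Y0 i - Y0 j)"
    "\<And>x. x \<le> \<delta> \<Longrightarrow> \<forall>i\<in>{1..N}. \<forall>j\<in>{1..N}. i \<noteq> j \<longrightarrow> x \<le> norm (Y0 i - Y0 j) \<Longrightarrow> x \<le> d"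
    by (rule minimal_separation[OF inj \<delta>]) (rule that)
  obtain \<theta> c where kernel: "kernel_bound p \<theta> c"
    using kernel_bound_exists[OF p] by blast
  then have \<theta>: "0 < \<theta>" "0 \<le> c" by (auto simp: kernel_bound_def)
  have p0: "0 < p" using p by simp
  obtain k m K where K: "0 < K" "\<And>\<epsilon>. 0 < \<epsilon> \<Longrightarrow> \<epsilon> \<le> 1 \<Longrightarrow>
      2 * (2 * A * \<epsilon> / (d / 100) + d * (c + (\<Lambda> * \<epsilon> powr (- \<gamma>)) powr p + A) * (\<epsilon> ^ m) powr \<theta>
       + d / \<epsilon> ^ m * (tail_const A d k * \<epsilon> ^ k / (8 * (d / 100)\<^sup>2) ^ (2 * k))) \<le> K * \<epsilon>"
    by (rule tail_exponents[OF A(2) d(1) \<theta> p0 \<gamma> \<Lambda>]) (rule that)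
  define T where "T = min 1 (d\<^sup>2 / (30 * A * real (N + 1)))"
  define \<epsilon>0 where "\<epsilon>0 = min 1 (min (\<delta> / 400) (13 * (d / 100)\<^sup>2 / K))"
  define C where "C = A + 2 * A / d\<^sup>2"
  have T: "0 < T" "T \<le> 1" using d A by (auto simp: T_def)
  have \<epsilon>0: "0 < \<epsilon>0" "\<epsilon>0 \<le> 1" "\<epsilon>0 \<le> \<delta> / 400" "\<epsilon>0 \<le> 13 * (d / 100)\<^sup>2 / K"
    using \<delta> K(1) d by (auto simp: \<epsilon>0_def)
  have "T \<le> d\<^sup>2 / (30 * A * real (N + 1))" by (simp add: T_def)
  then have TN: "30 * A * T * real (N + 1) \<le> d\<^sup>2" using A by (simp add: pos_le_divide_eq mult_ac)
  have "30 * A * T * 1 \<le> 30 * A * T * real (N + 1)" using A T by (intro mult_left_mono) auto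
  then have T30: "30 * A * T \<le> d\<^sup>2" using TN by simp
  have AT0: "0 \<le> A * T" "0 \<le> A * T * real (N + 1)" using A T by auto
  have T16: "16 * A * T \<le> d\<^sup>2" using T30 AT0(1) by linarith
  have T16N: "16 * A * T * real (N + 1) \<le> d\<^sup>2" using TN AT0(2) by linarith
  have C: "0 < C" using A d by (auto simp: C_def intro!: add_pos_nonneg)
  have ex: "\<exists>Y. point_vortex_solution N a Y0 T Y"
    by (rule vortex_existence[OF less_imp_le[OF T(1)] A d(1) T16N d(3)])
  have bound: "W1 (signed_density (w t)) (signed_dirac_sum {1..N} a (\<lambda>i. Y i t)) \<le> ereal (C * exp (C * t) * \<epsilon>)"
    if Y: "point_vortex_solution N a Y0 T Y" and \<epsilon>: "0 < \<epsilon>" "\<epsilon> \<le> \<epsilon>0"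
      and sol: "admissible_solution N p \<gamma> \<Lambda> R \<delta> a Y0 \<epsilon> w0 w ws" and t: "t \<in> {0..T}"
    for Y \<epsilon> w0 w ws t
  proof -
    have adm: "admissible_data N p \<gamma> \<Lambda> R \<delta> a Y0 \<epsilon> w0" and evo: "euler_evolution N p w0 w ws"
      using sol by (auto simp: admissible_solution_def)
    obtain X where X: "lagrangian_flow (\<lambda>t. velocity (w t)) X"
      "transport_solution p (\<lambda>t. velocity (w t)) X w (\<lambda>x. \<Sum>i\<in>{1..N}. w0 i x)"
      "\<forall>i\<in>{1..N}. transport_solution p (\<lambda>t. velocity (w t)) X (ws i) (w0 i)"
      using evo unfolding euler_evolution_def by blast
    interpret bf: blob_flow N p \<gamma> \<Lambda> R \<delta> a Y0 \<epsilon> w0 w ws X \<theta> c A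
    proof (intro blob_flow.intro blob_data.intro blob_flow_axioms.intro)
    qed (use adm evo X p a R \<delta> \<epsilon> \<theta> kernel A in auto)
    have "\<delta> - 2 * (R + \<epsilon>) \<le> d"
    proof (rule d(4))
      show "\<delta> - 2 * (R + \<epsilon>) \<le> \<delta>" using R \<epsilon> by simp
      show "\<forall>i\<in>{1..N}. \<forall>j\<in>{1..N}. i \<noteq> j \<longrightarrow> \<delta> - 2 * (R + \<epsilon>) \<le> norm (Y0 i - Y0 j)"
        using bf.Y0_separated by blast
    qed
    then have sizes: "R + \<epsilon> \<le> d / 100" using R(3) \<epsilon>(2) \<epsilon>0(3) \<delta> by simp
    have sep: "3 * d / 4 \<le> norm (Y i s - Y j s)"
      if "i \<in> {1..N}" "j \<in> {1..N}" "i \<noteq> j" "s \<in> {0..T}" for i j s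
      using separation_stable[of d Y0 i j "\<lambda>i. Y i s"] d(3)[of i j] that
        vortex_confinement[OF Y less_imp_le[OF T(1)] A d(1) T16 d(3) that(4)] by auto
    have "\<epsilon> \<le> 13 * (d / 100)\<^sup>2 / K" using \<epsilon> \<epsilon>0 by simp
    then have "K * \<epsilon> \<le> 13 * (d / 100)\<^sup>2" using K(1) by (simp add: pos_le_divide_eq mult.commute)
    then have small: "2 * (2 * A * \<epsilon> / (d / 100) + d * bf.B * (\<epsilon> ^ m) powr \<theta>
       + d / \<epsilon> ^ m * (tail_const A d k * \<epsilon> ^ k / (8 * (d / 100)\<^sup>2) ^ (2 * k))) \<le> 13 * (d / 100)\<^sup>2"
      unfolding bf.B_def using K(2)[of \<epsilon>] \<epsilon> \<epsilon>0 by (intro order_trans[OF K(2)]) auto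
    have hpos: "0 < \<epsilon> ^ m" using \<epsilon> by simp
    have "W1 (signed_density (w t)) (signed_dirac_sum {1..N} a (\<lambda>i. Y i t))
        \<le> ereal (A * \<epsilon> * exp (2 * A / d\<^sup>2 * t))"
      by (rule bf.W1_bound[OF Y T A(2) d(1) sizes T30 sep hpos small t])
    also have "A * \<epsilon> * exp (2 * A / d\<^sup>2 * t) \<le> C * \<epsilon> * exp (C * t)"
    proof -
      have "A \<le> C" "2 * A / d\<^sup>2 \<le> C" using A(2) by (simp_all add: C_def)
      then show ?thesis using A(2) \<epsilon>(1) t C by (intro mult_mono iffD2[OF exp_le_cancel_iff]) auto
    qed
    finally show ?thesis by (simp add: mult_ac)
  qed
  show ?thesis
  proof (rule exI[of _ \<epsilon>0], rule exI[of _ T], rule exI[of _ C], intro conjI allI impI ballI)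
    fix Y \<epsilon> w0 w ws t
    assume "point_vortex_solution N a Y0 T Y"
      and "0 < \<epsilon> \<and> \<epsilon> \<le> \<epsilon>0 \<and> admissible_solution N p \<gamma> \<Lambda> R \<delta> a Y0 \<epsilon> w0 w ws"
      and "t \<in> {0..T}"
    then show "W1 (signed_density (w t)) (signed_dirac_sum {1..N} a (\<lambda>i. Y i t)) \<le> ereal (C * exp (C * t) * \<epsilon>)"
      by (elim conjE) (rule bound)
  qed (rule \<epsilon>0 T C ex)+
qed

theorem corollary1:
  shows "\<exists>c0 :: real. 0 < c0 \<and> c0 < 1 \<and>
    (\<forall>(N :: nat) (p :: real) (\<gamma> :: real) (\<Lambda> :: real) (R :: real) (\<delta> :: real)
      (a :: nat \<Rightarrow> real) (Y0 :: nat \<Rightarrow> plane).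
      2 < p \<and> 0 < \<gamma> \<and> 0 < \<Lambda> \<and> 0 < R \<and> R < \<delta> \<and>
      (\<forall>i\<in>{1..N}. a i \<noteq> 0) \<and> inj_on Y0 {1..N} \<and> R \<le> c0 * \<delta> \<longrightarrow>
      (\<exists>\<epsilon>0 T C :: real. 0 < \<epsilon>0 \<and> \<epsilon>0 \<le> 1 \<and> 0 < T \<and> 0 < C \<and>
        (\<exists>Y. point_vortex_solution N a Y0 T Y) \<and>
        (\<forall>Y. point_vortex_solution N a Y0 T Y \<longrightarrow>
          (\<forall>\<epsilon> w0 w ws. 0 < \<epsilon> \<and> \<epsilon> \<le> \<epsilon>0 \<and> admissible_solution N p \<gamma> \<Lambda> R \<delta> a Y0 \<epsilon> w0 w ws \<longrightarrow>
            (\<forall>t\<in>{0..T}.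
              W1 (signed_density (w t)) (signed_dirac_sum {1..N} a (\<lambda>i. Y i t))
                \<le> ereal (C * exp (C * t) * \<epsilon>))))))"
  by (rule exI[of _ "1 / 400"], intro conjI allI impI, simp, simp)
    (elim conjE, rule vortex_approximation)

end
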